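(* Let $T>0$, $p\in(2,3)$, and let $(\mathcal{P}^n)_{n\in\mathbb{N}}$, $\mathcal{P}^n=\{0=t^n_0<t^n_1<\cdots<t^n_{N_n}=T\}$, be a sequence of partitions of $[0,T]$. Suppose that $X\colon[0,T]\to\mathbb{R}^d$ satisfies Property (RIE) relative to $p$ and $(\mathcal{P}^n)_{n\in\mathbb{N}}$, and let $\mathbf{X}=(X,\mathbb{X})$ be the canonical rough path lift of $X$. Let $y_0\in\mathbb{R}^k$, $b\in C^2_b(\mathbb{R}^{k+1};\mathbb{R}^k)$, $\sigma\in C^3_b(\mathbb{R}^{k+1};\mathcal{L}(\mathbb{R}^d;\mathbb{R}^k))$. Let $Y$ be the solution of the RDE $$Y_t=y_0+\int_0^t b(s,Y_s)\,\mathrm{d}s+\int_0^t\sigma(s,Y_s)\,\mathrm{d}\mathbf{X}_s,\qquad t\in[0,T],$$ and let $Y^n$ be the Euler approximation $$Y^n_t=y_0+\sum_{i:\,t^n_{i+1}\le t}b(t^n_i,Y^n_{t^n_i})(t^n_{i+1}-t^n_i)+\sum_{i:\,t^n_{i+1}\le t}\sigma(t^n_i,Y^n_{t^n_i})(X_{t^n_{i+1}}-X_{t^n_i}),\qquad t\in[0,T].$$ Then $\|Y^n-Y\|_{p'}\to0$ as $n\to\infty$ for any $p'\in(p,3)$, and the rate of convergence is determined by the estimate $$\|Y^n-Y\|_{p'}\le C\bigg(|\mathcal{P}^n|^{1-\frac1q}+\|X^n-X\|_\infty^{1-\frac{p}{p'}}+\bigg\|\int_0^\cdot X^n_u\otimes\mathrm{d}X_u-\int_0^\cdot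 X_u\otimes\mathrm{d}X_u\bigg\|_\infty^{1-\frac{p}{p'}}\bigg),\qquad n\in\mathbb{N},$$ which holds for any $q\in(1,2)$ such that $\frac1{p'}+\frac1q>1$, where the constant $C$ depends only on $p,p',q,\|b\|_{C^2_b},\|\sigma\|_{C^3_b},T,|X_0|$ and $w(0,T)$, where $w$ is the control function in condition (iii) of Property (RIE).
   Context: Notation. $\Delta_T=\{(s,t)\in[0,T]^2:s\le t\}$; $X_{s,t}=X_t-X_s$; $x\otimes y=(x^iy^j)_{i,j}$. The mesh size of a partition is $|\mathcal{P}|=\max_i|u_{i+1}-u_i|$. A control function is $w\colon\Delta_T\to[0,\infty)$ with $w(s,u)+w(u,t)\le w(s,t)$ for $s\le u\le t$. For a path, $\|X\|_p=(\sup_{\mathcal{P}}\sum_{[u,v]\in\mathcal{P}}|X_v-X_u|^p)^{1/p}$ (supremum over partitions of $[0,T]$) is the $p$-variation, and for two-parameter functions $\|\mathbb{X}\|_r=(\sup_{\mathcal{P}}\sum_{[u,v]\in\mathcal{P}}|\mathbb{X}_{u,v}|^r)^{1/r}$. $D([0,T];E)$ denotes càdlàg paths, $D^p$ those of finite $p$-variation, $D^r_2$ the two-parameter functions on $\Delta_T$, càdlàg in each variable, with $\|\cdot\|_r<\infty$. $C^j_b$ denotes $j$-times differentiable functions which are bounded and continuous together with their derivatives up to order $j$, with $\|f\|_{C^j_b}=\sum_{i=0}^j\|\mathrm{D}^if\|_\infty$. Constants in estimates may additionally depend on the dimensions. Convention: $\frac00:=0$. Property (RIE). Let $p\in(2,3)$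 and let $(\mathcal{P}^n)$ be a sequence of partitions of $[0,T]$ with $|\mathcal{P}^n|\to0$. For $X\in D([0,T];\mathbb{R}^d)$ put $X^n_t=X_T\mathbf{1}_{\{T\}}(t)+\sum_{k=0}^{N_n-1}X_{t^n_k}\mathbf{1}_{[t^n_k,t^n_{k+1})}(t)$. $X$ satisfies Property (RIE) relative to $p$ and $(\mathcal{P}^n)$ if: (i) $X^n\to X$ uniformly; (ii) the Riemann sums $\int_0^tX^n_u\otimes\mathrm{d}X_u:=\sum_{k=0}^{N_n-1}X_{t^n_k}\otimes X_{t^n_k\wedge t,t^n_{k+1}\wedge t}$ converge uniformly in $t\in[0,T]$ to a limit, denoted $\int_0^tX_u\otimes\mathrm{d}X_u$; (iii) there is a control function $w$ such that $$\sup_{(s,t)\in\Delta_T}\frac{|X_{s,t}|^p}{w(s,t)}+\sup_{n\in\mathbb{N}}\sup_{0\le k<\ell\le N_n}\frac{|\int_{t^n_k}^{t^n_\ell}X^n_u\otimes\mathrm{d}X_u-X_{t^n_k}\otimes X_{t^n_k,t^n_\ell}|^{p/2}}{w(t^n_k,t^n_\ell)}\le1.$$ Integrals over $[s,t]$ are differences of those over $[0,t]$ and $[0,s]$. The canonical rough path lift of $X$ is $\mathbf{X}=(X,\mathbb{X})$ with $\mathbb{X}_{s,t}=\int_s^tX_u\otimes\mathrm{d}X_u-X_s\otimes X_{s,t}$; it is known to be a càdlàg $p$-rough path. RDEs. A càdlàg $p$-rough path is a pair $\mathbf{X}=(X,\mathbb{X})$ with $X\in D^p([0,T];\mathbb{R}^d)$,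 $\mathbb{X}\in D^{p/2}_2(\Delta_T;\mathbb{R}^{d\times d})$ and $\mathbb{X}_{s,t}=\mathbb{X}_{s,u}+\mathbb{X}_{u,t}+X_{s,u}\otimes X_{u,t}$. A pair $(F,F')$ is controlled by $X$ if $F\in D^p$, $F'\in D^p$ and $R^F_{s,t}:=F_{s,t}-F'_sX_{s,t}$ lies in $D^{p/2}_2$. The rough integral is $\int_0^tF_s\,\mathrm{d}\mathbf{X}_s=\lim_{|\mathcal{P}|\to0}\sum_{[u,v]\in\mathcal{P}}(F_uX_{u,v}+F'_u\mathbb{X}_{u,v})$ over partitions of $[0,t]$. $Y$ solves the RDE if $(Y,\sigma(\cdot,Y))$ is controlled by $X$ and the equation holds, where the rough integral is that of $\sigma(\cdot,Y)$ with $F'_s=\mathrm{D}_y\sigma(s,Y_s)\sigma(s,Y_s)$; such a solution exists and is unique. *)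

theory Defs
  imports "HOL-Analysis.Analysis"
begin

text \<open>A partition of [a, b] with N subintervals is given by its points t 0, ..., t N; the values
  of t beyond N are irrelevant.  The case N = 0 occurs exactly when a = b.\<close>

definition interval_partition :: "real \<Rightarrow> real \<Rightarrow> nat \<Rightarrow> (nat \<Rightarrow> real) \<Rightarrow> bool" where
  "interval_partition a b N t \<longleftrightarrow> t 0 = a \<and> t N = b \<and> (\<forall>i<N. t i < t (Suc i))"

definition mesh :: "nat \<Rightarrow> (nat \<Rightarrow> real) \<Rightarrow> real" where
  "mesh N t = Max (insert 0 ((\<lambda>i. \<bar>t (Suc i) - t i\<bar>) ` {..<N}))"

definition simplex2 :: "real \<Rightarrow> (real \<times> real) set" where
  "simplex2 T = {(s, t). 0 \<le> s \<and> s \<le> t \<and> t \<le> T}"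

definition control :: "real \<Rightarrow> (real \<Rightarrow> real \<Rightarrow> real) \<Rightarrow> bool" where
  "control T w \<longleftrightarrow> (\<forall>(s, t) \<in> simplex2 T. 0 \<le> w s t)
     \<and> (\<forall>s u t. 0 \<le> s \<and> s \<le> u \<and> u \<le> t \<and> t \<le> T \<longrightarrow> w s u + w u t \<le> w s t)"

definition ennreal_powr :: "ennreal \<Rightarrow> real \<Rightarrow> ennreal" where
  "ennreal_powr x a = (if x = top then top else ennreal (enn2real x powr a))"

definition variation2 :: "real \<Rightarrow> real \<Rightarrow> (real \<Rightarrow> real \<Rightarrow> 'a::real_normed_vector) \<Rightarrow> ennreal" where
  "variation2 r T A = ennreal_powr
     (SUP (N, t) \<in> {(N, t). interval_partition 0 T N t}.
        ennreal (\<Sum>i<N. norm (A (t i) (t (Suc i))) powr r)) (1 / r)"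

definition variation :: "real \<Rightarrow> real \<Rightarrow> (real \<Rightarrow> 'a::real_normed_vector) \<Rightarrow> ennreal" where
  "variation p T X = variation2 p T (\<lambda>s t. X t - X s)"

definition cadlag_on :: "real \<Rightarrow> real \<Rightarrow> (real \<Rightarrow> 'a::topological_space) \<Rightarrow> bool" where
  "cadlag_on a b X \<longleftrightarrow> (\<forall>t. a \<le> t \<and> t < b \<longrightarrow> (X \<longlongrightarrow> X t) (at_right t))
     \<and> (\<forall>t. a < t \<and> t \<le> b \<longrightarrow> (\<exists>l. (X \<longlongrightarrow> l) (at_left t)))"

definition cadlag_finite_variation ::
  "real \<Rightarrow> real \<Rightarrow> (real \<Rightarrow> 'a::real_normed_vector) \<Rightarrow> bool" where
  "cadlag_finite_variation p T X \<longleftrightarrow> cadlag_on 0 T X \<and> variation p T X < top"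

definition cadlag_finite_variation2 ::
  "real \<Rightarrow> real \<Rightarrow> (real \<Rightarrow> real \<Rightarrow> 'a::real_normed_vector) \<Rightarrow> bool" where
  "cadlag_finite_variation2 r T A \<longleftrightarrow>
     (\<forall>s\<in>{0..T}. cadlag_on s T (\<lambda>t. A s t)) \<and> (\<forall>t\<in>{0..T}. cadlag_on 0 t (\<lambda>s. A s t))
     \<and> variation2 r T A < top"

definition sup_norm :: "'a set \<Rightarrow> ('a \<Rightarrow> 'b::real_normed_vector) \<Rightarrow> real" where
  "sup_norm S f = (SUP x\<in>S. norm (f x))"

text \<open>Higher derivatives are iterated Frechet derivatives with values in nested spaces of bounded
  linear maps, carrying the operator norm.  As the type changes with each derivative, the classes
  of order 0 to 3 are separate definitions.\<close>

definition Dblin :: "('a::real_normed_vector \<Rightarrow> 'b::real_normed_vector) \<Rightarrow> 'a \<Rightarrow> 'a \<Rightarrow>\<^sub>L 'b" where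
  "Dblin f x = Blinfun (frechet_derivative f (at x))"

definition C0b :: "('a::real_normed_vector \<Rightarrow> 'b::real_normed_vector) \<Rightarrow> bool" where
  "C0b f \<longleftrightarrow> continuous_on UNIV f \<and> bounded (range f)"

definition C1b :: "('a::real_normed_vector \<Rightarrow> 'b::real_normed_vector) \<Rightarrow> bool" where
  "C1b f \<longleftrightarrow> C0b f \<and> (\<forall>x. f differentiable (at x)) \<and> C0b (Dblin f)"

definition C2b :: "('a::real_normed_vector \<Rightarrow> 'b::real_normed_vector) \<Rightarrow> bool" where
  "C2b f \<longleftrightarrow> C0b f \<and> (\<forall>x. f differentiable (at x)) \<and> C1b (Dblin f)"

definition C3b :: "('a::real_normed_vector \<Rightarrow> 'b::real_normed_vector) \<Rightarrow> bool" where
  "C3b f \<longleftrightarrow> C0b f \<and> (\<forall>x. f differentiable (at x)) \<and> C2b (Dblin f)"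

definition C2b_norm :: "('a::real_normed_vector \<Rightarrow> 'b::real_normed_vector) \<Rightarrow> real" where
  "C2b_norm f = sup_norm UNIV f + sup_norm UNIV (Dblin f) + sup_norm UNIV (Dblin (Dblin f))"

definition C3b_norm :: "('a::real_normed_vector \<Rightarrow> 'b::real_normed_vector) \<Rightarrow> real" where
  "C3b_norm f = sup_norm UNIV f + sup_norm UNIV (Dblin f) + sup_norm UNIV (Dblin (Dblin f))
     + sup_norm UNIV (Dblin (Dblin (Dblin f)))"

definition tensor :: "real^'d \<Rightarrow> real^'d \<Rightarrow> real^'d^'d" (infixl \<open>\<otimes>\<^sub>v\<close> 70) where
  "x \<otimes>\<^sub>v y = (\<chi> i j. x $ i * y $ j)"

definition discretization :: "real \<Rightarrow> nat \<Rightarrow> (nat \<Rightarrow> real) \<Rightarrow> (real \<Rightarrow> real^'d) \<Rightarrow> real \<Rightarrow> real^'d" where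
  "discretization T N \<tau> X t = indicat_real {T} t *\<^sub>R X T
     + (\<Sum>k<N. indicat_real {\<tau> k..<\<tau> (Suc k)} t *\<^sub>R X (\<tau> k))"

definition riemann_sum :: "nat \<Rightarrow> (nat \<Rightarrow> real) \<Rightarrow> (real \<Rightarrow> real^'d) \<Rightarrow> real \<Rightarrow> real^'d^'d" where
  "riemann_sum N \<tau> X t = (\<Sum>k<N. X (\<tau> k) \<otimes>\<^sub>v (X (min (\<tau> (Suc k)) t) - X (min (\<tau> k) t)))"

text \<open>The quotients are formed in ennreal, where 0 / 0 = 0, but a / 0 is infinite for a > 0
  (whereas it is 0 in the reals).\<close>

definition RIE_control ::
  "real \<Rightarrow> real \<Rightarrow> (nat \<Rightarrow> nat) \<Rightarrow> (nat \<Rightarrow> nat \<Rightarrow> real) \<Rightarrow> (real \<Rightarrow> real^'d)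
     \<Rightarrow> (real \<Rightarrow> real \<Rightarrow> real) \<Rightarrow> bool" where
  "RIE_control p T N \<tau> X w \<longleftrightarrow> control T w \<and>
     (SUP (s, t) \<in> simplex2 T. ennreal (norm (X t - X s) powr p) / ennreal (w s t))
     + (SUP n. SUP (k, l) \<in> {(k, l). k < l \<and> l \<le> N n}.
          ennreal (norm (riemann_sum (N n) (\<tau> n) X (\<tau> n l) - riemann_sum (N n) (\<tau> n) X (\<tau> n k)
             - X (\<tau> n k) \<otimes>\<^sub>v (X (\<tau> n l) - X (\<tau> n k))) powr (p / 2))
          / ennreal (w (\<tau> n k) (\<tau> n l))) \<le> 1"

definition property_RIE ::
  "real \<Rightarrow> real \<Rightarrow> (nat \<Rightarrow> nat) \<Rightarrow> (nat \<Rightarrow> nat \<Rightarrow> real) \<Rightarrow> (real \<Rightarrow> real^'d) \<Rightarrow> bool" where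
  "property_RIE p T N \<tau> X \<longleftrightarrow>
     2 < p \<and> p < 3
     \<and> (\<forall>n. interval_partition 0 T (N n) (\<tau> n)) \<and> (\<lambda>n. mesh (N n) (\<tau> n)) \<longlonglongrightarrow> 0
     \<and> cadlag_on 0 T X
     \<and> uniform_limit {0..T} (\<lambda>n. discretization T (N n) (\<tau> n) X) X sequentially
     \<and> (\<exists>I. uniform_limit {0..T} (\<lambda>n. riemann_sum (N n) (\<tau> n) X) I sequentially)
     \<and> (\<exists>w. RIE_control p T N \<tau> X w)"

definition RIE_integral ::
  "(nat \<Rightarrow> nat) \<Rightarrow> (nat \<Rightarrow> nat \<Rightarrow> real) \<Rightarrow> (real \<Rightarrow> real^'d) \<Rightarrow> real \<Rightarrow> real^'d^'d" where
  "RIE_integral N \<tau> X t = lim (\<lambda>n. riemann_sum (N n) (\<tau> n) X t)"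

definition canonical_lift ::
  "(nat \<Rightarrow> nat) \<Rightarrow> (nat \<Rightarrow> nat \<Rightarrow> real) \<Rightarrow> (real \<Rightarrow> real^'d) \<Rightarrow> real \<Rightarrow> real \<Rightarrow> real^'d^'d" where
  "canonical_lift N \<tau> X s t
     = RIE_integral N \<tau> X t - RIE_integral N \<tau> X s - X s \<otimes>\<^sub>v (X t - X s)"

definition controlled_path ::
  "real \<Rightarrow> real \<Rightarrow> (real \<Rightarrow> real^'d) \<Rightarrow> (real \<Rightarrow> 'e::real_normed_vector)
     \<Rightarrow> (real \<Rightarrow> (real^'d) \<Rightarrow>\<^sub>L 'e) \<Rightarrow> bool" where
  "controlled_path p T X F F' \<longleftrightarrow>
     cadlag_finite_variation p T F \<and> cadlag_finite_variation p T F'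
     \<and> cadlag_finite_variation2 (p / 2) T (\<lambda>s t. F t - F s - F' s (X t - X s))"

text \<open>A map G with values in linear maps acts on matrices by G (x \<open>\<otimes>\<^sub>v\<close> y) = (G x) y, extended
  linearly: the first index of the second-level path belongs to the integrand.\<close>

definition apply_matrix ::
  "((real^'d) \<Rightarrow>\<^sub>L (real^'d) \<Rightarrow>\<^sub>L (real^'k)) \<Rightarrow> real^'d^'d \<Rightarrow> real^'k" where
  "apply_matrix G A = (\<Sum>i\<in>UNIV. \<Sum>j\<in>UNIV. (A $ i $ j) *\<^sub>R G (axis i 1) (axis j 1))"

definition has_rough_integral ::
  "(real \<Rightarrow> real^'d) \<Rightarrow> (real \<Rightarrow> real \<Rightarrow> real^'d^'d) \<Rightarrow> (real \<Rightarrow> (real^'d) \<Rightarrow>\<^sub>L (real^'k))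
     \<Rightarrow> (real \<Rightarrow> (real^'d) \<Rightarrow>\<^sub>L (real^'d) \<Rightarrow>\<^sub>L (real^'k)) \<Rightarrow> real \<Rightarrow> real^'k \<Rightarrow> bool" where
  "has_rough_integral X XX F F' t I \<longleftrightarrow>
     (\<forall>\<epsilon>>0. \<exists>\<delta>>0. \<forall>M u. interval_partition 0 t M u \<and> mesh M u < \<delta> \<longrightarrow>
        norm ((\<Sum>i<M. F (u i) (X (u (Suc i)) - X (u i))
                + apply_matrix (F' (u i)) (XX (u i) (u (Suc i)))) - I) < \<epsilon>)"

definition solves_RDE ::
  "real \<Rightarrow> real \<Rightarrow> (real \<Rightarrow> real^'d) \<Rightarrow> (real \<Rightarrow> real \<Rightarrow> real^'d^'d) \<Rightarrow> real^'k
     \<Rightarrow> (real \<times> (real^'k) \<Rightarrow> real^'k) \<Rightarrow> (real \<times> (real^'k) \<Rightarrow> (real^'d) \<Rightarrow>\<^sub>L (real^'k))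
     \<Rightarrow> (real \<Rightarrow> real^'k) \<Rightarrow> bool" where
  "solves_RDE p T X XX y0 b \<sigma> Y \<longleftrightarrow>
     controlled_path p T X Y (\<lambda>s. \<sigma> (s, Y s))
     \<and> (\<forall>t\<in>{0..T}. \<exists>I.
          has_rough_integral X XX (\<lambda>s. \<sigma> (s, Y s))
            (\<lambda>s. Dblin (\<lambda>y. \<sigma> (s, y)) (Y s) o\<^sub>L \<sigma> (s, Y s)) t I
          \<and> Y t = y0 + integral {0..t} (\<lambda>s. b (s, Y s)) + I)"

text \<open>This equation determines the values on [0, T] uniquely, by recursion along the partition.\<close>

definition euler_approximation ::
  "real \<Rightarrow> nat \<Rightarrow> (nat \<Rightarrow> real) \<Rightarrow> (real \<Rightarrow> real^'d) \<Rightarrow> real^'k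
     \<Rightarrow> (real \<times> (real^'k) \<Rightarrow> real^'k) \<Rightarrow> (real \<times> (real^'k) \<Rightarrow> (real^'d) \<Rightarrow>\<^sub>L (real^'k))
     \<Rightarrow> (real \<Rightarrow> real^'k) \<Rightarrow> bool" where
  "euler_approximation T N \<tau> X y0 b \<sigma> Y \<longleftrightarrow>
     (\<forall>t\<in>{0..T}. Y t = y0
        + (\<Sum>i | i < N \<and> \<tau> (Suc i) \<le> t. (\<tau> (Suc i) - \<tau> i) *\<^sub>R b (\<tau> i, Y (\<tau> i)))
        + (\<Sum>i | i < N \<and> \<tau> (Suc i) \<le> t. \<sigma> (\<tau> i, Y (\<tau> i)) (X (\<tau> (Suc i)) - X (\<tau> i))))"

end

theory Submission
  imports Defs
begin

text \<open>The convergence rests on one observation: at the grid points the Euler scheme is an exact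
  one-step scheme of level two.  The discretised driver agrees with X at the grid points, and its second
  level, formed with the Riemann sums instead of their limit, vanishes over a single cell; hence a step of
  the second-order scheme
  \<open>y + b dt + \<sigma> X + (D\<^sub>y \<sigma>) \<sigma> XX\<close> over a cell is just an Euler step.  Along the grid the solution
  and the scheme are therefore driven by the same first level and by second levels that are uniformly
  close, and everything reduces to a stability estimate for such expansions in the sense of Davie.

  The tool is sewing: if the coboundary of a two-parameter function, and its values over single steps, are
  of order \<open>\<theta> > 1\<close> in a control, then so are all its values (\<open>discrete_sewing\<close>).  It is applied to the
  solution on short intervals, to the solution in a cell, and to the error along the grid.

  A solution is expanded as first level plus second level plus drift plus defect.  The defect of a
  rough integral is estimated by the coboundary of its germ, which is linear in the remainder of the solution
  (\<open>defect_bound\<close>); on intervals of small control this yields a bound on the remainder by a constant that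
  depends on nothing but the coefficients and the control (\<open>remainder_bound\<close>).

  Inside a cell X is close to its left end value, and its second level is close to the one of the
  Riemann sum.  Interpolating the smallness with the variation bounds loses a bit of regularity,
  from p to p', and produces the powers \<open>1 - p/p'\<close> of the two uniform errors; time gives the power
  \<open>1 - 1/q\<close> of the mesh in the same way.  With this small driver the defect over one cell is small
  as well (\<open>defect_of_cell\<close>).

  The error along the grid obeys an expansion of the same kind, whose defect over a cell is the defect
  just estimated.  On blocks of small control, sewing closes the estimate for the error and its defect
  (\<open>block_estimate\<close>), and since the number of blocks is bounded in terms of the control, the error is
  bounded by a multiple of the rate, together with its increments (\<open>err_increment_bound\<close>).  Off the grid,
  only the increments of the solution inside a cell are added.

  Jumps are never excluded.  A coboundary over \<open>s < u < t\<close> sees the remainder over \<open>[s, u]\<close> and the driver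
  over \<open>[u, t]\<close>; the remainder is never needed up to the right end point, where a jump may destroy its
  smallness.  The a priori bound and the bounds for cells therefore start from information on half-open
  intervals only.\<close>

section \<open>Sewing\<close>

definition sewing_const :: "real \<Rightarrow> real" where
  "sewing_const \<theta> = 3 / (1 - 2 powr (1 - \<theta>))"

lemma sewing_const:
  assumes "1 < \<theta>"
  shows "3 \<le> sewing_const \<theta>" "3 + 2 * sewing_const \<theta> * (1/2) powr \<theta> = sewing_const \<theta>"
proof -
  define x :: real where "x = 2 powr (1 - \<theta>)"
  have x: "0 < x" "x < 1"
    using assms by (auto simp: x_def powr_less_one)
  have h: "2 * (1/2) powr \<theta> = x"
    by (simp add: x_def powr_diff powr_divide)
  have s: "sewing_const \<theta> = 3 / (1 - x)"
    by (simp add: sewing_const_def x_def)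
  show "3 \<le> sewing_const \<theta>"
    unfolding s using x by (simp add: field_simps)
  have "3 + 2 * sewing_const \<theta> * (1/2) powr \<theta> = 3 + sewing_const \<theta> * x"
    by (simp flip: h)
  also have "\<dots> = sewing_const \<theta>"
    unfolding s using x by (simp add: field_simps)
  finally show "3 + 2 * sewing_const \<theta> * (1/2) powr \<theta> = sewing_const \<theta>" .
qed

text \<open>Sewing along finitely many points, by induction on their number.  Halving the control makes the two
  halves contribute \<open>2 * (1/2) powr \<theta> < 1\<close> of the claim, and the constant solves the resulting equation
  for the remainder: three terms of size one (two coboundaries and one step) are added in each round.\<close>

lemma discrete_sewing:
  fixes G :: "nat \<Rightarrow> nat \<Rightarrow> 'a::real_normed_vector" and W :: "nat \<Rightarrow> nat \<Rightarrow> real"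
  assumes \<theta>: "1 < \<theta>" and K: "0 \<le> K"
    and W_nonneg: "\<And>i j. a \<le> i \<Longrightarrow> i \<le> j \<Longrightarrow> j \<le> c \<Longrightarrow> 0 \<le> W i j"
    and W_super: "\<And>i j k. a \<le> i \<Longrightarrow> i \<le> j \<Longrightarrow> j \<le> k \<Longrightarrow> k \<le> c \<Longrightarrow> W i j + W j k \<le> W i k"
    and step: "\<And>i. a \<le> i \<Longrightarrow> i < c \<Longrightarrow> norm (G i (Suc i)) \<le> K * W i (Suc i) powr \<theta>"
    and cobound: "\<And>i j k. a \<le> i \<Longrightarrow> i < j \<Longrightarrow> j < k \<Longrightarrow> k \<le> c \<Longrightarrow>
        norm (G i k - G i j - G j k) \<le> K * W i k powr \<theta>"
    and "a \<le> i" "i < j" "j \<le> c"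
  shows "norm (G i j) \<le> sewing_const \<theta> * K * W i j powr \<theta>"
  using \<open>a \<le> i\<close> \<open>i < j\<close> \<open>j \<le> c\<close>
proof (induction "j - i" arbitrary: i j rule: less_induct)
  case less
  define C where "C = sewing_const \<theta>"
  have C: "3 \<le> C" "3 + 2 * C * (1/2) powr \<theta> = C"
    using sewing_const[OF \<theta>] by (auto simp: C_def)
  have mono: "W i' j' \<le> W i j" if "i \<le> i'" "i' \<le> j'" "j' \<le> j" for i' j'
    using W_super[of i i' j'] W_super[of i j' j] W_nonneg[of i i'] W_nonneg[of j' j] that less.prems
    by fastforce
  have le: "K * x powr \<theta> \<le> K * W i j powr \<theta>" if "0 \<le> x" "x \<le> W i j" for x
    using that \<theta> K by (intro mult_left_mono powr_mono2) auto
  have half: "norm (G i' j') \<le> C * K * ((1/2) powr \<theta> * W i j powr \<theta>)"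
    if "i \<le> i'" "i' < j'" "j' \<le> j" "j' - i' < j - i" "W i' j' \<le> W i j / 2" for i' j'
  proof -
    have "norm (G i' j') \<le> C * K * W i' j' powr \<theta>"
      using less.hyps[of j' i'] that less.prems by (simp add: C_def)
    also have "\<dots> \<le> C * K * (1/2 * W i j) powr \<theta>"
      using that \<theta> K C(1) W_nonneg[of i' j'] less.prems by (intro mult_left_mono powr_mono2) auto
    also have "(1/2 * W i j) powr \<theta> = (1/2) powr \<theta> * W i j powr \<theta>"
      by (rule powr_mult)
    finally show ?thesis .
  qed
  show ?case
  proof (cases "j = Suc i")
    case True
    have "norm (G i j) \<le> 1 * (K * W i j powr \<theta>)"
      using step[of i] True less.prems by auto
    also have "\<dots> \<le> C * (K * W i j powr \<theta>)"
      using C K by (intro mult_right_mono) auto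
    finally show ?thesis by (simp add: C_def algebra_simps)
  next
    case False
    \<comment> \<open>Split at the last point m before half of the control is used up: both the block before m
      and the block after the step from m to m + 1 carry at most half of the control.\<close>
    define A where "A = {m. i \<le> m \<and> m < j \<and> W i m \<le> W i j / 2}"
    have "W i i = 0"
      using W_super[of i i i] W_nonneg[of i i] less.prems by auto
    then have iA: "i \<in> A" using less.prems W_nonneg[of i j] by (auto simp: A_def)
    have finA: "finite A" by (rule finite_subset[of _ "{..<j}"]) (auto simp: A_def)
    define m where "m = Max A"
    have mA: "m \<in> A" unfolding m_def using finA iA by (intro Max_in) auto
    then have m: "i \<le> m" "m < j" "W i m \<le> W i j / 2" by (auto simp: A_def)
    have right: "W (Suc m) j \<le> W i j / 2" if "Suc m < j"
    proof -
      have "Suc m \<notin> A" using Max_ge[OF finA, of "Suc m"] unfolding m_def by auto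
      then have "W i (Suc m) > W i j / 2" using that m by (auto simp: A_def)
      then show ?thesis using W_super[of i "Suc m" j] that m less.prems by auto
    qed
    let ?E = "K * W i j powr \<theta>" and ?H = "C * K * ((1/2) powr \<theta> * W i j powr \<theta>)"
    have E0: "0 \<le> ?E" using K by auto
    have H0: "0 \<le> ?H" using K C by auto
    have mj: "norm (G m j) \<le> 2 * ?E + ?H"
    proof (cases "Suc m = j")
      case True
      have "norm (G m j) \<le> K * W m j powr \<theta>" using step[of m] True m less.prems by auto
      also have "\<dots> \<le> ?E" using le[of "W m j"] mono[of m j] W_nonneg[of m j] m less.prems by auto
      finally show ?thesis using E0 H0 by linarith
    next
      case False
      have "G m j = (G m j - G m (Suc m) - G (Suc m) j) + G m (Suc m) + G (Suc m) j" by simp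
      then have "norm (G m j) \<le> norm (G m j - G m (Suc m) - G (Suc m) j) + norm (G m (Suc m)) + norm (G (Suc m) j)"
        by (metis norm_triangle_ineq norm_triangle_mono order_refl)
      moreover have "norm (G m j - G m (Suc m) - G (Suc m) j) \<le> ?E"
        using cobound[of m "Suc m" j] le[of "W m j"] mono[of m j] W_nonneg[of m j] m less.prems False
        by fastforce
      moreover have "norm (G m (Suc m)) \<le> ?E"
        using step[of m] le[of "W m (Suc m)"] mono[of m "Suc m"] W_nonneg[of m "Suc m"] m less.prems False
        by fastforce
      moreover have "norm (G (Suc m) j) \<le> ?H"
        using False m right less.prems by (intro half) auto
      ultimately show ?thesis by linarith
    qed
    have "norm (G i j) \<le> 3 * ?E + 2 * ?H"
    proof (cases "m = i")
      case True
      then show ?thesis using mj E0 H0 by simp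
    next
      case False
      have "G i j = (G i j - G i m - G m j) + G i m + G m j" by simp
      then have "norm (G i j) \<le> norm (G i j - G i m - G m j) + norm (G i m) + norm (G m j)"
        by (metis norm_triangle_ineq norm_triangle_mono order_refl)
      moreover have "norm (G i j - G i m - G m j) \<le> ?E"
        using cobound[of i m j] m False less.prems by auto
      moreover have "norm (G i m) \<le> ?H"
        using False m less.prems by (intro half) auto
      ultimately show ?thesis using mj by linarith
    qed
    also have "\<dots> = (3 + 2 * C * (1/2) powr \<theta>) * K * W i j powr \<theta>"
      by (simp add: algebra_simps)
    finally show ?thesis unfolding C(2) by (simp add: C_def)
  qed
qed

lemma control_nonneg: "control T \<omega> \<Longrightarrow> 0 \<le> s \<Longrightarrow> s \<le> t \<Longrightarrow> t \<le> T \<Longrightarrow> 0 \<le> \<omega> s t"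
  by (auto simp: control_def simplex2_def)

lemma control_add:
  "control T \<omega> \<Longrightarrow> 0 \<le> s \<Longrightarrow> s \<le> u \<Longrightarrow> u \<le> t \<Longrightarrow> t \<le> T \<Longrightarrow> \<omega> s u + \<omega> u t \<le> \<omega> s t"
  by (auto simp: control_def)

lemma control_mono:
  assumes "control T \<omega>" "0 \<le> s" "s \<le> s'" "s' \<le> t'" "t' \<le> t" "t \<le> T"
  shows "\<omega> s' t' \<le> \<omega> s t"
  using control_add[of T \<omega> s s' t'] control_add[of T \<omega> s t' t] control_nonneg[of T \<omega> s s']
    control_nonneg[of T \<omega> t' t] assms by linarith

lemma interval_partition_mono:
  assumes "interval_partition a b N u" "i \<le> j" "j \<le> N"
  shows "u i \<le> u j"
  using \<open>i \<le> j\<close> \<open>j \<le> N\<close>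
proof (induction j rule: dec_induct)
  case (step n)
  then show ?case using assms(1) unfolding interval_partition_def
    by (metis Suc_le_eq dual_order.trans le_SucI less_imp_le not_less_eq_eq)
qed auto

lemma interval_partition_strict_mono:
  assumes "interval_partition a b N u" "i < j" "j \<le> N"
  shows "u i < u j"
proof -
  have "u i < u (Suc i)" using assms by (auto simp: interval_partition_def)
  also have "u (Suc i) \<le> u j" using assms by (intro interval_partition_mono[OF assms(1)]) auto
  finally show ?thesis .
qed

lemma interval_partition_bounds:
  assumes "interval_partition a b N u" "i \<le> N"
  shows "a \<le> u i" "u i \<le> b"
  using interval_partition_mono[OF assms(1), of 0 i] interval_partition_mono[OF assms(1), of i N] assms
  by (auto simp: interval_partition_def)

lemma control_sum_le:
  assumes "control T \<omega>" "0 \<le> s" "t \<le> T" "interval_partition s t M u"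
  shows "(\<Sum>i<M. \<omega> (u i) (u (Suc i))) \<le> \<omega> s t"
proof -
  have "(\<Sum>i<m. \<omega> (u i) (u (Suc i))) \<le> \<omega> s (u m)" if "m \<le> M" for m
    using that
  proof (induction m)
    case 0
    have "u 0 = s" "s \<le> t"
      using assms(4) interval_partition_bounds[OF assms(4), of 0] by (auto simp: interval_partition_def)
    then show ?case using control_nonneg[OF assms(1), of s s] assms by auto
  next
    case (Suc m)
    have "s \<le> u m" "u m \<le> u (Suc m)" "u (Suc m) \<le> T"
      using Suc.prems interval_partition_bounds[OF assms(4)] interval_partition_mono[OF assms(4), of m "Suc m"]
        assms(3) by (auto intro: order.trans)
    then have "\<omega> s (u m) + \<omega> (u m) (u (Suc m)) \<le> \<omega> s (u (Suc m))"
      using control_add[OF assms(1,2)] by auto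
    then show ?case using Suc by auto
  qed
  from this[of M] show ?thesis using assms(4) by (auto simp: interval_partition_def)
qed

lemma sewing:
  fixes \<Xi> :: "real \<Rightarrow> real \<Rightarrow> 'a::real_normed_vector"
  assumes \<theta>: "1 < \<theta>" and K: "0 \<le> K" and ctrl: "control T \<omega>" and st: "0 \<le> s" "s < t" "t \<le> T"
    and cobound: "\<And>x v z. s \<le> x \<Longrightarrow> x < v \<Longrightarrow> v < z \<Longrightarrow> z \<le> t \<Longrightarrow>
        norm (\<Xi> x z - \<Xi> x v - \<Xi> v z) \<le> K * \<omega> x z powr \<theta>"
    and u: "interval_partition s t M u"
  shows "norm ((\<Sum>i<M. \<Xi> (u i) (u (Suc i))) - \<Xi> s t) \<le> sewing_const \<theta> * K * \<omega> s t powr \<theta>"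
proof -
  define G where "G i j = \<Xi> (u i) (u j) - (\<Sum>l=i..<j. \<Xi> (u l) (u (Suc l)))" for i j
  have u0: "u 0 = s" and uM: "u M = t" using u by (auto simp: interval_partition_def)
  have M: "0 < M" using u0 uM st by (cases M) auto
  note bd = interval_partition_bounds[OF u] and mono = interval_partition_mono[OF u]
    and smono = interval_partition_strict_mono[OF u]
  have le: "0 \<le> u i" "u i \<le> T" if "i \<le> M" for i
    using bd[OF that] st by auto
  have "norm (G 0 M) \<le> sewing_const \<theta> * K * \<omega> (u 0) (u M) powr \<theta>"
  proof (rule discrete_sewing[where a = 0 and c = M and W = "\<lambda>i j. \<omega> (u i) (u j)", OF \<theta> K])
    show "0 \<le> \<omega> (u i) (u j)" if "i \<le> j" "j \<le> M" for i j
      using that by (intro control_nonneg[OF ctrl] le mono) auto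
    show "\<omega> (u i) (u j) + \<omega> (u j) (u k) \<le> \<omega> (u i) (u k)" if "i \<le> j" "j \<le> k" "k \<le> M" for i j k
      using that by (intro control_add[OF ctrl] le mono) auto
    show "norm (G i (Suc i)) \<le> K * \<omega> (u i) (u (Suc i)) powr \<theta>" for i
      using K by (auto simp: G_def)
    show "norm (G i k - G i j - G j k) \<le> K * \<omega> (u i) (u k) powr \<theta>" if "i < j" "j < k" "k \<le> M" for i j k
    proof -
      have "(\<Sum>l=i..<k. \<Xi> (u l) (u (Suc l))) = (\<Sum>l=i..<j. \<Xi> (u l) (u (Suc l))) + (\<Sum>l=j..<k. \<Xi> (u l) (u (Suc l)))"
        using that by (simp add: sum.atLeastLessThan_concat)
      then have "G i k - G i j - G j k = \<Xi> (u i) (u k) - \<Xi> (u i) (u j) - \<Xi> (u j) (u k)"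
        by (simp add: G_def)
      then show ?thesis using that bd smono by (auto intro!: cobound)
    qed
  qed (use M in auto)
  then show ?thesis
    by (simp add: G_def u0 uM norm_minus_commute atLeast0LessThan)
qed

section \<open>Calculus of smooth bounded maps\<close>

lemma Dblin_has_derivative:
  "f differentiable (at x) \<Longrightarrow> (f has_derivative blinfun_apply (Dblin f x)) (at x)"
  unfolding Dblin_def
  by (metis bounded_linear_Blinfun_apply frechet_derivative_works has_derivative_bounded_linear)

lemma lipschitz_of_Dblin:
  assumes "\<And>x. f differentiable (at x)" "\<And>x. norm (Dblin f x) \<le> L"
  shows "norm (f x - f y) \<le> L * norm (x - y)"
  by (rule differentiable_bound[of UNIV f "\<lambda>x. blinfun_apply (Dblin f x)"])
    (use assms Dblin_has_derivative in \<open>auto simp flip: norm_blinfun.rep_eq\<close>)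

text \<open>The map \<open>\<lambda>x. f (x + h) - f x\<close> is Lipschitz with a constant proportional to the norm of h.\<close>

lemma rectangular_increment_bound:
  assumes "\<And>x. f differentiable (at x)" "\<And>x y. norm (Dblin f x - Dblin f y) \<le> L * norm (x - y)"
  shows "norm (f (a + h) - f a - f (c + h) + f c) \<le> L * norm (a - c) * norm h"
proof -
  let ?g = "\<lambda>x. f (x + h) - f x"
  have d: "(?g has_derivative blinfun_apply (Dblin f (x + h) - Dblin f x)) (at x)" for x
  proof -
    have "((\<lambda>x. x + h) has_derivative (\<lambda>v. v)) (at x)"
      by (auto intro!: derivative_eq_intros)
    from has_derivative_compose[OF this Dblin_has_derivative[OF assms(1)]]
    have "((\<lambda>x. f (x + h)) has_derivative blinfun_apply (Dblin f (x + h))) (at x)" .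
    then show ?thesis
      using Dblin_has_derivative[OF assms(1), of x]
      by (auto simp: blinfun.diff_left intro!: derivative_eq_intros)
  qed
  have "norm (?g a - ?g c) \<le> (L * norm h) * norm (a - c)"
    by (rule differentiable_bound[of UNIV ?g "\<lambda>x. blinfun_apply (Dblin f (x + h) - Dblin f x)"])
      (use d assms(2)[of "x + h" x for x] in \<open>auto simp flip: norm_blinfun.rep_eq\<close>)
  then show ?thesis by (simp add: algebra_simps)
qed

definition taylor_rest :: "('a::real_normed_vector \<Rightarrow> 'b::real_normed_vector) \<Rightarrow> 'a \<Rightarrow> 'a \<Rightarrow> 'b" where
  "taylor_rest f a h = f (a + h) - f a - Dblin f a h"

text \<open>The derivative of the Taylor rest at x is the increment of the derivative of f between a and \<open>a + x\<close>.\<close>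

lemma taylor_rest_diff_right:
  assumes "\<And>x. f differentiable (at x)" "\<And>x y. norm (Dblin f x - Dblin f y) \<le> L * norm (x - y)"
    and L: "0 \<le> L"
  shows "norm (taylor_rest f a h - taylor_rest f a k) \<le> L * (norm h + norm k) * norm (h - k)"
proof -
  have d: "(taylor_rest f a has_derivative blinfun_apply (Dblin f (a + x) - Dblin f a)) (at x within S)" for x S
  proof -
    have "((\<lambda>x. a + x) has_derivative (\<lambda>v. v)) (at x)"
      by (auto intro!: derivative_eq_intros)
    from has_derivative_compose[OF this Dblin_has_derivative[OF assms(1)]]
    have "((\<lambda>x. f (a + x)) has_derivative blinfun_apply (Dblin f (a + x))) (at x)" .
    then have "(taylor_rest f a has_derivative blinfun_apply (Dblin f (a + x) - Dblin f a)) (at x)"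
      unfolding taylor_rest_def[abs_def]
      by (auto simp: blinfun.diff_left blinfun.bounded_linear_right bounded_linear_imp_has_derivative intro!: derivative_eq_intros)
    then show ?thesis using has_derivative_at_withinI by blast
  qed
  show ?thesis
  proof (rule differentiable_bound[of "cball 0 (norm h + norm k)" "taylor_rest f a" "\<lambda>x. blinfun_apply (Dblin f (a + x) - Dblin f a)"])
    show "onorm (blinfun_apply (Dblin f (a + x) - Dblin f a)) \<le> L * (norm h + norm k)"
      if "x \<in> cball 0 (norm h + norm k)" for x
    proof -
      have "norm (Dblin f (a + x) - Dblin f a) \<le> L * norm x" using assms(2)[of "a + x" a] by simp
      also have "\<dots> \<le> L * (norm h + norm k)" using that L by (intro mult_left_mono) auto
      finally show ?thesis by (simp flip: norm_blinfun.rep_eq)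
    qed
  qed (use d in auto)
qed

lemma taylor_rest_bound:
  assumes "\<And>x. f differentiable (at x)" "\<And>x y. norm (Dblin f x - Dblin f y) \<le> L * norm (x - y)"
    and "0 \<le> L"
  shows "norm (taylor_rest f a h) \<le> L * (norm h)\<^sup>2"
  using taylor_rest_diff_right[OF assms, of a h 0]
  by (simp add: taylor_rest_def power2_eq_square mult.assoc)

text \<open>The base points are compared along the ray \<open>\<theta> h\<close>: the derivative in \<open>\<theta>\<close> is a rectangular
  increment of the first derivative, for which the previous bound is available.\<close>

lemma taylor_rest_diff_left:
  assumes f: "\<And>x. f differentiable (at x)" and Df: "\<And>x. Dblin f differentiable (at x)"
    and D2: "\<And>x y. norm (Dblin (Dblin f) x - Dblin (Dblin f) y) \<le> L * norm (x - y)"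
    and L: "0 \<le> L"
  shows "norm (taylor_rest f a h - taylor_rest f c h) \<le> L * norm (a - c) * (norm h)\<^sup>2"
proof -
  define \<psi> where "\<psi> \<theta> = taylor_rest f a (\<theta> *\<^sub>R h) - taylor_rest f c (\<theta> *\<^sub>R h)" for \<theta> :: real
  define \<psi>' where "\<psi>' \<theta> = (\<lambda>r. r *\<^sub>R (Dblin f (a + \<theta> *\<^sub>R h) - Dblin f a - Dblin f (c + \<theta> *\<^sub>R h) + Dblin f c) h)"
    for \<theta> :: real
  have one: "((\<lambda>\<theta>. taylor_rest f a (\<theta> *\<^sub>R h)) has_derivative
      (\<lambda>r. r *\<^sub>R (Dblin f (a + \<theta> *\<^sub>R h) - Dblin f a) h)) (at \<theta>)" for a \<theta>
  proof -
    have "((\<lambda>\<theta>. a + \<theta> *\<^sub>R h) has_derivative (\<lambda>r. r *\<^sub>R h)) (at \<theta>)"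
      by (auto intro!: derivative_eq_intros)
    from has_derivative_compose[OF this Dblin_has_derivative[OF f, of "a + \<theta> *\<^sub>R h"]]
    have "((\<lambda>\<theta>. f (a + \<theta> *\<^sub>R h)) has_derivative (\<lambda>r. Dblin f (a + \<theta> *\<^sub>R h) (r *\<^sub>R h))) (at \<theta>)" .
    moreover have "((\<lambda>\<theta>. Dblin f a (\<theta> *\<^sub>R h)) has_derivative (\<lambda>r. Dblin f a (r *\<^sub>R h))) (at \<theta>)"
      by (auto simp: blinfun.scaleR_right intro!: derivative_eq_intros)
    ultimately show ?thesis
      unfolding taylor_rest_def
      by (auto simp: blinfun.diff_left blinfun.scaleR_right scaleR_diff_right intro!: derivative_eq_intros)
  qed
  have d: "(\<psi> has_derivative \<psi>' \<theta>) (at \<theta> within {0..1})" for \<theta>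
    unfolding \<psi>_def[abs_def]
    by (rule has_derivative_at_withinI, rule has_derivative_eq_rhs[OF has_derivative_diff[OF one one]])
      (simp add: \<psi>'_def fun_eq_iff blinfun.diff_left blinfun.add_left algebra_simps)
  have "norm (\<psi> 1 - \<psi> 0) \<le> (L * norm (a - c) * (norm h)\<^sup>2) * norm (1 - 0 :: real)"
  proof (rule differentiable_bound[of "{0..1}" \<psi> \<psi>'])
    fix \<theta> :: real assume \<theta>: "\<theta> \<in> {0..1}"
    let ?B = "Dblin f (a + \<theta> *\<^sub>R h) - Dblin f a - Dblin f (c + \<theta> *\<^sub>R h) + Dblin f c"
    have "norm ?B \<le> L * norm (a - c) * norm (\<theta> *\<^sub>R h)"
      by (rule rectangular_increment_bound[OF Df D2])
    also have "\<dots> \<le> L * norm (a - c) * norm h"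
      using \<theta> L by (intro mult_left_mono) (auto simp: mult_left_le_one_le)
    finally have "norm (?B h) \<le> L * norm (a - c) * (norm h)\<^sup>2"
      using norm_blinfun[of ?B h] by (smt (verit) mult_right_mono norm_ge_zero power2_eq_square mult.assoc)
    then show "onorm (\<psi>' \<theta>) \<le> L * norm (a - c) * (norm h)\<^sup>2"
      unfolding \<psi>'_def using L
      by (intro onorm_le) (metis mult.commute mult_right_mono norm_ge_zero norm_scaleR real_norm_def)
  qed (use d in auto)
  then show ?thesis by (simp add: \<psi>_def taylor_rest_def)
qed

lemma sup_norm_upper:
  assumes "bdd_above ((\<lambda>x. norm (f x)) ` S)" "x \<in> S"
  shows "norm (f x) \<le> sup_norm S f"
  unfolding sup_norm_def using assms by (intro cSUP_upper) auto

lemma C0b_sup_norm: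
  assumes "C0b f"
  shows "norm (f x) \<le> sup_norm UNIV f" "0 \<le> sup_norm UNIV f"
proof -
  have "bdd_above (range (\<lambda>x. norm (f x)))"
    using assms by (auto simp: C0b_def bounded_iff bdd_above_def)
  then show *: "norm (f x) \<le> sup_norm UNIV f" for x
    by (intro sup_norm_upper) auto
  show "0 \<le> sup_norm UNIV f" using *[of undefined] norm_ge_zero order_trans by blast
qed

lemma C2b_bounds:
  assumes "C2b f" "C2b_norm f \<le> L"
  shows "\<And>x. norm (f x) \<le> L" "\<And>x y. norm (f x - f y) \<le> L * norm (x - y)"
proof -
  have f: "C0b f" "C0b (Dblin f)" "C0b (Dblin (Dblin f))" "\<And>x. f differentiable (at x)"
    using assms by (auto simp: C2b_def C1b_def)
  note b = C0b_sup_norm[OF f(1)] C0b_sup_norm[OF f(2)] C0b_sup_norm[OF f(3)]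
  show "norm (f x) \<le> L" for x
    using b(1)[of x] b(2,4,6) assms(2) by (simp add: C2b_norm_def)
  have "norm (Dblin f x) \<le> L" for x
    using b(3)[of x] b(2,4,6) assms(2) by (simp add: C2b_norm_def)
  then show "norm (f x - f y) \<le> L * norm (x - y)" for x y
    by (rule lipschitz_of_Dblin[OF f(4)])
qed

lemma norm_add_le2:
  fixes a :: "'a::real_normed_vector"
  shows "a = b + c \<Longrightarrow> norm a \<le> norm b + norm c"
  using norm_triangle_ineq by simp

section \<open>Contracting the second level\<close>

lemma norm_tensor: "norm (x \<otimes>\<^sub>v y) \<le> norm x * norm y"
proof -
  have "(x \<otimes>\<^sub>v y) $ i = x $ i *\<^sub>R y" for i
    by (simp add: tensor_def vec_eq_iff)
  then have "norm (x \<otimes>\<^sub>v y) = L2_set (\<lambda>i. \<bar>x $ i\<bar> * norm y) UNIV"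
    by (simp add: norm_vec_def[of "x \<otimes>\<^sub>v y"])
  also have "\<dots> = L2_set (\<lambda>i. \<bar>x $ i\<bar>) UNIV * norm y"
    by (simp add: L2_set_left_distrib)
  finally show ?thesis by (simp add: norm_vec_def[of x])
qed

lemma tensor_linear:
  "(x + x') \<otimes>\<^sub>v y = x \<otimes>\<^sub>v y + x' \<otimes>\<^sub>v y" "(x - x') \<otimes>\<^sub>v y = x \<otimes>\<^sub>v y - x' \<otimes>\<^sub>v y"
  "x \<otimes>\<^sub>v (y + y') = x \<otimes>\<^sub>v y + x \<otimes>\<^sub>v y'" "x \<otimes>\<^sub>v (y - y') = x \<otimes>\<^sub>v y - x \<otimes>\<^sub>v y'"
  "0 \<otimes>\<^sub>v y = 0" "x \<otimes>\<^sub>v 0 = 0"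
  by (simp_all add: tensor_def vec_eq_iff algebra_simps)

lemma apply_matrix_linear:
  "apply_matrix (G + H) A = apply_matrix G A + apply_matrix H A"
  "apply_matrix (G - H) A = apply_matrix G A - apply_matrix H A"
  "apply_matrix G (A + B) = apply_matrix G A + apply_matrix G B"
  "apply_matrix G (A - B) = apply_matrix G A - apply_matrix G B"
  by (simp_all add: apply_matrix_def blinfun.add_left blinfun.diff_left sum.distrib sum_subtractf
      scaleR_right_distrib scaleR_left_distrib scaleR_right_diff_distrib scaleR_left_diff_distrib)

lemma apply_matrix_tensor: "apply_matrix G (x \<otimes>\<^sub>v y) = G x y"
proof -
  have ex: "(\<Sum>i\<in>UNIV. z $ i *\<^sub>R axis i 1) = z" for z :: "real^'n"
    using basis_expansion[of z] by (simp add: scalar_mult_eq_scaleR)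
  have "G x y = G (\<Sum>i\<in>UNIV. x $ i *\<^sub>R axis i 1) (\<Sum>j\<in>UNIV. y $ j *\<^sub>R axis j 1)"
    by (simp add: ex)
  also have "\<dots> = (\<Sum>i\<in>UNIV. \<Sum>j\<in>UNIV. (x $ i * y $ j) *\<^sub>R G (axis i 1) (axis j 1))"
    by (simp add: blinfun.sum_right blinfun.sum_left blinfun.scaleR_right blinfun.scaleR_left
        scaleR_sum_right) (subst sum.swap, simp add: mult.commute)
  finally show ?thesis by (simp add: apply_matrix_def tensor_def)
qed

text \<open>A crude bound for \<^const>\<open>apply_matrix\<close>, with one unit for each entry of the matrix.  It is attached to
  the second level of the driver once and for all, so that it does not show in later estimates.\<close>

definition contraction_const :: "'d::finite itself \<Rightarrow> real" where
  "contraction_const _ = (real CARD('d))\<^sup>2"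

lemma norm_apply_matrix:
  fixes A :: "real^'d^'d"
  shows "norm (apply_matrix G A) \<le> norm G * (contraction_const TYPE('d) * norm A)"
proof -
  have "norm ((A $ i $ j) *\<^sub>R G (axis i 1) (axis j 1)) \<le> norm A * norm G" for i j
  proof -
    have "norm (A $ i $ j) \<le> norm A"
      by (rule order.trans[OF Finite_Cartesian_Product.norm_nth_le Finite_Cartesian_Product.norm_nth_le])
    moreover have "norm (G (axis i 1) (axis j 1)) \<le> norm G * norm (axis i (1::real)) * norm (axis j (1::real))"
      using norm_blinfun[of "G (axis i 1)" "axis j 1"] norm_blinfun[of G "axis i 1"]
      by (simp add: norm_axis_1)
    ultimately show ?thesis by (simp add: norm_axis_1 mult_mono)
  qed
  then have "norm (apply_matrix G A) \<le> (\<Sum>i\<in>(UNIV::'d set). \<Sum>j\<in>(UNIV::'d set). norm A * norm G)"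
    unfolding apply_matrix_def by (intro sum_norm_le)
  then show ?thesis by (simp add: contraction_const_def power2_eq_square algebra_simps)
qed

lemma contraction_const_ge_1: "1 \<le> contraction_const TYPE('d::finite)"
proof -
  have "1 \<le> CARD('d)" using zero_less_card_finite[where 'a='d] by linarith
  then have "1 \<le> real CARD('d)" by linarith
  then show ?thesis by (simp add: contraction_const_def)
qed

section \<open>The vector field of the equation\<close>

definition state_inclusion :: "(real^'k) \<Rightarrow>\<^sub>L (real \<times> (real^'k))" where
  "state_inclusion = Blinfun (\<lambda>y. (0, y))"

lemma state_inclusion_apply [simp]: "state_inclusion y = (0, y)"
  unfolding state_inclusion_def
  by (simp add: bounded_linear_Blinfun_apply bounded_linear_Pair bounded_linear_zero bounded_linear_ident)

lemma norm_state_inclusion: "norm state_inclusion \<le> 1"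
  by (rule norm_blinfun_bound) (auto simp: norm_Pair)

text \<open>The Gubinelli derivative of \<open>\<sigma>(\<cdot>, Y)\<close> along a solution: the derivative of \<open>\<sigma>\<close> in the state
  variable, composed with \<open>\<sigma>\<close> itself.  Time and state are kept together in one point of the product space;
  the inclusion picks the state direction.\<close>

definition gubinelli_field ::
  "(real \<times> (real^'k) \<Rightarrow> (real^'d) \<Rightarrow>\<^sub>L (real^'k)) \<Rightarrow> real \<times> (real^'k)
     \<Rightarrow> (real^'d) \<Rightarrow>\<^sub>L (real^'d) \<Rightarrow>\<^sub>L (real^'k)" where
  "gubinelli_field \<sigma> z = (Dblin \<sigma> z o\<^sub>L state_inclusion) o\<^sub>L \<sigma> z"

lemma Dblin_state:
  assumes "\<sigma> differentiable (at (s, y))"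
  shows "Dblin (\<lambda>y. \<sigma> (s, y)) y = Dblin \<sigma> (s, y) o\<^sub>L state_inclusion"
proof -
  have "((\<lambda>y. (s, y)) has_derivative (\<lambda>v. (0, v))) (at y)"
    by (auto intro!: derivative_eq_intros)
  from has_derivative_compose[OF this Dblin_has_derivative[OF assms]]
  have "((\<lambda>y. \<sigma> (s, y)) has_derivative blinfun_apply (Dblin \<sigma> (s, y) o\<^sub>L state_inclusion)) (at y)"
    by (rule has_derivative_eq_rhs) auto
  then show ?thesis
    unfolding Dblin_def by (metis blinfun_apply_inverse frechet_derivative_at)
qed

locale smooth_field =
  fixes L :: real and \<sigma> :: "real \<times> (real^'k) \<Rightarrow> (real^'d) \<Rightarrow>\<^sub>L (real^'k)"
  assumes L_ge_1: "1 \<le> L" and sigma_C3b: "C3b \<sigma>" and sigma_norm: "C3b_norm \<sigma> \<le> L"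
begin

lemma sigma_smooth:
  "\<sigma> differentiable (at z)" "Dblin \<sigma> differentiable (at z)"
  "norm (\<sigma> z) \<le> L" "norm (Dblin \<sigma> z) \<le> L"
  "norm (\<sigma> z - \<sigma> z') \<le> L * norm (z - z')"
  "norm (Dblin \<sigma> z - Dblin \<sigma> z') \<le> L * norm (z - z')"
  "norm (Dblin (Dblin \<sigma>) z - Dblin (Dblin \<sigma>) z') \<le> L * norm (z - z')"
proof -
  have f: "C0b \<sigma>" "C0b (Dblin \<sigma>)" "C0b (Dblin (Dblin \<sigma>))" "C0b (Dblin (Dblin (Dblin \<sigma>)))"
    and d: "\<And>x. \<sigma> differentiable (at x)" "\<And>x. Dblin \<sigma> differentiable (at x)"
      "\<And>x. Dblin (Dblin \<sigma>) differentiable (at x)"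
    using sigma_C3b by (auto simp: C3b_def C2b_def C1b_def)
  note b = C0b_sup_norm[OF f(1)] C0b_sup_norm[OF f(2)] C0b_sup_norm[OF f(3)] C0b_sup_norm[OF f(4)]
  have n: "norm (\<sigma> z) \<le> L" "norm (Dblin \<sigma> z) \<le> L" "norm (Dblin (Dblin \<sigma>) z) \<le> L"
    "norm (Dblin (Dblin (Dblin \<sigma>)) z) \<le> L" for z
    using b(1)[of z] b(3)[of z] b(5)[of z] b(7)[of z] b(2,4,6,8) sigma_norm
    by (simp_all add: C3b_norm_def)
  show "\<sigma> differentiable (at z)" "Dblin \<sigma> differentiable (at z)" "norm (\<sigma> z) \<le> L" "norm (Dblin \<sigma> z) \<le> L"
    using d n by auto
  show "norm (\<sigma> z - \<sigma> z') \<le> L * norm (z - z')"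
    by (rule lipschitz_of_Dblin[OF d(1) n(2)])
  show "norm (Dblin \<sigma> z - Dblin \<sigma> z') \<le> L * norm (z - z')"
    by (rule lipschitz_of_Dblin[OF d(2) n(3)])
  show "norm (Dblin (Dblin \<sigma>) z - Dblin (Dblin \<sigma>) z') \<le> L * norm (z - z')"
    by (rule lipschitz_of_Dblin[OF d(3) n(4)])
qed

abbreviation \<Gamma> where "\<Gamma> \<equiv> gubinelli_field \<sigma>"

abbreviation first_order :: "real \<times> (real^'k) \<Rightarrow> real^'d \<Rightarrow> real \<times> (real^'k)" where
  "first_order z x \<equiv> (0, \<sigma> z x)"

lemma first_order_bounds:
  "norm (first_order z x) \<le> L * norm x"
  "norm (first_order z x - first_order z' x) \<le> L * norm (z - z') * norm x"
proof -
  have "norm (\<sigma> z x) \<le> norm (\<sigma> z) * norm x" by (rule norm_blinfun)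
  also have "\<dots> \<le> L * norm x" by (intro mult_right_mono sigma_smooth) auto
  finally show "norm (first_order z x) \<le> L * norm x" by simp
  have "norm ((\<sigma> z - \<sigma> z') x) \<le> norm (\<sigma> z - \<sigma> z') * norm x" by (rule norm_blinfun)
  also have "\<dots> \<le> L * norm (z - z') * norm x" by (intro mult_right_mono sigma_smooth) auto
  finally show "norm (first_order z x - first_order z' x) \<le> L * norm (z - z') * norm x"
    by (simp add: blinfun.diff_left)
qed

text \<open>Taylor expansion is used only up to the point \<open>z + first_order z x\<close>, which depends on the driver
  alone; the rest of the increment is handled by the Lipschitz bound.  Expanding at the full increment
  would produce the square of the unknown remainder, and no a priori bound could be closed.\<close>

lemma taylor_first_order:
  "\<sigma> z' - \<sigma> z - \<Gamma> z x = (\<sigma> z' - \<sigma> (z + first_order z x)) + taylor_rest \<sigma> z (first_order z x)"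
  by (simp add: taylor_rest_def gubinelli_field_def)

lemma field_remainder_bound:
  "norm (\<sigma> z' - \<sigma> z - \<Gamma> z x) \<le> L * norm (z' - z - first_order z x) + L ^ 3 * (norm x)\<^sup>2"
proof -
  let ?h = "first_order z x"
  have "norm (taylor_rest \<sigma> z ?h) \<le> L * (norm ?h)\<^sup>2"
    using L_ge_1 by (intro taylor_rest_bound sigma_smooth) auto
  also have "\<dots> \<le> L * (L * norm x)\<^sup>2"
    using L_ge_1 first_order_bounds(1) by (intro mult_left_mono power_mono) auto
  also have "\<dots> = L ^ 3 * (norm x)\<^sup>2" by (simp add: power_mult_distrib power3_eq_cube power2_eq_square)
  finally have "norm (taylor_rest \<sigma> z ?h) \<le> L ^ 3 * (norm x)\<^sup>2" .
  moreover have "norm (\<sigma> z' - \<sigma> (z + ?h)) \<le> L * norm (z' - (z + ?h))" by (rule sigma_smooth)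
  moreover have "norm (\<sigma> z' - \<sigma> z - \<Gamma> z x) \<le> norm (\<sigma> z' - \<sigma> (z + ?h)) + norm (taylor_rest \<sigma> z ?h)"
    unfolding taylor_first_order by (rule norm_triangle_ineq)
  ultimately show ?thesis by (simp add: diff_diff_eq)
qed

text \<open>The same decomposition for two points and two increments, compared with each other.  The bound is
  linear in the differences \<open>z - \<zeta>\<close> and \<open>h - k\<close>, and besides them it contains only the driver and data of
  the first path; so the a priori bound for the solution suffices to compare it with the Euler scheme.\<close>

lemma field_remainder_diff:
  fixes z z' \<zeta> \<zeta>' x
  defines "h \<equiv> z' - z - first_order z x" and "k \<equiv> \<zeta>' - \<zeta> - first_order \<zeta> x"
  shows "norm ((\<sigma> z' - \<sigma> z - \<Gamma> z x) - (\<sigma> \<zeta>' - \<sigma> \<zeta> - \<Gamma> \<zeta> x))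
    \<le> L * ((1 + L * norm x) * norm (z - \<zeta>) * norm h + norm (h - k)) + 3 * L ^ 3 * norm (z - \<zeta>) * (norm x)\<^sup>2"
proof -
  let ?a = "first_order z x" and ?c = "first_order \<zeta> x"
  have L0: "0 \<le> L" using L_ge_1 by simp
  have T1: "norm (taylor_rest \<sigma> z ?a - taylor_rest \<sigma> \<zeta> ?a) \<le> L ^ 3 * norm (z - \<zeta>) * (norm x)\<^sup>2"
  proof -
    have "norm (taylor_rest \<sigma> z ?a - taylor_rest \<sigma> \<zeta> ?a) \<le> L * norm (z - \<zeta>) * (norm ?a)\<^sup>2"
      by (intro taylor_rest_diff_left sigma_smooth L0)
    also have "\<dots> \<le> L * norm (z - \<zeta>) * (L * norm x)\<^sup>2"
      using L0 first_order_bounds(1) by (intro mult_left_mono power_mono) auto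
    finally show ?thesis by (simp add: power_mult_distrib power3_eq_cube power2_eq_square algebra_simps)
  qed
  have T2: "norm (taylor_rest \<sigma> \<zeta> ?a - taylor_rest \<sigma> \<zeta> ?c) \<le> 2 * L ^ 3 * norm (z - \<zeta>) * (norm x)\<^sup>2"
  proof -
    have "norm (taylor_rest \<sigma> \<zeta> ?a - taylor_rest \<sigma> \<zeta> ?c) \<le> L * (norm ?a + norm ?c) * norm (?a - ?c)"
      by (intro taylor_rest_diff_right sigma_smooth L0)
    also have "\<dots> \<le> L * (L * norm x + L * norm x) * (L * norm (z - \<zeta>) * norm x)"
      using L0 by (intro mult_mono mult_left_mono add_mono first_order_bounds) auto
    finally show ?thesis by (simp add: power3_eq_cube power2_eq_square algebra_simps)
  qed
  have S: "norm ((\<sigma> z' - \<sigma> (z + ?a)) - (\<sigma> \<zeta>' - \<sigma> (\<zeta> + ?c)))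
      \<le> L * ((1 + L * norm x) * norm (z - \<zeta>) * norm h + norm (h - k))"
  proof -
    let ?p = "z + ?a" and ?q = "\<zeta> + ?c"
    have e: "z' = ?p + h" "\<zeta>' = ?q + k" by (simp_all add: h_def k_def)
    have "norm (?p - ?q) \<le> norm (z - \<zeta>) + norm (?a - ?c)"
      by (metis add_diff_add norm_triangle_ineq)
    also have "\<dots> \<le> (1 + L * norm x) * norm (z - \<zeta>)"
      using first_order_bounds(2)[of z x \<zeta>] by (simp add: algebra_simps)
    finally have pq: "norm (?p - ?q) \<le> (1 + L * norm x) * norm (z - \<zeta>)" .
    have "norm (\<sigma> (?p + h) - \<sigma> ?p - \<sigma> (?q + h) + \<sigma> ?q) \<le> L * norm (?p - ?q) * norm h"
      by (intro rectangular_increment_bound sigma_smooth)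
    also have "\<dots> \<le> L * ((1 + L * norm x) * norm (z - \<zeta>)) * norm h"
      using L0 pq by (intro mult_right_mono mult_left_mono) auto
    finally have r: "norm (\<sigma> (?p + h) - \<sigma> ?p - \<sigma> (?q + h) + \<sigma> ?q)
        \<le> L * ((1 + L * norm x) * norm (z - \<zeta>) * norm h)" by (simp add: mult.assoc)
    have l: "norm (\<sigma> (?q + h) - \<sigma> (?q + k)) \<le> L * norm (h - k)"
      using sigma_smooth(5)[of "?q + h" "?q + k"] by simp
    have "(\<sigma> z' - \<sigma> ?p) - (\<sigma> \<zeta>' - \<sigma> ?q)
        = (\<sigma> (?p + h) - \<sigma> ?p - \<sigma> (?q + h) + \<sigma> ?q) + (\<sigma> (?q + h) - \<sigma> (?q + k))"
      unfolding e by simp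
    then have "norm ((\<sigma> z' - \<sigma> ?p) - (\<sigma> \<zeta>' - \<sigma> ?q)) \<le> norm (\<sigma> (?p + h) - \<sigma> ?p - \<sigma> (?q + h) + \<sigma> ?q)
        + norm (\<sigma> (?q + h) - \<sigma> (?q + k))"
      by (rule norm_add_le2)
    with r l show ?thesis unfolding distrib_left by linarith
  qed
  have eq: "(\<sigma> z' - \<sigma> z - \<Gamma> z x) - (\<sigma> \<zeta>' - \<sigma> \<zeta> - \<Gamma> \<zeta> x)
      = ((\<sigma> z' - \<sigma> (z + ?a)) - (\<sigma> \<zeta>' - \<sigma> (\<zeta> + ?c)))
        + ((taylor_rest \<sigma> z ?a - taylor_rest \<sigma> \<zeta> ?a) + (taylor_rest \<sigma> \<zeta> ?a - taylor_rest \<sigma> \<zeta> ?c))"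
    unfolding taylor_first_order by simp
  from norm_add_le2[OF eq] norm_triangle_ineq[of "taylor_rest \<sigma> z ?a - taylor_rest \<sigma> \<zeta> ?a"
      "taylor_rest \<sigma> \<zeta> ?a - taylor_rest \<sigma> \<zeta> ?c"] S T1 T2
  show ?thesis by linarith
qed

lemma blinfun_compose_diff:
  fixes A A' :: "'b::real_normed_vector \<Rightarrow>\<^sub>L 'c::real_normed_vector" and B B' :: "'a::real_normed_vector \<Rightarrow>\<^sub>L 'b"
  shows "(A - A') o\<^sub>L B = (A o\<^sub>L B) - (A' o\<^sub>L B)" "A o\<^sub>L (B - B') = (A o\<^sub>L B) - (A o\<^sub>L B')"
  by (auto intro!: blinfun_eqI simp: blinfun.diff_left blinfun.diff_right)

lemma norm_compose_le:
  fixes A :: "'b::real_normed_vector \<Rightarrow>\<^sub>L 'c::real_normed_vector" and B :: "'a::real_normed_vector \<Rightarrow>\<^sub>L 'b"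
  assumes "norm A \<le> r" "norm B \<le> q"
  shows "norm (A o\<^sub>L B) \<le> r * q"
  by (rule order.trans[OF norm_blinfun_compose mult_mono[OF assms order.trans[OF norm_ge_zero assms(1)] norm_ge_zero]])

definition "Dy z = Dblin \<sigma> z o\<^sub>L state_inclusion"

lemma Dy_bounds:
  "norm (Dy z) \<le> L" "norm (Dy z - Dy z') \<le> L * norm (z - z')"
  "norm (Dy (a + h) - Dy a - Dy (c + h) + Dy c) \<le> L * norm (a - c) * norm h"
proof -
  have *: "norm (A o\<^sub>L (state_inclusion :: (real^'k) \<Rightarrow>\<^sub>L _)) \<le> r" if "norm A \<le> r"
    for A :: "_ \<Rightarrow>\<^sub>L (real^'d) \<Rightarrow>\<^sub>L (real^'k)" and r
    using norm_compose_le[OF that norm_state_inclusion] by simp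
  show "norm (Dy z) \<le> L" unfolding Dy_def by (rule *[OF sigma_smooth(4)])
  have "Dy z - Dy z' = (Dblin \<sigma> z - Dblin \<sigma> z') o\<^sub>L state_inclusion"
    by (simp add: Dy_def blinfun_compose_diff)
  then show "norm (Dy z - Dy z') \<le> L * norm (z - z')" using *[OF sigma_smooth(6)] by simp
  have "Dy (a + h) - Dy a - Dy (c + h) + Dy c
      = (Dblin \<sigma> (a + h) - Dblin \<sigma> a - Dblin \<sigma> (c + h) + Dblin \<sigma> c) o\<^sub>L state_inclusion"
    by (auto intro!: blinfun_eqI simp: Dy_def blinfun.diff_left blinfun.add_left)
  then show "norm (Dy (a + h) - Dy a - Dy (c + h) + Dy c) \<le> L * norm (a - c) * norm h"
    using *[OF rectangular_increment_bound[OF sigma_smooth(2,7)]] by simp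
qed

lemma \<Gamma>_eq: "\<Gamma> z = Dy z o\<^sub>L \<sigma> z" by (simp add: gubinelli_field_def Dy_def)

lemma \<Gamma>_bound: "norm (\<Gamma> z) \<le> L\<^sup>2"
  using norm_compose_le[OF Dy_bounds(1) sigma_smooth(3)] by (simp add: \<Gamma>_eq power2_eq_square)

lemma \<Gamma>_lipschitz: "norm (\<Gamma> z - \<Gamma> z') \<le> 2 * L\<^sup>2 * norm (z - z')"
proof -
  have "\<Gamma> z - \<Gamma> z' = ((Dy z - Dy z') o\<^sub>L \<sigma> z) + (Dy z' o\<^sub>L (\<sigma> z - \<sigma> z'))"
    by (simp add: \<Gamma>_eq blinfun_compose_diff)
  then have "norm (\<Gamma> z - \<Gamma> z') \<le> norm ((Dy z - Dy z') o\<^sub>L \<sigma> z) + norm (Dy z' o\<^sub>L (\<sigma> z - \<sigma> z'))"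
    by (rule norm_add_le2)
  also have "\<dots> \<le> (L * norm (z - z')) * L + L * (L * norm (z - z'))"
    by (intro add_mono norm_compose_le Dy_bounds sigma_smooth)
  finally show ?thesis by (simp add: power2_eq_square algebra_simps)
qed

lemma \<Gamma>_rectangular:
  "norm (\<Gamma> (a + h) - \<Gamma> a - \<Gamma> (c + h) + \<Gamma> c) \<le> 4 * L\<^sup>2 * norm (a - c) * norm h"
proof -
  have eq: "\<Gamma> (a + h) - \<Gamma> a - \<Gamma> (c + h) + \<Gamma> c
      = (((Dy (a + h) - Dy a - Dy (c + h) + Dy c) o\<^sub>L \<sigma> (a + h))
          + ((Dy (c + h) - Dy c) o\<^sub>L (\<sigma> (a + h) - \<sigma> (c + h))))
        + (((Dy a - Dy c) o\<^sub>L (\<sigma> (a + h) - \<sigma> a))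
          + (Dy c o\<^sub>L (\<sigma> (a + h) - \<sigma> a - \<sigma> (c + h) + \<sigma> c)))" (is "_ = (?A + ?B) + (?C + ?D)")
    by (rule blinfun_eqI) (simp add: \<Gamma>_eq blinfun.diff_left blinfun.diff_right blinfun.add_left blinfun.add_right)
  have "norm (\<Gamma> (a + h) - \<Gamma> a - \<Gamma> (c + h) + \<Gamma> c) \<le> (norm ?A + norm ?B) + (norm ?C + norm ?D)"
    using norm_add_le2[OF eq] norm_triangle_ineq[of ?A ?B] norm_triangle_ineq[of ?C ?D]
    by linarith
  also have "\<dots> \<le> ((L * norm (a - c) * norm h) * L + (L * norm h) * (L * norm (a - c)))
      + ((L * norm (a - c)) * (L * norm h) + L * (L * norm (a - c) * norm h))"
    using Dy_bounds(2)[of "c + h" c] sigma_smooth(5)[of "a + h" "c + h"] sigma_smooth(5)[of "a + h" a]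
    by (intro add_mono norm_compose_le Dy_bounds sigma_smooth rectangular_increment_bound) auto
  finally show ?thesis by (simp add: power2_eq_square algebra_simps)
qed

lemma \<Gamma>_increment_diff:
  "norm ((\<Gamma> (a + h) - \<Gamma> a) - (\<Gamma> (c + k) - \<Gamma> c)) \<le> 4 * L\<^sup>2 * norm (a - c) * norm h + 2 * L\<^sup>2 * norm (h - k)"
proof -
  have "(\<Gamma> (a + h) - \<Gamma> a) - (\<Gamma> (c + k) - \<Gamma> c)
      = (\<Gamma> (a + h) - \<Gamma> a - \<Gamma> (c + h) + \<Gamma> c) + (\<Gamma> (c + h) - \<Gamma> (c + k))" by simp
  then have "norm ((\<Gamma> (a + h) - \<Gamma> a) - (\<Gamma> (c + k) - \<Gamma> c))
      \<le> norm (\<Gamma> (a + h) - \<Gamma> a - \<Gamma> (c + h) + \<Gamma> c) + norm (\<Gamma> (c + h) - \<Gamma> (c + k))"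
    by (rule norm_add_le2)
  then show ?thesis using \<Gamma>_rectangular[of a h c] \<Gamma>_lipschitz[of "c + h" "c + k"] by simp
qed

end

lemma norm_diff_le2:
  fixes a :: "'a::real_normed_vector"
  shows "a = b - c \<Longrightarrow> norm a \<le> norm b + norm c"
  using norm_triangle_ineq4 by simp

section \<open>Rough integrals over subintervals\<close>

lemma mesh_less_iff: "0 < \<delta> \<Longrightarrow> mesh N u < \<delta> \<longleftrightarrow> (\<forall>i<N. \<bar>u (Suc i) - u i\<bar> < \<delta>)"
  by (auto simp: mesh_def)

lemma fine_partition_exists:
  assumes "s \<le> t" "0 < \<delta>"
  shows "\<exists>N u. interval_partition s t N u \<and> mesh N u < \<delta>"
proof (cases "s = t")
  case True
  then show ?thesis using assms
    by (intro exI[of _ 0] exI[of _ "\<lambda>_. s"]) (auto simp: interval_partition_def mesh_less_iff)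
next
  case False
  then have st: "s < t" using assms by simp
  define N where "N = nat \<lceil>(t - s) / \<delta>\<rceil> + 1"
  have N: "(t - s) / \<delta> < real N" unfolding N_def by linarith
  have N0: "0 < real N" by (simp add: N_def)
  define u where "u i = s + real i * ((t - s) / real N)" for i
  have step: "u (Suc i) - u i = (t - s) / real N" for i
    unfolding u_def by (simp only: of_nat_Suc distrib_right mult_1)
  have pos: "0 < (t - s) / real N" using N0 st by simp
  have "u i < u (Suc i)" for i using step[of i] pos by linarith
  moreover have "u 0 = s" "u N = t" using N0 by (simp_all add: u_def)
  ultimately have "interval_partition s t N u" by (auto simp: interval_partition_def)
  moreover have "(t - s) / real N < \<delta>"
    using N N0 assms by (simp add: field_simps)
  moreover note step pos
  ultimately show ?thesis using assms(2)
    by (intro exI[of _ N] exI[of _ u]) (auto simp: mesh_less_iff)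
qed

lemma concat_partition:
  assumes A: "interval_partition a s N u" "mesh N u < \<delta>" and B: "interval_partition s t M v" "mesh M v < \<delta>"
    and \<delta>: "0 < \<delta>"
  defines "w \<equiv> \<lambda>i. if i \<le> N then u i else v (i - N)"
  shows "interval_partition a t (N + M) w" "mesh (N + M) w < \<delta>"
    "(\<Sum>i<N + M. \<Xi> (w i) (w (Suc i))) = (\<Sum>i<N. \<Xi> (u i) (u (Suc i))) + (\<Sum>i<M. \<Xi> (v i) (v (Suc i)))"
proof -
  have e: "u N = v 0" using A(1) B(1) by (auto simp: interval_partition_def)
  have w1: "w i = u i" if "i \<le> N" for i using that by (simp add: w_def)
  have w2: "w (N + i) = v i" for i using e by (simp add: w_def)
  have *: "P (w i) (w (Suc i))" if "\<forall>i<N. P (u i) (u (Suc i))" "\<forall>i<M. P (v i) (v (Suc i))" "i < N + M" for P i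
  proof (cases "i < N")
    case True then show ?thesis using that w1 by auto
  next
    case False
    then obtain j where "i = N + j" using le_Suc_ex not_less by blast
    then show ?thesis using that w2[of j] w2[of "Suc j"] by auto
  qed
  show "interval_partition a t (N + M) w"
    using A(1) B(1) *[of "(<)"] w1[of 0] w2[of M] by (auto simp: interval_partition_def)
  show "mesh (N + M) w < \<delta>"
    using A(2) B(2) *[of "\<lambda>x y. \<bar>y - x\<bar> < \<delta>"] \<delta> by (auto simp: mesh_less_iff)
  have "(\<Sum>i<N + M. \<Xi> (w i) (w (Suc i)))
      = (\<Sum>i<N. \<Xi> (w i) (w (Suc i))) + (\<Sum>i<M. \<Xi> (w (N + i)) (w (N + Suc i)))"
    by (induction M) (auto simp: add.assoc)
  also have "(\<Sum>i<N. \<Xi> (w i) (w (Suc i))) = (\<Sum>i<N. \<Xi> (u i) (u (Suc i)))"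
    by (intro sum.cong) (auto simp: w1)
  also have "(\<Sum>i<M. \<Xi> (w (N + i)) (w (N + Suc i))) = (\<Sum>i<M. \<Xi> (v i) (v (Suc i)))"
    by (simp only: w2)
  finally show "(\<Sum>i<N + M. \<Xi> (w i) (w (Suc i))) = (\<Sum>i<N. \<Xi> (u i) (u (Suc i))) + (\<Sum>i<M. \<Xi> (v i) (v (Suc i)))" .
qed

text \<open>Any fine partition of \<open>[0, s]\<close> followed by one of \<open>[s, t]\<close> is a fine partition of \<open>[0, t]\<close>.\<close>

lemma rough_integral_increment:
  assumes s: "has_rough_integral X XX F F' s I" and t: "has_rough_integral X XX F F' t J"
    and st: "0 \<le> s" "s \<le> t" and \<epsilon>: "0 < \<epsilon>"
  shows "\<exists>M u. interval_partition s t M u \<and>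
    norm ((\<Sum>i<M. F (u i) (X (u (Suc i)) - X (u i)) + apply_matrix (F' (u i)) (XX (u i) (u (Suc i)))) - (J - I)) < \<epsilon>"
proof -
  let ?\<Xi> = "\<lambda>x y. F x (X y - X x) + apply_matrix (F' x) (XX x y)"
  obtain \<delta>1 where d1: "0 < \<delta>1"
    "\<And>M u. interval_partition 0 s M u \<Longrightarrow> mesh M u < \<delta>1 \<Longrightarrow> norm ((\<Sum>i<M. ?\<Xi> (u i) (u (Suc i))) - I) < \<epsilon> / 2"
    using s \<epsilon> unfolding has_rough_integral_def by (meson half_gt_zero)
  obtain \<delta>2 where d2: "0 < \<delta>2"
    "\<And>M u. interval_partition 0 t M u \<Longrightarrow> mesh M u < \<delta>2 \<Longrightarrow> norm ((\<Sum>i<M. ?\<Xi> (u i) (u (Suc i))) - J) < \<epsilon> / 2"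
    using t \<epsilon> unfolding has_rough_integral_def by (meson half_gt_zero)
  define \<delta> where "\<delta> = min \<delta>1 \<delta>2"
  have \<delta>: "0 < \<delta>" using d1 d2 by (simp add: \<delta>_def)
  obtain N u where u: "interval_partition 0 s N u" "mesh N u < \<delta>"
    using fine_partition_exists[OF st(1) \<delta>] by blast
  obtain M v where v: "interval_partition s t M v" "mesh M v < \<delta>"
    using fine_partition_exists[OF st(2) \<delta>] by blast
  note c = concat_partition[OF u v \<delta>]
  let ?A = "\<Sum>i<N. ?\<Xi> (u i) (u (Suc i))" and ?B = "\<Sum>i<M. ?\<Xi> (v i) (v (Suc i))"
  have "norm (?A - I) < \<epsilon> / 2" using d1(2)[OF u(1)] u(2) by (simp add: \<delta>_def)
  moreover have "norm ((?A + ?B) - J) < \<epsilon> / 2"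
    using d2(2)[OF c(1)] c(2) unfolding c(3)[of ?\<Xi>] by (simp add: \<delta>_def)
  moreover have "norm (?B - (J - I)) \<le> norm ((?A + ?B) - J) + norm (?A - I)"
    by (rule norm_diff_le2) (simp only: algebra_simps)
  ultimately have "norm (?B - (J - I)) < \<epsilon>" by linarith
  then show ?thesis using v(1) by blast
qed

section \<open>The expansion of a solution\<close>

text \<open>All that is ever used about the driver on an interval.  There are two exponents, \<open>\<alpha>\<close> for the first
  level and \<open>\<beta>\<close> for the second, with \<open>\<alpha> + \<beta> > 1\<close>; time counts as a second-level quantity.  Since the
  rate in the mesh may force \<open>\<beta> < 2 \<alpha>\<close>, the square of the first level is bounded separately.  The factor a
  is 1 in general and the rate of convergence inside a cell.\<close>

definition driver_bound ::
  "real \<Rightarrow> real \<Rightarrow> (real \<Rightarrow> real^'d) \<Rightarrow> (real \<Rightarrow> real \<Rightarrow> real^'d^'d) \<Rightarrow> (real \<Rightarrow> real \<Rightarrow> real)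
     \<Rightarrow> real \<Rightarrow> real \<Rightarrow> real \<Rightarrow> bool" where
  "driver_bound \<alpha> \<beta> X XX \<omega> a s t \<longleftrightarrow>
     norm (X t - X s) \<le> a * \<omega> s t powr \<alpha> \<and> (norm (X t - X s))\<^sup>2 \<le> a * \<omega> s t powr \<beta>
     \<and> contraction_const TYPE('d) * norm (XX s t) \<le> a * \<omega> s t powr \<beta> \<and> t - s \<le> a * \<omega> s t powr \<beta>"

lemma driver_bound_control_mono:
  assumes "driver_bound \<alpha> \<beta> X XX \<omega> a s t" "0 \<le> \<omega> s t" "\<omega> s t \<le> \<omega>' s t" "0 \<le> \<alpha>" "0 \<le> \<beta>" "0 \<le> a"
  shows "driver_bound \<alpha> \<beta> X XX \<omega>' a s t"
proof -
  have "a * \<omega> s t powr \<alpha> \<le> a * \<omega>' s t powr \<alpha>" "a * \<omega> s t powr \<beta> \<le> a * \<omega>' s t powr \<beta>"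
    using assms by (auto intro!: mult_left_mono powr_mono2)
  then show ?thesis using assms(1) by (auto simp: driver_bound_def)
qed

text \<open>Chen's relation turns the coboundary of the germ into the remainder of the integrand against the first
  level and the increment of its derivative against the second level.\<close>

lemma germ_coboundary:
  fixes F\<^sub>s F\<^sub>u :: "(real^'d) \<Rightarrow>\<^sub>L (real^'k)" and G\<^sub>s G\<^sub>u :: "(real^'d) \<Rightarrow>\<^sub>L (real^'d) \<Rightarrow>\<^sub>L (real^'k)"
  shows "(F\<^sub>s (x + y) + apply_matrix G\<^sub>s (A + B + x \<otimes>\<^sub>v y)) - (F\<^sub>s x + apply_matrix G\<^sub>s A) - (F\<^sub>u y + apply_matrix G\<^sub>u B)
    = - ((F\<^sub>u - F\<^sub>s - G\<^sub>s x) y) - apply_matrix (G\<^sub>u - G\<^sub>s) B"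
  by (simp add: apply_matrix_linear apply_matrix_tensor blinfun.add_right blinfun.diff_left)

lemma powr_lower_exponent:
  assumes "0 \<le> x" "x \<le> V" "1 \<le> V" "a \<le> b" "b \<le> a + 1"
  shows "x powr b \<le> V * x powr (a::real)"
proof -
  have "x powr b = x powr (b - a) * x powr a" by (simp flip: powr_add)
  also have "\<dots> \<le> V powr 1 * x powr a"
  proof (intro mult_right_mono)
    have "x powr (b - a) \<le> V powr (b - a)" using assms by (intro powr_mono2) auto
    also have "\<dots> \<le> V powr 1" using assms by (intro powr_mono) auto
    finally show "x powr (b - a) \<le> V powr 1" .
  qed auto
  finally show ?thesis using assms by simp
qed

text \<open>The analytic content of being a solution, in terms of an arbitrary control.  The parameter I is the
  rough integral as a function of its upper limit.  Finiteness of the variation of the remainder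
  is expressed by a monotone function v without any bound on its size: it enters only to start
  the absorption argument for the a priori bound.\<close>

locale rough_equation = smooth_field L \<sigma>
  for L :: real and \<sigma> :: "real \<times> (real^'k) \<Rightarrow> (real^'d) \<Rightarrow>\<^sub>L (real^'k)" +
  fixes T \<alpha> \<beta> W :: real and \<omega> :: "real \<Rightarrow> real \<Rightarrow> real"
    and X :: "real \<Rightarrow> real^'d" and XX :: "real \<Rightarrow> real \<Rightarrow> real^'d^'d"
    and b :: "real \<times> (real^'k) \<Rightarrow> real^'k" and Y :: "real \<Rightarrow> real^'k" and y0 :: "real^'k"
    and I :: "real \<Rightarrow> real^'k"
  assumes exponents: "0 < \<alpha>" "\<alpha> \<le> \<beta>" "\<beta> \<le> 1" "1 < \<alpha> + \<beta>"
    and W_ge_1: "1 \<le> W" and control_\<omega>: "control T \<omega>" and \<omega>_total: "\<omega> 0 T \<le> W"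
    and chen: "\<And>s u t. XX s t = XX s u + XX u t + (X u - X s) \<otimes>\<^sub>v (X t - X u)"
    and driver: "\<And>s t. 0 \<le> s \<Longrightarrow> s < t \<Longrightarrow> t \<le> T \<Longrightarrow> driver_bound \<alpha> \<beta> X XX \<omega> 1 s t"
    and b_bound: "\<And>z. norm (b z) \<le> L" and b_lipschitz: "\<And>z z'. norm (b z - b z') \<le> L * norm (z - z')"
    and right_continuous: "\<And>t. 0 \<le> t \<Longrightarrow> t < T \<Longrightarrow> (Y \<longlongrightarrow> Y t) (at_right t)"
    and drift_integrable: "(\<lambda>r. b (r, Y r)) integrable_on {0..T}"
    and rough_integral: "\<And>t. 0 \<le> t \<Longrightarrow> t \<le> T \<Longrightarrow>
      has_rough_integral X XX (\<lambda>s. \<sigma> (s, Y s)) (\<lambda>s. gubinelli_field \<sigma> (s, Y s)) t (I t)"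
    and equation: "\<And>t. 0 \<le> t \<Longrightarrow> t \<le> T \<Longrightarrow> Y t = y0 + integral {0..t} (\<lambda>r. b (r, Y r)) + I t"
    and finite_remainder: "\<exists>v. \<forall>s t. 0 \<le> s \<and> s \<le> t \<and> t \<le> T \<longrightarrow>
      v s \<le> v t \<and> norm (Y t - Y s - \<sigma> (s, Y s) (X t - X s)) \<le> (v t - v s :: real) powr \<beta>"
begin

definition state :: "real \<Rightarrow> real \<times> (real^'k)" where "state t = (t, Y t)"

definition controlled_remainder :: "real \<Rightarrow> real \<Rightarrow> real^'k" where
  "controlled_remainder s t = Y t - Y s - \<sigma> (state s) (X t - X s)"

definition germ :: "real \<Rightarrow> real \<Rightarrow> real^'k" where
  "germ s t = \<sigma> (state s) (X t - X s) + apply_matrix (\<Gamma> (state s)) (XX s t)"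

definition drift :: "real \<Rightarrow> real \<Rightarrow> real^'k" where
  "drift s t = integral {s..t} (\<lambda>r. b (r, Y r))"

definition defect :: "real \<Rightarrow> real \<Rightarrow> real^'k" where
  "defect s t = Y t - Y s - drift s t - germ s t"

lemma \<omega>_range:
  assumes "0 \<le> s" "s \<le> t" "t \<le> T"
  shows "0 \<le> \<omega> s t" "\<omega> s t \<le> W"
  using control_nonneg[OF control_\<omega> assms] control_mono[OF control_\<omega>, of 0 s t T] \<omega>_total assms by auto

lemma drift_integrable_on: "0 \<le> s \<Longrightarrow> t \<le> T \<Longrightarrow> (\<lambda>r. b (r, Y r)) integrable_on {s..t}"
  by (rule integrable_on_subinterval[OF drift_integrable]) auto

lemma drift_bound:
  assumes "0 \<le> s" "s \<le> t" "t \<le> T"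
  shows "norm (drift s t) \<le> L * (t - s)"
proof -
  have "norm (integral {s..t} (\<lambda>r. b (r, Y r))) \<le> integral {s..t} (\<lambda>r. L)"
    using drift_integrable_on[of s t] assms b_bound by (intro integral_norm_bound_integral) auto
  then show ?thesis using assms by (simp add: drift_def algebra_simps)
qed

lemma drift_add:
  assumes "0 \<le> s" "s \<le> u" "u \<le> t" "t \<le> T"
  shows "drift s u + drift u t = drift s t"
  unfolding drift_def
  using drift_integrable_on[of s t] assms by (intro Henstock_Kurzweil_Integration.integral_combine) auto

lemma norm_state_increment:
  "norm (state v - state x) \<le> \<bar>v - x\<bar> + norm (Y v - Y x)"
  "norm (state v - state x - first_order (state x) (X v - X x)) \<le> \<bar>v - x\<bar> + norm (controlled_remainder x v)"
  using norm_Pair_le[of "v - x" "Y v - Y x"] norm_Pair_le[of "v - x" "controlled_remainder x v"]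
  by (simp_all add: state_def controlled_remainder_def)

lemma increment_bound: "norm (Y v - Y x) \<le> L * norm (X v - X x) + norm (controlled_remainder x v)"
proof -
  have "Y v - Y x = \<sigma> (state x) (X v - X x) + controlled_remainder x v"
    by (simp add: controlled_remainder_def)
  from norm_add_le2[OF this] show ?thesis
    using first_order_bounds(1)[of "state x" "X v - X x"] by simp
qed

lemma second_level_bound:
  assumes "contraction_const TYPE('d) * norm (A :: real^'d^'d) \<le> r" "norm G \<le> q"
  shows "norm (apply_matrix G A) \<le> q * r"
proof -
  have "0 \<le> q" using order.trans[OF norm_ge_zero assms(2)] .
  then have "norm G * (contraction_const TYPE('d) * norm A) \<le> q * r"
    using assms contraction_const_ge_1[where 'd='d] by (intro mult_mono) auto
  with norm_apply_matrix[of G A] show ?thesis by linarith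
qed

lemma controlled_remainder_bound:
  assumes "0 \<le> s" "s < t" "t \<le> T" "driver_bound \<alpha> \<beta> X XX \<omega>' a s t"
  shows "norm (controlled_remainder s t) \<le> (L\<^sup>2 + L) * a * \<omega>' s t powr \<beta> + norm (defect s t)"
proof -
  have "controlled_remainder s t = apply_matrix (\<Gamma> (state s)) (XX s t) + (drift s t + defect s t)"
    by (simp add: controlled_remainder_def defect_def germ_def)
  from norm_add_le2[OF this] norm_triangle_ineq[of "drift s t" "defect s t"]
  have "norm (controlled_remainder s t)
      \<le> norm (apply_matrix (\<Gamma> (state s)) (XX s t)) + norm (drift s t) + norm (defect s t)" by linarith
  moreover have "norm (apply_matrix (\<Gamma> (state s)) (XX s t)) \<le> L\<^sup>2 * (a * \<omega>' s t powr \<beta>)"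
    using assms(4) by (intro second_level_bound \<Gamma>_bound) (auto simp: driver_bound_def)
  moreover have "norm (drift s t) \<le> L * (a * \<omega>' s t powr \<beta>)"
  proof -
    have "t - s \<le> a * \<omega>' s t powr \<beta>" using assms(4) by (auto simp: driver_bound_def)
    then have "L * (t - s) \<le> L * (a * \<omega>' s t powr \<beta>)" using L_ge_1 by (intro mult_left_mono) auto
    with drift_bound[of s t] assms show ?thesis by linarith
  qed
  ultimately show ?thesis by (simp add: algebra_simps)
qed

lemma germ_approximation:
  assumes "0 \<le> s" "s \<le> t" "t \<le> T" "0 < \<epsilon>"
  shows "\<exists>M u. interval_partition s t M u \<and> norm ((\<Sum>i<M. germ (u i) (u (Suc i))) - (defect s t + germ s t)) < \<epsilon>"
proof -
  have d: "drift 0 t = drift 0 s + drift s t" using drift_add[of 0 s t] assms by auto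
  have "I s = Y s - y0 - drift 0 s" "I t = Y t - y0 - drift 0 t"
    using equation[of s] equation[of t] assms by (simp_all add: drift_def)
  then have "I t - I s = defect s t + germ s t"
    by (simp add: defect_def d)
  then show ?thesis
    using rough_integral_increment[OF rough_integral[of s] rough_integral[of t], of \<epsilon>] assms
    by (simp add: germ_def state_def)
qed

text \<open>The constants \<open>c0\<close>, \<open>c1\<close>, \<open>M0\<close>, and so on below are functions of L, \<open>\<alpha>\<close>, \<open>\<beta>\<close> and W only; this is
  what makes the final constant independent of the path and of the partition.\<close>

definition c0 :: real where "c0 = 6 * sewing_const (\<alpha> + \<beta>) * L ^ 3 * W"

lemma c0_ge_1: "1 \<le> c0"
proof -
  have "1 * 1 * 1 * 1 \<le> 6 * sewing_const (\<alpha> + \<beta>) * L ^ 3 * W"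
    using sewing_const(1)[OF exponents(4)] L_ge_1 W_ge_1 by (intro mult_mono) auto
  then show ?thesis by (simp add: c0_def)
qed

text \<open>The coboundary of the germ is linear in the remainder of the solution, so a bound on the
  remainder enters the defect only with an additional power of the control.  Smallness of the driver
  may come from the left interval or from the right one; the factors a and a' keep them apart, because over
  a cell only the left one is small, and inside a cell the left one is at first only bounded.\<close>

lemma defect_bound:
  assumes ctrl: "control T \<omega>'" and st: "0 \<le> s" "s < t" "t \<le> T" and W: "\<omega>' s t \<le> W"
    and nonneg: "0 \<le> a" "0 \<le> a'" "0 \<le> M"
    and R: "\<And>x v. s \<le> x \<Longrightarrow> x < v \<Longrightarrow> v < t \<Longrightarrow> norm (controlled_remainder x v) \<le> M * \<omega>' x v powr \<beta>"
    and left: "\<And>x v. s \<le> x \<Longrightarrow> x < v \<Longrightarrow> v < t \<Longrightarrow> driver_bound \<alpha> \<beta> X XX \<omega>' a x v"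
    and right: "\<And>v z. s \<le> v \<Longrightarrow> v < z \<Longrightarrow> z \<le> t \<Longrightarrow> driver_bound \<alpha> \<beta> X XX \<omega>' a' v z"
  shows "norm (defect s t) \<le> c0 * a' * (a + M) * \<omega>' s t powr (\<alpha> + \<beta>)"
proof -
  define K where "K = 6 * L ^ 3 * W * a' * (a + M)"
  have K0: "0 \<le> K" unfolding K_def using nonneg L_ge_1 W_ge_1 by (intro mult_nonneg_nonneg add_nonneg_nonneg zero_le_power) auto
  have L0: "0 \<le> L" "1 \<le> L\<^sup>2" "L \<le> L ^ 3" "L\<^sup>2 \<le> L ^ 3"
    using L_ge_1 one_le_power[OF L_ge_1, of 2] self_le_power[OF L_ge_1, of 3] power_increasing[of 2 3 L] by simp_all
  have cobound: "norm (germ x z - germ x v - germ v z) \<le> K * \<omega>' x z powr (\<alpha> + \<beta>)"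
    if xvz: "s \<le> x" "x < v" "v < z" "z \<le> t" for x v z
  proof -
    define o1 o2 o3 where "o1 = \<omega>' x v" and "o2 = \<omega>' v z" and "o3 = \<omega>' x z"
    have o: "0 \<le> o1" "0 \<le> o2" "o1 \<le> o3" "o2 \<le> o3" "o3 \<le> W"
      using xvz st W control_nonneg[OF ctrl, of x v] control_nonneg[OF ctrl, of v z]
        control_mono[OF ctrl, of x x v z] control_mono[OF ctrl, of x v z z] control_mono[OF ctrl, of s x z t]
      by (auto simp: o1_def o2_def o3_def)
    have X1: "norm (X v - X x) \<le> a * o1 powr \<alpha>" "(norm (X v - X x))\<^sup>2 \<le> a * o1 powr \<beta>" "\<bar>v - x\<bar> \<le> a * o1 powr \<beta>"
      using left[of x v] xvz by (auto simp: driver_bound_def o1_def)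
    have X2: "norm (X z - X v) \<le> a' * o2 powr \<alpha>" "contraction_const TYPE('d) * norm (XX v z) \<le> a' * o2 powr \<beta>"
      using right[of v z] xvz by (auto simp: driver_bound_def o2_def)
    have Rb: "norm (controlled_remainder x v) \<le> M * o1 powr \<beta>"
      using R[of x v] xvz by (auto simp: o1_def)
    have ob: "o1 powr \<beta> \<le> W * o1 powr \<alpha>"
      using o exponents W_ge_1 by (intro powr_lower_exponent) auto
    let ?F = "\<sigma> (state v) - \<sigma> (state x) - \<Gamma> (state x) (X v - X x)"
    have F: "norm ?F \<le> 2 * L ^ 3 * (a + M) * o1 powr \<beta>"
    proof -
      have "norm ?F \<le> L * (\<bar>v - x\<bar> + norm (controlled_remainder x v)) + L ^ 3 * (norm (X v - X x))\<^sup>2"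
        using field_remainder_bound[of "state v" "state x" "X v - X x"]
          mult_left_mono[OF norm_state_increment(2)[of v x] L0(1)] by linarith
      also have "\<dots> \<le> L * (a * o1 powr \<beta> + M * o1 powr \<beta>) + L ^ 3 * (a * o1 powr \<beta>)"
        using X1 Rb L0 by (intro add_mono mult_left_mono) auto
      also have "\<dots> \<le> L ^ 3 * (a * o1 powr \<beta> + M * o1 powr \<beta>) + L ^ 3 * (a * o1 powr \<beta> + M * o1 powr \<beta>)"
        using nonneg L0 by (intro add_mono mult_mono) auto
      finally show ?thesis by (simp add: algebra_simps)
    qed
    have G: "norm (\<Gamma> (state v) - \<Gamma> (state x)) \<le> 4 * L ^ 3 * W * (a + M) * o1 powr \<alpha>"
    proof -
      have "norm (state v - state x) \<le> \<bar>v - x\<bar> + (L * norm (X v - X x) + norm (controlled_remainder x v))"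
        using norm_state_increment(1)[of v x] increment_bound[of v x] by linarith
      also have "\<dots> \<le> a * o1 powr \<beta> + (L * (a * o1 powr \<alpha>) + M * o1 powr \<beta>)"
        using X1 Rb L0 by (intro add_mono mult_left_mono) auto
      also have "\<dots> \<le> a * (W * o1 powr \<alpha>) + (L * (a * o1 powr \<alpha>) + M * (W * o1 powr \<alpha>))"
        using ob nonneg L0 by (intro add_mono mult_left_mono) auto
      also have "\<dots> = (a * (1 * W) + a * (L * 1) + M * (1 * W)) * o1 powr \<alpha>" by (simp add: algebra_simps)
      also have "\<dots> \<le> (a * (L * W) + a * (L * W) + M * (L * W)) * o1 powr \<alpha>"
        using nonneg L_ge_1 W_ge_1
        by (intro mult_right_mono add_mono mult_left_mono mult_mono) auto
      also have "\<dots> \<le> (a * (L * W) + a * (L * W) + 2 * (M * (L * W))) * o1 powr \<alpha>"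
        using nonneg L_ge_1 W_ge_1 by (intro mult_right_mono) auto
      finally have "norm (state v - state x) \<le> 2 * L * W * (a + M) * o1 powr \<alpha>"
        by (simp add: algebra_simps)
      then have "2 * L\<^sup>2 * norm (state v - state x) \<le> 2 * L\<^sup>2 * (2 * L * W * (a + M) * o1 powr \<alpha>)"
        by (intro mult_left_mono) auto
      with \<Gamma>_lipschitz[of "state v" "state x"] show ?thesis
        by (simp add: power2_eq_square power3_eq_cube algebra_simps)
    qed
    have eq: "germ x z - germ x v - germ v z
        = - (?F (X z - X v)) - apply_matrix (\<Gamma> (state v) - \<Gamma> (state x)) (XX v z)"
      using germ_coboundary[of "\<sigma> (state x)" "X v - X x" "X z - X v" "\<Gamma> (state x)" "XX x v" "XX v z" "\<sigma> (state v)" "\<Gamma> (state v)"]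
      by (simp add: germ_def chen[of x z v])
    have "norm (germ x z - germ x v - germ v z)
        \<le> norm (?F (X z - X v)) + norm (apply_matrix (\<Gamma> (state v) - \<Gamma> (state x)) (XX v z))"
      using norm_diff_le2[OF eq] by simp
    also have "norm (?F (X z - X v)) \<le> (2 * L ^ 3 * (a + M) * o3 powr \<beta>) * (a' * o3 powr \<alpha>)"
    proof -
      have "norm (?F (X z - X v)) \<le> norm ?F * norm (X z - X v)" by (rule norm_blinfun)
      also have "\<dots> \<le> (2 * L ^ 3 * (a + M) * o1 powr \<beta>) * (a' * o2 powr \<alpha>)"
        using F X2 nonneg L0 by (intro mult_mono) auto
      also have "\<dots> \<le> (2 * L ^ 3 * (a + M) * o3 powr \<beta>) * (a' * o3 powr \<alpha>)"
        using o nonneg L0 exponents by (intro mult_mono mult_left_mono powr_mono2) auto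
      finally show ?thesis .
    qed
    also have "norm (apply_matrix (\<Gamma> (state v) - \<Gamma> (state x)) (XX v z))
        \<le> (4 * L ^ 3 * W * (a + M) * o3 powr \<alpha>) * (a' * o3 powr \<beta>)"
    proof -
      have "norm (apply_matrix (\<Gamma> (state v) - \<Gamma> (state x)) (XX v z))
          \<le> (4 * L ^ 3 * W * (a + M) * o1 powr \<alpha>) * (a' * o2 powr \<beta>)"
        by (rule second_level_bound[OF X2(2) G])
      also have "\<dots> \<le> (4 * L ^ 3 * W * (a + M) * o3 powr \<alpha>) * (a' * o3 powr \<beta>)"
        using o nonneg L0 W_ge_1 exponents by (intro mult_mono mult_left_mono powr_mono2) auto
      finally show ?thesis .
    qed
    also have "(2 * L ^ 3 * (a + M) * o3 powr \<beta>) * (a' * o3 powr \<alpha>) + (4 * L ^ 3 * W * (a + M) * o3 powr \<alpha>) * (a' * o3 powr \<beta>)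
        = (2 + 4 * W) * (L ^ 3 * a' * (a + M) * o3 powr (\<alpha> + \<beta>))"
      by (simp add: powr_add algebra_simps)
    also have "\<dots> \<le> (6 * W) * (L ^ 3 * a' * (a + M) * o3 powr (\<alpha> + \<beta>))"
      using nonneg L0 W_ge_1 by (intro mult_right_mono) auto
    finally show ?thesis by (simp add: K_def o3_def algebra_simps)
  qed
  have "norm (defect s t) \<le> sewing_const (\<alpha> + \<beta>) * K * \<omega>' s t powr (\<alpha> + \<beta>) + \<epsilon>" if "0 < \<epsilon>" for \<epsilon>
  proof -
    obtain N u where u: "interval_partition s t N u"
      "norm ((\<Sum>i<N. germ (u i) (u (Suc i))) - (defect s t + germ s t)) < \<epsilon>"
      using germ_approximation[of s t \<epsilon>] st \<open>0 < \<epsilon>\<close> by auto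
    have "norm ((\<Sum>i<N. germ (u i) (u (Suc i))) - germ s t) \<le> sewing_const (\<alpha> + \<beta>) * K * \<omega>' s t powr (\<alpha> + \<beta>)"
      by (rule sewing[OF exponents(4) K0 ctrl st cobound u(1)])
    moreover have eq: "defect s t = ((\<Sum>i<N. germ (u i) (u (Suc i))) - germ s t)
        - ((\<Sum>i<N. germ (u i) (u (Suc i))) - (defect s t + germ s t))" by simp
    have "norm (defect s t) \<le> norm ((\<Sum>i<N. germ (u i) (u (Suc i))) - germ s t)
        + norm ((\<Sum>i<N. germ (u i) (u (Suc i))) - (defect s t + germ s t))"
      by (rule norm_diff_le2[OF eq])
    ultimately show ?thesis using u(2) by linarith
  qed
  then have "norm (defect s t) \<le> sewing_const (\<alpha> + \<beta>) * K * \<omega>' s t powr (\<alpha> + \<beta>)"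
    by (rule field_le_epsilon)
  then show ?thesis by (simp add: K_def c0_def algebra_simps)
qed

section \<open>A priori bounds\<close>

text \<open>On an interval with small control, a bound on the remainder improves itself: only half of it
  comes back through the defect.\<close>

lemma remainder_halving:
  assumes ctrl: "control T \<omega>'" and le: "\<And>x v. 0 \<le> x \<Longrightarrow> x < v \<Longrightarrow> v \<le> T \<Longrightarrow> \<omega> x v \<le> \<omega>' x v"
    and st: "0 \<le> s" "t \<le> T" and small: "c0 * \<omega>' s t powr \<alpha> \<le> 1/2" "\<omega>' s t \<le> W" and M: "0 \<le> M"
    and R: "\<And>x v. s \<le> x \<Longrightarrow> x < v \<Longrightarrow> v \<le> t \<Longrightarrow> norm (controlled_remainder x v) \<le> M * \<omega>' x v powr \<beta>"
    and xv: "s \<le> x" "x < v" "v \<le> t"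
  shows "norm (controlled_remainder x v) \<le> (3 * L\<^sup>2 + M / 2) * \<omega>' x v powr \<beta>"
proof -
  have drv: "driver_bound \<alpha> \<beta> X XX \<omega>' 1 x v" if "0 \<le> x" "x < v" "v \<le> T" for x v
    using driver_bound_control_mono[where \<omega>' = \<omega>', OF driver[OF that]] le[OF that] \<omega>_range(1)[of x v]
      that exponents by auto
  have o: "0 \<le> \<omega>' x v" "\<omega>' x v \<le> \<omega>' s t"
    using control_nonneg[OF ctrl, of x v] control_mono[OF ctrl, of s x v t] st xv by auto
  have "c0 * \<omega>' x v powr \<alpha> \<le> c0 * \<omega>' s t powr \<alpha>"
    using o exponents c0_ge_1 by (intro mult_left_mono powr_mono2) auto
  then have h: "c0 * \<omega>' x v powr \<alpha> \<le> 1/2" using small by linarith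
  have "norm (defect x v) \<le> c0 * 1 * (1 + M) * \<omega>' x v powr (\<alpha> + \<beta>)"
    by (rule defect_bound[OF ctrl]) (use st xv M o small R drv in auto)
  also have "\<dots> = (c0 * \<omega>' x v powr \<alpha>) * ((1 + M) * \<omega>' x v powr \<beta>)"
    by (simp add: powr_add algebra_simps)
  also have "\<dots> \<le> 1/2 * ((1 + M) * \<omega>' x v powr \<beta>)"
    using h M by (intro mult_right_mono) auto
  finally have "norm (defect x v) \<le> 1/2 * ((1 + M) * \<omega>' x v powr \<beta>)" .
  then have "norm (controlled_remainder x v) \<le> (L\<^sup>2 + L) * 1 * \<omega>' x v powr \<beta> + 1/2 * ((1 + M) * \<omega>' x v powr \<beta>)"
    using controlled_remainder_bound[of x v \<omega>' 1] drv[of x v] st xv by auto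
  also have "\<dots> = (L\<^sup>2 + L + 1/2 + M / 2) * \<omega>' x v powr \<beta>" by (simp add: algebra_simps)
  also have "\<dots> \<le> (3 * L\<^sup>2 + M / 2) * \<omega>' x v powr \<beta>"
    using L_ge_1 self_le_power[OF L_ge_1, of 2] by (intro mult_right_mono) auto
  finally show ?thesis .
qed

text \<open>Iterating the self-improvement forgets the initial constant M.\<close>

lemma remainder_small_control:
  assumes ctrl: "control T \<omega>'" and le: "\<And>x v. 0 \<le> x \<Longrightarrow> x < v \<Longrightarrow> v \<le> T \<Longrightarrow> \<omega> x v \<le> \<omega>' x v"
    and st: "0 \<le> s" "s < t" "t \<le> T" and small: "c0 * \<omega>' s t powr \<alpha> \<le> 1/2" "\<omega>' s t \<le> W" and M: "0 \<le> M"
    and R: "\<And>x v. s \<le> x \<Longrightarrow> x < v \<Longrightarrow> v \<le> t \<Longrightarrow> norm (controlled_remainder x v) \<le> M * \<omega>' x v powr \<beta>"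
  shows "norm (controlled_remainder s t) \<le> 6 * L\<^sup>2 * \<omega>' s t powr \<beta>"
proof -
  have step: "norm (controlled_remainder x v) \<le> (6 * L\<^sup>2 + M / 2 ^ n) * \<omega>' x v powr \<beta>"
    if "s \<le> x" "x < v" "v \<le> t" for x v n
    using that
  proof (induction n arbitrary: x v)
    case 0
    have "M * \<omega>' x v powr \<beta> \<le> (6 * L\<^sup>2 + M / 2 ^ 0) * \<omega>' x v powr \<beta>"
      by (intro mult_right_mono) auto
    then show ?case using R[OF 0] by linarith
  next
    case (Suc n)
    have "norm (controlled_remainder x v) \<le> (3 * L\<^sup>2 + (6 * L\<^sup>2 + M / 2 ^ n) / 2) * \<omega>' x v powr \<beta>"
      by (rule remainder_halving[OF ctrl le st(1,3) small _ Suc.IH]) (use M Suc.prems in auto)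
    then show ?case by (simp add: field_simps)
  qed
  have "(\<lambda>n. (6 * L\<^sup>2 + M / 2 ^ n) * \<omega>' s t powr \<beta>) \<longlonglongrightarrow> (6 * L\<^sup>2 + 0) * \<omega>' s t powr \<beta>"
    by (intro tendsto_intros LIMSEQ_divide_realpow_zero) auto
  then show ?thesis
    using LIMSEQ_le_const[of _ _ "norm (controlled_remainder s t)"] step[of s t] st by auto
qed

definition \<delta>0 :: real where "\<delta>0 = (1 / (2 * c0)) powr (1 / \<alpha>)"

lemma \<delta>0: "0 < \<delta>0" "\<delta>0 \<le> 1" "c0 * \<delta>0 powr \<alpha> = 1/2"
proof -
  show "0 < \<delta>0" using c0_ge_1 by (simp add: \<delta>0_def)
  have "\<delta>0 powr \<alpha> = 1 / (2 * c0)" using exponents c0_ge_1 by (simp add: \<delta>0_def powr_powr)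
  then show "c0 * \<delta>0 powr \<alpha> = 1/2" using c0_ge_1 by simp
  have "\<delta>0 \<le> 1 powr (1 / \<alpha>)"
    unfolding \<delta>0_def using exponents c0_ge_1 by (intro powr_mono2) auto
  then show "\<delta>0 \<le> 1" by simp
qed

text \<open>The remainder is not known in advance to be dominated by \<^term>\<open>\<omega>\<close>.  It is dominated by
  \<^term>\<open>\<omega>\<close> plus a small multiple of its own variation, with a bad constant; the self-improvement
  replaces that constant by a universal one, and then the small multiple can be sent to zero.\<close>

lemma remainder_small:
  assumes st: "0 \<le> s" "s < t" "t \<le> T" and small: "\<omega> s t < \<delta>0"
  shows "norm (controlled_remainder s t) \<le> 6 * L\<^sup>2 * \<omega> s t powr \<beta>"
proof -
  obtain v where v: "\<And>x y. 0 \<le> x \<Longrightarrow> x \<le> y \<Longrightarrow> y \<le> T \<Longrightarrow> v x \<le> v y"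
    "\<And>x y. 0 \<le> x \<Longrightarrow> x \<le> y \<Longrightarrow> y \<le> T \<Longrightarrow> norm (controlled_remainder x y) \<le> (v y - v x :: real) powr \<beta>"
    using finite_remainder by (auto simp: controlled_remainder_def state_def)
  have \<beta>: "0 \<le> \<beta>" using exponents by linarith
  define B where "B = v t - v s"
  have B: "0 \<le> B" using v(1)[of s t] st by (simp add: B_def)
  define r where "r = (\<delta>0 - \<omega> s t) / (B + 1)"
  have r: "0 < r" using small B by (simp add: r_def)
  have bound: "norm (controlled_remainder s t) \<le> 6 * L\<^sup>2 * (\<omega> s t + \<kappa> * B) powr \<beta>"
    if l: "0 < \<kappa>" "\<kappa> \<le> r" for \<kappa>
  proof -
    define \<omega>' where "\<omega>' x y = \<omega> x y + \<kappa> * (v y - v x)" for x y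
    have le: "\<omega> x y \<le> \<omega>' x y" "\<kappa> * (v y - v x) \<le> \<omega>' x y" "0 \<le> \<kappa> * (v y - v x)"
      if "0 \<le> x" "x \<le> y" "y \<le> T" for x y
      using v(1)[OF that] \<omega>_range(1)[OF that] l by (auto simp: \<omega>'_def)
    have ctrl: "control T \<omega>'"
      unfolding control_def simplex2_def
    proof (intro conjI allI impI; clarify)
      show "0 \<le> \<omega>' x y" if "0 \<le> x" "x \<le> y" "y \<le> T" for x y
        using le[OF that] by linarith
      show "\<omega>' x u + \<omega>' u y \<le> \<omega>' x y" if "0 \<le> x" "x \<le> u" "u \<le> y" "y \<le> T" for x u y
        using control_add[OF control_\<omega> that] by (simp add: \<omega>'_def algebra_simps)
    qed
    have "\<kappa> * B \<le> r * B" using l B by (intro mult_right_mono)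
    also have "\<dots> \<le> r * (B + 1)" using r by (simp add: algebra_simps)
    also have "\<dots> = \<delta>0 - \<omega> s t" using B by (simp add: r_def)
    finally have d: "\<omega>' s t \<le> \<delta>0" by (simp add: \<omega>'_def B_def)
    have "c0 * \<omega>' s t powr \<alpha> \<le> c0 * \<delta>0 powr \<alpha>"
      using d c0_ge_1 exponents control_nonneg[OF ctrl, of s t] st by (intro mult_left_mono powr_mono2) auto
    then have small': "c0 * \<omega>' s t powr \<alpha> \<le> 1/2" using \<delta>0 by simp
    have R: "norm (controlled_remainder x y) \<le> (1 / \<kappa>) powr \<beta> * \<omega>' x y powr \<beta>"
      if "0 \<le> x" "x < y" "y \<le> T" for x y
    proof -
      have "norm (controlled_remainder x y) \<le> (v y - v x) powr \<beta>" using v(2)[of x y] that by auto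
      also have "\<dots> = (1 / \<kappa> * (\<kappa> * (v y - v x))) powr \<beta>" using l by simp
      also have "\<dots> = (1 / \<kappa>) powr \<beta> * (\<kappa> * (v y - v x)) powr \<beta>" by (rule powr_mult)
      also have "\<dots> \<le> (1 / \<kappa>) powr \<beta> * \<omega>' x y powr \<beta>"
        using le[of x y] that \<beta> by (intro mult_left_mono powr_mono2) auto
      finally show ?thesis .
    qed
    have "norm (controlled_remainder s t) \<le> 6 * L\<^sup>2 * \<omega>' s t powr \<beta>"
      by (rule remainder_small_control[OF ctrl _ st small', of "(1 / \<kappa>) powr \<beta>"])
        (use le R st d \<delta>0 W_ge_1 in auto)
    then show ?thesis by (simp add: \<omega>'_def B_def)
  qed
  have "((\<lambda>\<kappa>. 6 * L\<^sup>2 * (\<omega> s t + \<kappa> * B) powr \<beta>) \<longlongrightarrow> 6 * L\<^sup>2 * (\<omega> s t + 0 * B) powr \<beta>) (at_right 0)"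
    using exponents B \<omega>_range(1)[of s t] st
    by (intro tendsto_mult_left tendsto_powr2 tendsto_intros)
      (auto simp: eventually_at_filter intro!: always_eventually)
  moreover have "eventually (\<lambda>\<kappa>. norm (controlled_remainder s t) \<le> 6 * L\<^sup>2 * (\<omega> s t + \<kappa> * B) powr \<beta>) (at_right 0)"
    using r bound by (auto simp: eventually_at_right_field intro!: exI[of _ r])
  ultimately show ?thesis
    using tendsto_lowerbound[of _ _ "at_right (0::real)" "norm (controlled_remainder s t)"] by simp
qed

definition c1 :: real where "c1 = 3 * L\<^sup>2 * W + 7 * L\<^sup>2 * c0 * W\<^sup>2"

lemma powr_\<omega>_le:
  assumes "0 \<le> s" "s \<le> t" "t \<le> T"
  shows "\<omega> s t powr \<alpha> \<le> W" "\<omega> s t powr \<beta> \<le> W" "\<omega> s t powr \<beta> \<le> W * \<omega> s t powr \<alpha>"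
    "\<omega> s t powr (\<alpha> + \<beta>) \<le> W * \<omega> s t powr \<beta>"
proof -
  have "x \<le> W" if "0 \<le> e" "e \<le> 1" "x = \<omega> s t powr e" for e x
  proof -
    have "\<omega> s t powr e \<le> W powr e" using \<omega>_range[OF assms] that by (intro powr_mono2) auto
    also have "\<dots> \<le> W powr 1" using that W_ge_1 by (intro powr_mono) auto
    finally show ?thesis using W_ge_1 that by simp
  qed
  then show "\<omega> s t powr \<alpha> \<le> W" "\<omega> s t powr \<beta> \<le> W" using exponents by auto
  show "\<omega> s t powr \<beta> \<le> W * \<omega> s t powr \<alpha>" "\<omega> s t powr (\<alpha> + \<beta>) \<le> W * \<omega> s t powr \<beta>"
    using \<omega>_range[OF assms] exponents W_ge_1 by (auto intro!: powr_lower_exponent)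
qed

text \<open>Closing up an interval at the right costs nothing, as the coboundary of the germ only sees the
  remainder up to the last but one point.  Therefore a jump of arbitrary size at the right end point
  does no harm.\<close>

lemma increment_almost_small:
  assumes st: "0 \<le> s" "s < t" "t \<le> T" and small: "\<And>v. s < v \<Longrightarrow> v < t \<Longrightarrow> \<omega> s v < \<delta>0"
  shows "norm (Y t - Y s) \<le> c1"
proof -
  have L2: "L \<le> L\<^sup>2" "1 \<le> L\<^sup>2" using L_ge_1 self_le_power[OF L_ge_1, of 2] by auto
  have R: "norm (controlled_remainder x v) \<le> 6 * L\<^sup>2 * \<omega> x v powr \<beta>" if "s \<le> x" "x < v" "v < t" for x v
    using control_mono[OF control_\<omega>, of s x v v] small[of v] st that by (intro remainder_small) auto
  have "norm (defect s t) \<le> c0 * 1 * (1 + 6 * L\<^sup>2) * \<omega> s t powr (\<alpha> + \<beta>)"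
    by (rule defect_bound[OF control_\<omega> st]) (use st R driver \<omega>_range[of s t] in auto)
  also have "\<dots> \<le> c0 * 1 * (7 * L\<^sup>2) * W\<^sup>2"
  proof (intro mult_mono mult_left_mono)
    have "\<omega> s t powr (\<alpha> + \<beta>) \<le> W * \<omega> s t powr \<beta>" using powr_\<omega>_le(4) st by auto
    also have "\<dots> \<le> W * W" using powr_\<omega>_le(2)[of s t] st W_ge_1 by (intro mult_left_mono) auto
    finally show "\<omega> s t powr (\<alpha> + \<beta>) \<le> W\<^sup>2" by (simp add: power2_eq_square)
  qed (use c0_ge_1 L2 in auto)
  finally have d: "norm (defect s t) \<le> 7 * L\<^sup>2 * c0 * W\<^sup>2" by (simp add: algebra_simps)
  have D: "norm (X t - X s) \<le> W" "contraction_const TYPE('d) * norm (XX s t) \<le> W" "t - s \<le> W"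
    using driver[OF st] powr_\<omega>_le(1,2)[of s t] st by (auto simp: driver_bound_def)
  have "L * (t - s) \<le> L\<^sup>2 * W" using D L2 L_ge_1 st by (intro mult_mono) auto
  then have dr: "norm (drift s t) \<le> L\<^sup>2 * W" using drift_bound[of s t] st by linarith
  have "L * norm (X t - X s) \<le> L\<^sup>2 * W" using D L2 L_ge_1 by (intro mult_mono) auto
  then have g1: "norm (\<sigma> (state s) (X t - X s)) \<le> L\<^sup>2 * W"
    using first_order_bounds(1)[of "state s" "X t - X s"] by simp
  have g2: "norm (apply_matrix (\<Gamma> (state s)) (XX s t)) \<le> L\<^sup>2 * W"
    by (rule second_level_bound[OF D(2) \<Gamma>_bound])
  have "Y t - Y s = (\<sigma> (state s) (X t - X s) + apply_matrix (\<Gamma> (state s)) (XX s t)) + (drift s t + defect s t)"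
    by (simp add: defect_def germ_def)
  from norm_add_le2[OF this] norm_triangle_ineq[of "\<sigma> (state s) (X t - X s)" "apply_matrix (\<Gamma> (state s)) (XX s t)"]
    norm_triangle_ineq[of "drift s t" "defect s t"] d dr g1 g2
  show ?thesis by (simp add: c1_def)
qed

text \<open>Induction on the number of steps of size \<open>\<delta>0\<close> in the control.  The first step ends at the last
  time c before the control exceeds \<open>\<delta>0\<close>; beyond c less than n steps are left.  As the control need not be
  small to the right of c, the increment after c is taken from times \<open>v > c\<close>, and right-continuity of the
  solution closes the gap.\<close>

lemma increment_le_steps:
  assumes "0 \<le> s" "s < t" "t \<le> T" "\<omega> s t < real n * \<delta>0"
  shows "norm (Y t - Y s) \<le> real n * c1"
  using assms
proof (induction n arbitrary: s)
  case 0
  then show ?case using \<omega>_range(1)[of s t] by simp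
next
  case (Suc n)
  have c1: "0 \<le> c1" using L_ge_1 W_ge_1 c0_ge_1 by (simp add: c1_def)
  define c where "c = Sup {v. s \<le> v \<and> v \<le> t \<and> \<omega> s v < \<delta>0}" (is "_ = Sup ?S")
  have "\<omega> s s + \<omega> s s \<le> \<omega> s s" using Suc.prems by (intro control_add[OF control_\<omega>]) auto
  then have "s \<in> ?S" using Suc.prems \<delta>0 by auto
  have bdd: "bdd_above ?S" by (rule bdd_aboveI[of _ t]) auto
  have c: "s \<le> c" "c \<le> t"
    unfolding c_def using \<open>s \<in> ?S\<close> bdd by (auto intro: cSup_upper cSup_least)
  have below: "\<omega> s v < \<delta>0" if v: "s < v" "v < c" for v
  proof -
    obtain v' where "v' \<in> ?S" "v < v'" using v \<open>s \<in> ?S\<close> less_cSupD[of ?S v] by (auto simp: c_def)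
    then show ?thesis using control_mono[OF control_\<omega>, of s s v v'] v Suc.prems by auto
  qed
  have first: "norm (Y c - Y s) \<le> c1"
  proof (cases "c = s")
    case True then show ?thesis using c1 by simp
  next
    case False
    then show ?thesis using c below Suc.prems by (intro increment_almost_small) auto
  qed
  show ?case
  proof (cases "c = t")
    case True
    have "1 * c1 \<le> real (Suc n) * c1" using c1 by (intro mult_right_mono) auto
    then show ?thesis using first True by simp
  next
    case False
    have above: "norm (Y t - Y v) \<le> real n * c1" if v: "c < v" "v < t" for v
    proof -
      have "v \<notin> ?S" using v cSup_upper[OF _ bdd, of v] by (auto simp: c_def)
      then have "\<delta>0 \<le> \<omega> s v" using v c by auto
      moreover have "\<omega> s v + \<omega> v t \<le> \<omega> s t" using v c Suc.prems by (intro control_add[OF control_\<omega>]) auto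
      ultimately have "\<omega> v t < real n * \<delta>0" using Suc.prems(4) by (simp add: algebra_simps)
      then show ?thesis using v c Suc.prems by (intro Suc.IH) auto
    qed
    have "(Y \<longlongrightarrow> Y c) (at_right c)"
      using c False Suc.prems by (intro right_continuous) auto
    then have "((\<lambda>v. norm (Y t - Y v)) \<longlongrightarrow> norm (Y t - Y c)) (at_right c)"
      by (intro tendsto_intros)
    moreover have "eventually (\<lambda>v. norm (Y t - Y v) \<le> real n * c1) (at_right c)"
      using above c False by (auto simp: eventually_at_right_field intro!: exI[of _ t])
    ultimately have "norm (Y t - Y c) \<le> real n * c1"
      by (intro tendsto_upperbound) auto
    moreover have "norm (Y t - Y s) \<le> norm (Y t - Y c) + norm (Y c - Y s)"
      by (rule norm_add_le2) simp
    ultimately show ?thesis using first by (simp add: algebra_simps)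
  qed
qed

definition M0 :: real where
  "M0 = 6 * L\<^sup>2 + ((W / \<delta>0 + 1) * c1 + L * W) * (1 / \<delta>0) powr \<beta>"

lemma M0_nonneg: "0 \<le> M0"
  using L_ge_1 W_ge_1 c0_ge_1 \<delta>0 by (auto simp: M0_def c1_def)

text \<open>An interval whose control exceeds \<open>\<delta>0\<close> is harmless: there the bound on the increments suffices, as
  \<open>\<omega> s t / \<delta>0\<close> is at least 1.\<close>

lemma remainder_bound:
  assumes st: "0 \<le> s" "s < t" "t \<le> T"
  shows "norm (controlled_remainder s t) \<le> M0 * \<omega> s t powr \<beta>"
proof (cases "\<omega> s t < \<delta>0")
  case True
  have "6 * L\<^sup>2 * \<omega> s t powr \<beta> \<le> M0 * \<omega> s t powr \<beta>"
    using L_ge_1 W_ge_1 c0_ge_1 \<delta>0 by (intro mult_right_mono) (auto simp: M0_def c1_def)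
  then show ?thesis using remainder_small[OF st True] by linarith
next
  case False
  have c1: "0 \<le> c1" using L_ge_1 W_ge_1 c0_ge_1 by (simp add: c1_def)
  define n where "n = nat \<lfloor>W / \<delta>0\<rfloor> + 1"
  have q: "0 \<le> W / \<delta>0" using W_ge_1 \<delta>0 by simp
  have n: "W / \<delta>0 < real n" "real n \<le> W / \<delta>0 + 1" unfolding n_def using q by linarith+
  have "\<omega> s t < real n * \<delta>0"
    using n(1) \<omega>_range(2)[of s t] st \<delta>0 by (simp add: field_simps)
  then have "norm (Y t - Y s) \<le> real n * c1" by (rule increment_le_steps[OF st])
  also have "\<dots> \<le> (W / \<delta>0 + 1) * c1" using n c1 by (intro mult_right_mono) auto
  finally have y: "norm (Y t - Y s) \<le> (W / \<delta>0 + 1) * c1" .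
  have "norm (X t - X s) \<le> W"
    using driver[OF st] powr_\<omega>_le(1)[of s t] st by (auto simp: driver_bound_def)
  then have "L * norm (X t - X s) \<le> L * W" using L_ge_1 by (intro mult_left_mono) auto
  then have x: "norm (\<sigma> (state s) (X t - X s)) \<le> L * W"
    using first_order_bounds(1)[of "state s" "X t - X s"] by simp
  let ?A = "(W / \<delta>0 + 1) * c1 + L * W"
  have A: "0 \<le> ?A" using c1 q L_ge_1 W_ge_1 by simp
  have "norm (controlled_remainder s t) \<le> ?A * 1"
    using norm_diff_le2[of "controlled_remainder s t" "Y t - Y s" "\<sigma> (state s) (X t - X s)"] x y
    by (simp add: controlled_remainder_def)
  also have "\<dots> \<le> ?A * (1 / \<delta>0 * \<omega> s t) powr \<beta>"
  proof (intro mult_left_mono A)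
    have "1 \<le> 1 / \<delta>0 * \<omega> s t" using False \<delta>0 by (simp add: field_simps)
    then show "1 \<le> (1 / \<delta>0 * \<omega> s t) powr \<beta>" using exponents by (intro ge_one_powr_ge_zero) auto
  qed
  also have "(1 / \<delta>0 * \<omega> s t) powr \<beta> = (1 / \<delta>0) powr \<beta> * \<omega> s t powr \<beta>" by (rule powr_mult)
  also have "?A * ((1 / \<delta>0) powr \<beta> * \<omega> s t powr \<beta>) = (?A * (1 / \<delta>0) powr \<beta>) * \<omega> s t powr \<beta>" by simp
  also have "\<dots> \<le> M0 * \<omega> s t powr \<beta>"
    using L_ge_1 by (intro mult_right_mono) (auto simp: M0_def)
  finally show ?thesis .
qed

section \<open>Cells of the partition\<close>

definition M1 :: real where "M1 = L\<^sup>2 + L + c0 * (1 + M0) * W"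

lemma M1_nonneg: "0 \<le> M1"
  using L_ge_1 W_ge_1 c0_ge_1 M0_nonneg by (auto simp: M1_def)

text \<open>Where the driver is small, so is the remainder: the defect carries one factor of the driver
  at its right end.\<close>

lemma remainder_in_cell:
  assumes st: "0 \<le> s" "s < t" "t \<le> T" and e: "0 \<le> e"
    and cell: "\<And>x v. s \<le> x \<Longrightarrow> x < v \<Longrightarrow> v \<le> t \<Longrightarrow> driver_bound \<alpha> \<beta> X XX \<omega> e x v"
  shows "norm (controlled_remainder s t) \<le> e * M1 * \<omega> s t powr \<beta>"
proof -
  have "norm (defect s t) \<le> c0 * e * (1 + M0) * \<omega> s t powr (\<alpha> + \<beta>)"
    by (rule defect_bound[OF control_\<omega> st])
      (use st e M0_nonneg remainder_bound driver cell \<omega>_range[of s t] in auto)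
  also have "\<dots> \<le> c0 * e * (1 + M0) * (W * \<omega> s t powr \<beta>)"
    using powr_\<omega>_le(4)[of s t] st c0_ge_1 e M0_nonneg by (intro mult_left_mono) auto
  finally have "norm (controlled_remainder s t)
      \<le> (L\<^sup>2 + L) * e * \<omega> s t powr \<beta> + c0 * e * (1 + M0) * (W * \<omega> s t powr \<beta>)"
    using controlled_remainder_bound[OF st cell[of s t]] st by auto
  then show ?thesis by (simp add: M1_def algebra_simps)
qed

lemma increment_in_cell:
  assumes st: "0 \<le> s" "s < t" "t \<le> T" and e: "0 \<le> e"
    and cell: "\<And>x v. s \<le> x \<Longrightarrow> x < v \<Longrightarrow> v \<le> t \<Longrightarrow> driver_bound \<alpha> \<beta> X XX \<omega> e x v"
  shows "norm (Y t - Y s) \<le> e * (L + M1 * W) * \<omega> s t powr \<alpha>"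
proof -
  have "L * norm (X t - X s) \<le> L * (e * \<omega> s t powr \<alpha>)"
    using cell[of s t] st L_ge_1 by (intro mult_left_mono) (auto simp: driver_bound_def)
  moreover have "e * M1 * \<omega> s t powr \<beta> \<le> e * M1 * (W * \<omega> s t powr \<alpha>)"
    using powr_\<omega>_le(3)[of s t] st e M1_nonneg by (intro mult_left_mono) auto
  ultimately have "norm (Y t - Y s) \<le> L * (e * \<omega> s t powr \<alpha>) + e * M1 * (W * \<omega> s t powr \<alpha>)"
    using remainder_in_cell[OF st e cell] increment_bound[of t s] by force
  then show ?thesis by (simp add: algebra_simps)
qed

text \<open>Across the whole cell the driver may jump at the right end point.  The smallness now comes
  from the left factor of the coboundary.\<close>

lemma defect_of_cell:
  assumes st: "0 \<le> s" "s < t" "t \<le> T" and e: "0 \<le> e"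
    and cell: "\<And>x v. s \<le> x \<Longrightarrow> x < v \<Longrightarrow> v < t \<Longrightarrow> driver_bound \<alpha> \<beta> X XX \<omega> e x v"
  shows "norm (defect s t) \<le> e * (c0 * (1 + M1)) * \<omega> s t powr (\<alpha> + \<beta>)"
proof -
  have "norm (defect s t) \<le> c0 * 1 * (e + e * M1) * \<omega> s t powr (\<alpha> + \<beta>)"
  proof (rule defect_bound[OF control_\<omega> st])
    show "norm (controlled_remainder x v) \<le> e * M1 * \<omega> x v powr \<beta>" if "s \<le> x" "x < v" "v < t" for x v
      using that st e cell by (intro remainder_in_cell) auto
  qed (use st e M1_nonneg driver cell \<omega>_range[of s t] in auto)
  then show ?thesis by (simp add: algebra_simps)
qed

section \<open>Stability along the partition\<close>

text \<open>The number \<open>e * B1\<close> bounds the oscillation of \<open>(t, Y t)\<close> in a cell.  On a block of control at most \<open>\<delta>1\<close>,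
  \<open>c2\<close> and \<open>c3\<close> are the factors of the error in its remainder and in the coboundary of its defect,
  \<open>c4\<close> those of the defect after sewing, \<open>c5\<close> those of the increments, and \<open>\<delta>1\<close> is chosen such that
  both the defect and the error come back with a factor one half.  Finally \<open>c7\<close> is the cost of a single
  cell, \<open>c8\<close> that of all blocks and cells together, and \<open>c9\<close> includes the increments between grid points.\<close>

definition B1 :: real where "B1 = W + (L + M1 * W) * W"
definition c2 :: real where "c2 = 3 * L\<^sup>2 + L * B1"
definition c3 :: real where
  "c3 = 2 * L\<^sup>2 * (1 + M0) + 3 * L ^ 3 + 4 * L\<^sup>2 * (1 + L + M0) + 2 * L ^ 3"
definition c4 :: real where
  "c4 = 2 * sewing_const (\<alpha> + \<beta>) * (c3 + 3 * L\<^sup>2 * c2 + c0 * (1 + M1))"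
definition c5 :: real where "c5 = L + c2 + c4"
definition c6 :: real where "c6 = sewing_const (\<alpha> + \<beta>) * (3 * L\<^sup>2) + c5"
definition \<delta>1 :: real where "\<delta>1 = (1 / (2 * c6)) powr (1 / \<alpha>)"
definition c7 :: real where
  "c7 = 1 + 2 * L * W + L * B1 * W + L\<^sup>2 * W + c0 * (1 + M1) * W\<^sup>2"
definition c8 :: real where "c8 = 2 * (2 * (c7 + 1)) ^ nat \<lceil>W / \<delta>1\<rceil>"
definition c9 :: real where
  "c9 = 2 * c5 * (c8 + 1) + 2 * c8 * (1 / \<delta>1) powr \<alpha> + 2 * (L + M1 * W)"

lemma constants_nonneg:
  "0 \<le> B1" "0 \<le> c2" "0 \<le> c3" "0 \<le> c4" "1 \<le> c5" "1 \<le> c6" "1 \<le> c7" "0 \<le> c8" "3 \<le> sewing_const (\<alpha> + \<beta>)"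
proof -
  show C: "3 \<le> sewing_const (\<alpha> + \<beta>)" by (rule sewing_const[OF exponents(4)])
  have L: "0 \<le> L" "1 \<le> L" "0 \<le> W" and c: "0 \<le> c0" using L_ge_1 W_ge_1 c0_ge_1 by auto
  note p = L c M0_nonneg M1_nonneg
  show B1: "0 \<le> B1" unfolding B1_def using p by (intro mult_nonneg_nonneg add_nonneg_nonneg) auto
  then show c2: "0 \<le> c2" unfolding c2_def using p by (intro mult_nonneg_nonneg add_nonneg_nonneg) auto
  show c3: "0 \<le> c3" unfolding c3_def using p by (intro mult_nonneg_nonneg add_nonneg_nonneg) auto
  have "0 \<le> c0 * (1 + M1)" using p by (intro mult_nonneg_nonneg) auto
  then show c4: "0 \<le> c4" unfolding c4_def using p C c2 c3 by (intro mult_nonneg_nonneg add_nonneg_nonneg) auto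
  then show "1 \<le> c5" unfolding c5_def using c2 L by linarith
  moreover have "0 \<le> sewing_const (\<alpha> + \<beta>) * (3 * L\<^sup>2)" using C by (intro mult_nonneg_nonneg) auto
  ultimately show "1 \<le> c6" unfolding c6_def by linarith
  have "0 \<le> 2 * L * W" "0 \<le> L * B1 * W" "0 \<le> L\<^sup>2 * W" "0 \<le> c0 * (1 + M1) * W\<^sup>2"
    using p B1 by (auto intro!: mult_nonneg_nonneg)
  then show c7: "1 \<le> c7" unfolding c7_def by linarith
  show "0 \<le> c8" unfolding c8_def using c7 by (intro mult_nonneg_nonneg zero_le_power) auto
qed

lemma \<delta>1:
  "0 < \<delta>1" "\<delta>1 \<le> 1" "sewing_const (\<alpha> + \<beta>) * (3 * L\<^sup>2) * \<delta>1 powr \<alpha> \<le> 1/2" "c5 * \<delta>1 powr \<alpha> \<le> 1/2"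
proof -
  show "0 < \<delta>1" using constants_nonneg(6) by (simp add: \<delta>1_def)
  have d: "\<delta>1 powr \<alpha> = 1 / (2 * c6)" using exponents constants_nonneg(6) by (simp add: \<delta>1_def powr_powr)
  have "\<delta>1 \<le> 1 powr (1 / \<alpha>)"
    unfolding \<delta>1_def using exponents constants_nonneg(6) by (intro powr_mono2) auto
  then show "\<delta>1 \<le> 1" by simp
  have c6: "c6 * \<delta>1 powr \<alpha> = 1/2" using d constants_nonneg(6) by simp
  have "0 \<le> sewing_const (\<alpha> + \<beta>) * (3 * L\<^sup>2)" using constants_nonneg(9) by (intro mult_nonneg_nonneg) auto
  then have "sewing_const (\<alpha> + \<beta>) * (3 * L\<^sup>2) * \<delta>1 powr \<alpha> \<le> c6 * \<delta>1 powr \<alpha>" "c5 * \<delta>1 powr \<alpha> \<le> c6 * \<delta>1 powr \<alpha>"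
    using constants_nonneg(5) by (auto intro!: mult_right_mono simp: c6_def)
  then show "sewing_const (\<alpha> + \<beta>) * (3 * L\<^sup>2) * \<delta>1 powr \<alpha> \<le> 1/2" "c5 * \<delta>1 powr \<alpha> \<le> 1/2"
    using c6 by auto
qed

end

text \<open>The sequence Z is the Euler scheme at the grid points, and XN the second level formed with the Riemann
  sums.  The number e measures both the distance of the two second levels on the grid and the size of the
  driver inside the cells.\<close>

locale euler_comparison = rough_equation L \<sigma> T \<alpha> \<beta> W \<omega> X XX b Y y0 I
  for L :: real and \<sigma> :: "real \<times> (real^'k) \<Rightarrow> (real^'d) \<Rightarrow>\<^sub>L (real^'k)" and T \<alpha> \<beta> W \<omega> X XX b Y y0 I +
  fixes N :: nat and \<tau> :: "nat \<Rightarrow> real" and XN :: "real \<Rightarrow> real \<Rightarrow> real^'d^'d" and e :: real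
    and Z :: "nat \<Rightarrow> real^'k"
  assumes partition: "interval_partition 0 T N \<tau>" and e_nonneg: "0 \<le> e"
    and chen_N: "\<And>s u t. XN s t = XN s u + XN u t + (X u - X s) \<otimes>\<^sub>v (X t - X u)"
    and XN_bound: "\<And>k l. k < l \<Longrightarrow> l \<le> N \<Longrightarrow>
      contraction_const TYPE('d) * norm (XN (\<tau> k) (\<tau> l)) \<le> \<omega> (\<tau> k) (\<tau> l) powr \<beta>"
    and XN_close: "\<And>k l. k < l \<Longrightarrow> l \<le> N \<Longrightarrow>
      contraction_const TYPE('d) * norm (XX (\<tau> k) (\<tau> l) - XN (\<tau> k) (\<tau> l)) \<le> e * \<omega> (\<tau> k) (\<tau> l) powr \<beta>"
    and XN_step: "\<And>k. k < N \<Longrightarrow> XN (\<tau> k) (\<tau> (Suc k)) = 0"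
    and cell: "\<And>k x v. k < N \<Longrightarrow> \<tau> k \<le> x \<Longrightarrow> x < v \<Longrightarrow> v < \<tau> (Suc k) \<Longrightarrow> driver_bound \<alpha> \<beta> X XX \<omega> e x v"
    and Z_0: "Z 0 = Y 0"
    and Z_Suc: "\<And>k. k < N \<Longrightarrow> Z (Suc k) = Z k + (\<tau> (Suc k) - \<tau> k) *\<^sub>R b (\<tau> k, Z k)
      + \<sigma> (\<tau> k, Z k) (X (\<tau> (Suc k)) - X (\<tau> k))"
begin

abbreviation "\<Omega> k l \<equiv> \<omega> (\<tau> k) (\<tau> l)"

definition stateN :: "nat \<Rightarrow> real \<times> (real^'k)" where "stateN k = (\<tau> k, Z k)"

definition err :: "nat \<Rightarrow> real^'k" where "err k = Y (\<tau> k) - Z k"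

definition drift_err :: "nat \<Rightarrow> nat \<Rightarrow> real^'k" where
  "drift_err k l = drift (\<tau> k) (\<tau> l) - (\<Sum>i=k..<l. (\<tau> (Suc i) - \<tau> i) *\<^sub>R b (stateN i))"

definition germN :: "nat \<Rightarrow> nat \<Rightarrow> real^'k" where
  "germN k l = \<sigma> (stateN k) (X (\<tau> l) - X (\<tau> k)) + apply_matrix (\<Gamma> (stateN k)) (XN (\<tau> k) (\<tau> l))"

text \<open>The defect of the solution minus that of the scheme.  The drifts are additive in time, so they are
  subtracted in full and do not contribute to the coboundary.\<close>

definition defect_err :: "nat \<Rightarrow> nat \<Rightarrow> real^'k" where
  "defect_err k l = err l - err k - drift_err k l - (germ (\<tau> k) (\<tau> l) - germN k l)"

lemma \<tau>_range: "k \<le> N \<Longrightarrow> 0 \<le> \<tau> k" "k \<le> N \<Longrightarrow> \<tau> k \<le> T"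
  using interval_partition_bounds[OF partition] by auto

lemma \<tau>_mono: "k \<le> l \<Longrightarrow> l \<le> N \<Longrightarrow> \<tau> k \<le> \<tau> l"
  using interval_partition_mono[OF partition] .

lemma \<tau>_strict_mono: "k < l \<Longrightarrow> l \<le> N \<Longrightarrow> \<tau> k < \<tau> l"
  using interval_partition_strict_mono[OF partition] .

lemma state_diff: "norm (state (\<tau> k) - stateN k) = norm (err k)"
  by (simp add: state_def stateN_def err_def)

lemma grid_driver:
  assumes "k < l" "l \<le> N"
  shows "norm (X (\<tau> l) - X (\<tau> k)) \<le> \<Omega> k l powr \<alpha>" "(norm (X (\<tau> l) - X (\<tau> k)))\<^sup>2 \<le> \<Omega> k l powr \<beta>"
    "contraction_const TYPE('d) * norm (XX (\<tau> k) (\<tau> l)) \<le> \<Omega> k l powr \<beta>" "\<tau> l - \<tau> k \<le> \<Omega> k l powr \<beta>"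
  using driver[of "\<tau> k" "\<tau> l"] \<tau>_range[of k] \<tau>_range[of l] \<tau>_strict_mono[OF assms] assms
  by (auto simp: driver_bound_def)

lemma drift_err_add:
  assumes "k \<le> l" "l \<le> m" "m \<le> N"
  shows "drift_err k m = drift_err k l + drift_err l m"
proof -
  have "drift (\<tau> k) (\<tau> l) + drift (\<tau> l) (\<tau> m) = drift (\<tau> k) (\<tau> m)"
    using assms by (intro drift_add \<tau>_range \<tau>_mono) auto
  moreover have "(\<Sum>i=k..<m. (\<tau> (Suc i) - \<tau> i) *\<^sub>R b (stateN i))
      = (\<Sum>i=k..<l. (\<tau> (Suc i) - \<tau> i) *\<^sub>R b (stateN i)) + (\<Sum>i=l..<m. (\<tau> (Suc i) - \<tau> i) *\<^sub>R b (stateN i))"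
    using assms by (simp add: sum.atLeastLessThan_concat)
  ultimately show ?thesis by (simp add: drift_err_def algebra_simps)
qed

text \<open>The right end point, where the solution may jump away, is a null set.\<close>

lemma drift_err_cell:
  assumes k: "k < N" and S: "norm (err k) \<le> S"
  shows "norm (drift_err k (Suc k)) \<le> L * (e * B1 + S) * (\<tau> (Suc k) - \<tau> k)"
proof -
  let ?a = "\<tau> k" and ?c = "\<tau> (Suc k)"
  have ac: "0 \<le> ?a" "?a < ?c" "?c \<le> T" using \<tau>_range[of k] \<tau>_range[of "Suc k"] \<tau>_strict_mono[of k "Suc k"] k by auto
  have S0: "0 \<le> S" using S norm_ge_zero order_trans by blast
  have pointwise: "norm (b (r, Y r) - b (stateN k)) \<le> L * (e * B1 + S)" if r: "?a \<le> r" "r < ?c" for r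
  proof -
    have y: "norm (Y r - Y ?a) \<le> e * (L + M1 * W) * W" and tm: "\<bar>r - ?a\<bar> \<le> e * W"
    proof (atomize(full), cases "r = ?a")
      case True
      then show "norm (Y r - Y ?a) \<le> e * (L + M1 * W) * W \<and> \<bar>r - ?a\<bar> \<le> e * W"
        using e_nonneg L_ge_1 W_ge_1 M1_nonneg by auto
    next
      case False
      then have ar: "?a < r" using r by simp
      have o: "\<omega> ?a r powr \<alpha> \<le> W" "\<omega> ?a r powr \<beta> \<le> W"
        using powr_\<omega>_le(1,2)[of ?a r] ac r ar by auto
      have "norm (Y r - Y ?a) \<le> e * (L + M1 * W) * \<omega> ?a r powr \<alpha>"
        using ar ac r e_nonneg cell[OF k] by (intro increment_in_cell) auto
      also have "\<dots> \<le> e * (L + M1 * W) * W"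
        using o e_nonneg L_ge_1 W_ge_1 M1_nonneg by (intro mult_left_mono) auto
      finally have "norm (Y r - Y ?a) \<le> e * (L + M1 * W) * W" .
      moreover have "r - ?a \<le> e * \<omega> ?a r powr \<beta>" using cell[OF k _ ar r(2)] by (auto simp: driver_bound_def)
      then have "\<bar>r - ?a\<bar> \<le> e * W" using o(2) ar e_nonneg mult_left_mono[OF o(2), of e] by linarith
      ultimately show "norm (Y r - Y ?a) \<le> e * (L + M1 * W) * W \<and> \<bar>r - ?a\<bar> \<le> e * W" by blast
    qed
    have "norm ((r, Y r) - stateN k) \<le> \<bar>r - ?a\<bar> + norm ((Y r - Y ?a) + err k)"
      using norm_Pair_le[of "r - ?a" "Y r - Z k"] by (simp add: stateN_def err_def)
    also have "\<dots> \<le> \<bar>r - ?a\<bar> + (norm (Y r - Y ?a) + norm (err k))"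
      by (intro add_left_mono norm_triangle_ineq)
    also have "\<dots> \<le> e * B1 + S" using y tm S by (simp add: B1_def algebra_simps)
    finally have "L * norm ((r, Y r) - stateN k) \<le> L * (e * B1 + S)"
      using L_ge_1 by (intro mult_left_mono) auto
    with b_lipschitz[of "(r, Y r)" "stateN k"] show ?thesis by linarith
  qed
  have "((\<lambda>r. b (r, Y r)) has_integral drift ?a ?c) {?a..?c}"
    unfolding drift_def using drift_integrable_on[of ?a ?c] ac by (intro integrable_integral) auto
  from has_integral_diff[OF this has_integral_const_real[of "b (stateN k)" ?a ?c]]
  have "((\<lambda>r. b (r, Y r) - b (stateN k)) has_integral drift_err k (Suc k)) {?a..?c}"
    using ac by (simp add: drift_err_def)
  then have "norm (drift_err k (Suc k)) \<le> L * (e * B1 + S) * Henstock_Kurzweil_Integration.content {?a..?c}"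
  proof (rule has_integral_bound_real[rotated 2])
    show "norm (b (r, Y r) - b (stateN k)) \<le> L * (e * B1 + S)" if "r \<in> {?a..?c} - {?c}" for r
      using that by (intro pointwise) auto
  qed (use L_ge_1 e_nonneg S0 constants_nonneg(1) in auto)
  then show ?thesis using ac by simp
qed

lemma drift_err_bound:
  assumes kl: "k < l" "l \<le> N" and S: "\<And>i. k \<le> i \<Longrightarrow> i < l \<Longrightarrow> norm (err i) \<le> S"
  shows "norm (drift_err k l) \<le> L * (e * B1 + S) * \<Omega> k l powr \<beta>"
proof -
  have S0: "0 \<le> S" using S[of k] kl norm_ge_zero order_trans by blast
  have "norm (drift_err k m) \<le> L * (e * B1 + S) * (\<tau> m - \<tau> k)" if "k \<le> m" "m \<le> l" for m
    using that
  proof (induction m rule: dec_induct)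
    case base
    have "drift_err k k = drift_err k k + drift_err k k" using kl by (intro drift_err_add) auto
    then show ?case by simp
  next
    case (step m)
    have "drift_err k (Suc m) = drift_err k m + drift_err m (Suc m)"
      using step kl by (intro drift_err_add) auto
    from norm_add_le2[OF this] step drift_err_cell[of m S] S[of m] kl show ?case by (auto simp: algebra_simps)
  qed
  from this[of l] have "norm (drift_err k l) \<le> L * (e * B1 + S) * (\<tau> l - \<tau> k)" using kl by auto
  also have "\<dots> \<le> L * (e * B1 + S) * \<Omega> k l powr \<beta>"
    using grid_driver(4)[OF kl] L_ge_1 e_nonneg S0 constants_nonneg(1) by (intro mult_left_mono) auto
  finally show ?thesis .
qed

definition remainder_err :: "nat \<Rightarrow> nat \<Rightarrow> real^'k" where
  "remainder_err k l = controlled_remainder (\<tau> k) (\<tau> l) - (Z l - Z k - \<sigma> (stateN k) (X (\<tau> l) - X (\<tau> k)))"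

lemma remainder_err_bound:
  assumes kl: "k < l" "l \<le> N" and S: "\<And>i. k \<le> i \<Longrightarrow> i < l \<Longrightarrow> norm (err i) \<le> S"
    and D: "norm (defect_err k l) \<le> M * \<Omega> k l powr (\<alpha> + \<beta>)"
  shows "norm (remainder_err k l) \<le> (c2 * (S + e) + M * \<Omega> k l powr \<alpha>) * \<Omega> k l powr \<beta>"
proof -
  let ?w = "\<Omega> k l powr \<beta>" and ?XX = "XX (\<tau> k) (\<tau> l)" and ?XN = "XN (\<tau> k) (\<tau> l)"
  have Sk: "norm (err k) \<le> S" using S[of k] kl by simp
  have S0: "0 \<le> S" using Sk norm_ge_zero order_trans by blast
  let ?A = "apply_matrix (\<Gamma> (state (\<tau> k)) - \<Gamma> (stateN k)) ?XX" and ?B = "apply_matrix (\<Gamma> (stateN k)) (?XX - ?XN)"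
  have eq: "remainder_err k l = (?A + ?B) + (drift_err k l + defect_err k l)"
    by (simp add: remainder_err_def controlled_remainder_def defect_err_def germ_def germN_def err_def
        apply_matrix_linear)
  have "norm (\<Gamma> (state (\<tau> k)) - \<Gamma> (stateN k)) \<le> 2 * L\<^sup>2 * S"
    using \<Gamma>_lipschitz[of "state (\<tau> k)" "stateN k"] Sk mult_left_mono[OF Sk, of "2 * L\<^sup>2"] by (simp add: state_diff)
  then have A: "norm ?A \<le> 2 * L\<^sup>2 * S * ?w"
    by (rule second_level_bound[OF grid_driver(3)[OF kl]])
  have B: "norm ?B \<le> L\<^sup>2 * (e * ?w)"
    by (rule second_level_bound[OF XN_close[OF kl] \<Gamma>_bound])
  have Dr: "norm (drift_err k l) \<le> L * (e * B1 + S) * ?w"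
    by (rule drift_err_bound[OF kl S])
  have "norm (remainder_err k l) \<le> 2 * L\<^sup>2 * S * ?w + L\<^sup>2 * (e * ?w) + L * (e * B1 + S) * ?w
      + M * \<Omega> k l powr (\<alpha> + \<beta>)"
    using norm_add_le2[OF eq] norm_triangle_ineq[of ?A ?B] norm_triangle_ineq[of "drift_err k l" "defect_err k l"]
      A B Dr D by linarith
  also have "\<dots> = ((2 * L\<^sup>2 + L) * S + (L\<^sup>2 + L * B1) * e) * ?w + M * \<Omega> k l powr \<alpha> * ?w"
    by (simp add: powr_add algebra_simps)
  also have "\<dots> \<le> (c2 * S + c2 * e) * ?w + M * \<Omega> k l powr \<alpha> * ?w"
  proof (intro add_right_mono mult_right_mono add_mono S0 e_nonneg)
    have "0 \<le> L * B1" using constants_nonneg(1) L_ge_1 by simp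
    then show "2 * L\<^sup>2 + L \<le> c2" "L\<^sup>2 + L * B1 \<le> c2"
      using self_le_power[OF L_ge_1, of 2] by (auto simp: c2_def)
  qed auto
  finally show ?thesis by (simp add: algebra_simps)
qed

lemma powr_small:
  assumes "0 \<le> x" "x \<le> (1::real)"
  shows "x powr \<beta> \<le> x powr \<alpha>" "x powr \<alpha> \<le> 1" "x powr \<beta> \<le> 1"
  using assms exponents by (auto intro: powr_mono' powr_le1)

lemma grid_\<omega>:
  assumes "k \<le> l" "l \<le> N"
  shows "0 \<le> \<Omega> k l" "\<Omega> k l \<le> W"
  using \<omega>_range[of "\<tau> k" "\<tau> l"] \<tau>_range[of k] \<tau>_range[of l] \<tau>_mono[OF assms] assms by auto

lemma err_increment:
  assumes kl: "k < l" "l \<le> N" and small: "\<Omega> k l \<le> 1" and S: "norm (err k) \<le> S"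
    and R: "norm (remainder_err k l) \<le> q * \<Omega> k l powr \<beta>" and q: "0 \<le> q"
  shows "norm (err l - err k) \<le> (L * S + q) * \<Omega> k l powr \<alpha>"
proof -
  let ?x = "X (\<tau> l) - X (\<tau> k)"
  have "err l - err k = (\<sigma> (state (\<tau> k)) ?x - \<sigma> (stateN k) ?x) + remainder_err k l"
    by (simp add: err_def remainder_err_def controlled_remainder_def)
  from norm_add_le2[OF this]
  have "norm (err l - err k) \<le> L * norm (err k) * norm ?x + norm (remainder_err k l)"
    using first_order_bounds(2)[of "state (\<tau> k)" ?x "stateN k"] by (simp add: state_diff)
  also have "\<dots> \<le> L * S * \<Omega> k l powr \<alpha> + q * \<Omega> k l powr \<alpha>"
  proof (intro add_mono mult_mono mult_left_mono)
    have "q * \<Omega> k l powr \<beta> \<le> q * \<Omega> k l powr \<alpha>"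
      using powr_small[OF _ small] grid_\<omega>(1)[of k l] kl q by (intro mult_left_mono) auto
    with R show "norm (remainder_err k l) \<le> q * \<Omega> k l powr \<alpha>" by linarith
  qed (use S L_ge_1 grid_driver(1)[OF kl] order.trans[OF norm_ge_zero S] in auto)
  finally show ?thesis by (simp add: algebra_simps)
qed

text \<open>Difference of two germ coboundaries.  Each product is split such that differences between solution and
  scheme always meet a bounded factor: \<open>F - FN\<close> and \<open>G - GN\<close> come with levels of the driver, and the
  difference of the second levels comes with the increment G of the solution.\<close>

lemma defect_err_coboundary:
  assumes klm: "k < l" "l < m" "m \<le> N" and small: "\<Omega> k m \<le> 1" and S: "norm (err k) \<le> S"
    and R: "norm (remainder_err k l) \<le> q * \<Omega> k l powr \<beta>" and q: "0 \<le> q"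
  shows "norm (defect_err k m - defect_err k l - defect_err l m)
    \<le> (c3 * (S + e) + 3 * L\<^sup>2 * q) * \<Omega> k m powr (\<alpha> + \<beta>)"
proof -
  define o1 o2 o3 where "o1 = \<Omega> k l" and "o2 = \<Omega> l m" and "o3 = \<Omega> k m"
  have kl: "k < l" "l \<le> N" and lm: "l < m" "m \<le> N" using klm by auto
  have tl: "0 \<le> \<tau> k" "\<tau> k < \<tau> l" "\<tau> l < \<tau> m" "\<tau> m \<le> T"
    using \<tau>_range[of k] \<tau>_range[of m] \<tau>_strict_mono[of k l] \<tau>_strict_mono[of l m] klm by auto
  have o: "0 \<le> o1" "0 \<le> o2" "o1 \<le> o3" "o2 \<le> o3" "o3 \<le> 1"
    using grid_\<omega>(1)[of k l] grid_\<omega>(1)[of l m] klm small tl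
      control_mono[OF control_\<omega>, of "\<tau> k" "\<tau> k" "\<tau> l" "\<tau> m"] control_mono[OF control_\<omega>, of "\<tau> k" "\<tau> l" "\<tau> m" "\<tau> m"]
    by (auto simp: o1_def o2_def o3_def)
  have pw: "o1 powr \<alpha> \<le> o3 powr \<alpha>" "o1 powr \<beta> \<le> o3 powr \<beta>" "o2 powr \<alpha> \<le> o3 powr \<alpha>" "o2 powr \<beta> \<le> o3 powr \<beta>"
    using o exponents by (auto intro!: powr_mono2)
  have sm: "o1 powr \<beta> \<le> o1 powr \<alpha>" "o1 powr \<alpha> \<le> 1" "o1 powr \<beta> \<le> 1" using powr_small[of o1] o by auto
  have S0: "0 \<le> S" using S norm_ge_zero order_trans by blast
  have L0: "0 \<le> L" "L \<le> L\<^sup>2" "1 \<le> L\<^sup>2" "0 \<le> L\<^sup>2" "0 \<le> L ^ 3"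
    using L_ge_1 self_le_power[OF L_ge_1, of 2] by auto
  let ?x = "X (\<tau> l) - X (\<tau> k)" and ?y = "X (\<tau> m) - X (\<tau> l)"
  have x: "norm ?x \<le> o1 powr \<alpha>" "(norm ?x)\<^sup>2 \<le> o1 powr \<beta>" "\<bar>\<tau> l - \<tau> k\<bar> \<le> o1 powr \<beta>"
    using grid_driver[OF kl] tl by (auto simp: o1_def)
  have y: "norm ?y \<le> o2 powr \<alpha>" using grid_driver(1)[OF lm] by (simp add: o2_def)
  have Rl: "norm (controlled_remainder (\<tau> k) (\<tau> l)) \<le> M0 * o1 powr \<beta>"
    using remainder_bound[of "\<tau> k" "\<tau> l"] tl by (simp add: o1_def)
  let ?F = "\<sigma> (state (\<tau> l)) - \<sigma> (state (\<tau> k)) - \<Gamma> (state (\<tau> k)) ?x"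
    and ?FN = "\<sigma> (stateN l) - \<sigma> (stateN k) - \<Gamma> (stateN k) ?x"
    and ?G = "\<Gamma> (state (\<tau> l)) - \<Gamma> (state (\<tau> k))" and ?GN = "\<Gamma> (stateN l) - \<Gamma> (stateN k)"
  have F: "norm (?F - ?FN) \<le> ((2 * L\<^sup>2 * (1 + M0) + 3 * L ^ 3) * S + L * q) * o3 powr \<beta>"
  proof -
    let ?h = "state (\<tau> l) - state (\<tau> k) - first_order (state (\<tau> k)) ?x"
      and ?k = "stateN l - stateN k - first_order (stateN k) ?x"
    have "?h - ?k = (0, remainder_err k l)"
      by (simp add: state_def stateN_def remainder_err_def controlled_remainder_def)
    then have hk: "norm (?h - ?k) \<le> q * o1 powr \<beta>" using R by (simp add: o1_def)
    have h: "norm ?h \<le> (1 + M0) * o1 powr \<beta>"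
      using norm_state_increment(2)[of "\<tau> l" "\<tau> k"] x Rl by (simp add: algebra_simps)
    have "norm (?F - ?FN) \<le> L * ((1 + L * norm ?x) * norm (err k) * norm ?h + norm (?h - ?k))
        + 3 * L ^ 3 * norm (err k) * (norm ?x)\<^sup>2"
      using field_remainder_diff[of "state (\<tau> l)" "state (\<tau> k)" ?x "stateN l" "stateN k"] by (simp only: state_diff)
    also have "\<dots> \<le> L * ((1 + L * 1) * S * ((1 + M0) * o1 powr \<beta>) + q * o1 powr \<beta>) + 3 * L ^ 3 * S * o1 powr \<beta>"
      using L0 S S0 x sm h hk M0_nonneg q by (intro add_mono mult_left_mono mult_mono) auto
    also have "\<dots> = ((L * (1 + L) * (1 + M0) + 3 * L ^ 3) * S + L * q) * o1 powr \<beta>"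
      by (simp add: algebra_simps)
    also have "\<dots> \<le> ((2 * L\<^sup>2 * (1 + M0) + 3 * L ^ 3) * S + L * q) * o3 powr \<beta>"
    proof (rule mult_mono)
      have "L * (1 + L) \<le> 2 * L\<^sup>2" using L0 by (simp add: power2_eq_square algebra_simps)
      then have "L * (1 + L) * (1 + M0) \<le> 2 * L\<^sup>2 * (1 + M0)" using M0_nonneg by (intro mult_right_mono) auto
      then show "(L * (1 + L) * (1 + M0) + 3 * L ^ 3) * S + L * q \<le> (2 * L\<^sup>2 * (1 + M0) + 3 * L ^ 3) * S + L * q"
        by (intro add_right_mono mult_right_mono[OF _ S0])
      have "0 \<le> (2 * L\<^sup>2 * (1 + M0) + 3 * L ^ 3) * S" using L0 M0_nonneg S0 by (intro mult_nonneg_nonneg add_nonneg_nonneg) auto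
      then show "0 \<le> (2 * L\<^sup>2 * (1 + M0) + 3 * L ^ 3) * S + L * q" using L0 q by simp
    qed (use pw M0_nonneg S0 in auto)
    finally show ?thesis .
  qed
  have si: "norm (state (\<tau> l) - state (\<tau> k)) \<le> (1 + L + M0) * o1 powr \<alpha>"
  proof -
    have "norm (state (\<tau> l) - state (\<tau> k)) \<le> \<bar>\<tau> l - \<tau> k\<bar> + (L * norm ?x + norm (controlled_remainder (\<tau> k) (\<tau> l)))"
      using norm_state_increment(1)[of "\<tau> l" "\<tau> k"] increment_bound[of "\<tau> l" "\<tau> k"] by linarith
    also have "\<dots> \<le> o1 powr \<beta> + (L * o1 powr \<alpha> + M0 * o1 powr \<beta>)"
      using x Rl L0 by (intro add_mono mult_left_mono) auto
    also have "\<dots> \<le> o1 powr \<alpha> + (L * o1 powr \<alpha> + M0 * o1 powr \<alpha>)"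
      using sm L0 M0_nonneg by (intro add_mono mult_left_mono) auto
    finally show ?thesis by (simp add: algebra_simps)
  qed
  have GD: "norm (?G - ?GN) \<le> (4 * L\<^sup>2 * (1 + L + M0) * S + 2 * L\<^sup>2 * (L * S + q)) * o3 powr \<alpha>"
  proof -
    let ?h = "state (\<tau> l) - state (\<tau> k)" and ?k = "stateN l - stateN k"
    have "?h - ?k = (0, err l - err k)" by (simp add: state_def stateN_def err_def)
    then have hk: "norm (?h - ?k) \<le> (L * S + q) * o1 powr \<alpha>"
      using err_increment[OF kl _ S R q] o by (simp add: o1_def)
    have "norm (?G - ?GN) \<le> 4 * L\<^sup>2 * norm (err k) * norm ?h + 2 * L\<^sup>2 * norm (?h - ?k)"
      using \<Gamma>_increment_diff[of "state (\<tau> k)" ?h "stateN k" ?k] by (simp add: state_diff)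
    also have "\<dots> \<le> 4 * L\<^sup>2 * S * ((1 + L + M0) * o1 powr \<alpha>) + 2 * L\<^sup>2 * ((L * S + q) * o1 powr \<alpha>)"
      using L0 S S0 si hk by (intro add_mono mult_left_mono mult_mono) auto
    also have "\<dots> = (4 * L\<^sup>2 * (1 + L + M0) * S + 2 * L\<^sup>2 * (L * S + q)) * o1 powr \<alpha>"
      by (simp add: algebra_simps)
    also have "\<dots> \<le> (4 * L\<^sup>2 * (1 + L + M0) * S + 2 * L\<^sup>2 * (L * S + q)) * o3 powr \<alpha>"
      using pw L0 M0_nonneg S0 q by (intro mult_left_mono add_nonneg_nonneg mult_nonneg_nonneg) auto
    finally show ?thesis .
  qed
  have GL: "norm ?G \<le> 2 * L\<^sup>2 * (1 + L + M0) * o3 powr \<alpha>"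
  proof -
    have "norm ?G \<le> 2 * L\<^sup>2 * ((1 + L + M0) * o1 powr \<alpha>)"
      using \<Gamma>_lipschitz[of "state (\<tau> l)" "state (\<tau> k)"] mult_left_mono[OF si, of "2 * L\<^sup>2"] by simp
    also have "\<dots> \<le> 2 * L\<^sup>2 * ((1 + L + M0) * o3 powr \<alpha>)"
      using pw L0 M0_nonneg by (intro mult_left_mono) auto
    finally show ?thesis by simp
  qed
  let ?XX = "XX (\<tau> l) (\<tau> m)" and ?XN = "XN (\<tau> l) (\<tau> m)"
  have g: "germ (\<tau> k) (\<tau> m) - germ (\<tau> k) (\<tau> l) - germ (\<tau> l) (\<tau> m) = - (?F ?y) - apply_matrix ?G ?XX"
    using germ_coboundary[of "\<sigma> (state (\<tau> k))" ?x ?y "\<Gamma> (state (\<tau> k))" "XX (\<tau> k) (\<tau> l)" ?XX "\<sigma> (state (\<tau> l))" "\<Gamma> (state (\<tau> l))"]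
    by (simp add: germ_def chen[of "\<tau> k" "\<tau> m" "\<tau> l"])
  have gN: "germN k m - germN k l - germN l m = - (?FN ?y) - apply_matrix ?GN ?XN"
    using germ_coboundary[of "\<sigma> (stateN k)" ?x ?y "\<Gamma> (stateN k)" "XN (\<tau> k) (\<tau> l)" ?XN "\<sigma> (stateN l)" "\<Gamma> (stateN l)"]
    by (simp add: germN_def chen_N[of "\<tau> k" "\<tau> m" "\<tau> l"])
  have "drift_err k m = drift_err k l + drift_err l m" using klm by (intro drift_err_add) auto
  then have "defect_err k m - defect_err k l - defect_err l m
      = (germN k m - germN k l - germN l m) - (germ (\<tau> k) (\<tau> m) - germ (\<tau> k) (\<tau> l) - germ (\<tau> l) (\<tau> m))"
    by (simp add: defect_err_def)
  also have "\<dots> = (?F - ?FN) ?y + (apply_matrix (?G - ?GN) ?XN + apply_matrix ?G (?XX - ?XN))"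
    unfolding g gN by (simp add: blinfun.diff_left apply_matrix_linear)
  finally have eq: "defect_err k m - defect_err k l - defect_err l m
      = (?F - ?FN) ?y + (apply_matrix (?G - ?GN) ?XN + apply_matrix ?G (?XX - ?XN))" .
  let ?w = "o3 powr (\<alpha> + \<beta>)"
  have t1: "norm ((?F - ?FN) ?y) \<le> ((2 * L\<^sup>2 * (1 + M0) + 3 * L ^ 3) * S + L * q) * ?w"
  proof -
    have "norm ((?F - ?FN) ?y) \<le> norm (?F - ?FN) * norm ?y" by (rule norm_blinfun)
    also have "\<dots> \<le> (((2 * L\<^sup>2 * (1 + M0) + 3 * L ^ 3) * S + L * q) * o3 powr \<beta>) * o3 powr \<alpha>"
      using F y pw order.trans[OF norm_ge_zero F] by (intro mult_mono) auto
    finally show ?thesis by (simp add: powr_add algebra_simps)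
  qed
  have t2: "norm (apply_matrix (?G - ?GN) ?XN) \<le> (4 * L\<^sup>2 * (1 + L + M0) * S + 2 * L\<^sup>2 * (L * S + q)) * ?w"
  proof -
    have "contraction_const TYPE('d) * norm ?XN \<le> o3 powr \<beta>" using XN_bound[OF lm] pw by (simp add: o2_def)
    from second_level_bound[OF this GD] show ?thesis by (simp add: powr_add algebra_simps)
  qed
  have t3: "norm (apply_matrix ?G (?XX - ?XN)) \<le> 2 * L\<^sup>2 * (1 + L + M0) * e * ?w"
  proof -
    have "contraction_const TYPE('d) * norm (?XX - ?XN) \<le> e * o3 powr \<beta>"
      using XN_close[OF lm] mult_left_mono[OF pw(4) e_nonneg] by (simp add: o2_def)
    from second_level_bound[OF this GL] show ?thesis by (simp add: powr_add algebra_simps)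
  qed
  have "norm (defect_err k m - defect_err k l - defect_err l m)
      \<le> ((2 * L\<^sup>2 * (1 + M0) + 3 * L ^ 3) * S + L * q) * ?w
        + ((4 * L\<^sup>2 * (1 + L + M0) * S + 2 * L\<^sup>2 * (L * S + q)) * ?w + 2 * L\<^sup>2 * (1 + L + M0) * e * ?w)"
    using norm_add_le2[OF eq] norm_triangle_ineq[of "apply_matrix (?G - ?GN) ?XN" "apply_matrix ?G (?XX - ?XN)"]
      t1 t2 t3 by linarith
  also have "\<dots> = (c3 * S + 2 * L\<^sup>2 * (1 + L + M0) * e + (L + 2 * L\<^sup>2) * q) * ?w"
    by (simp add: c3_def algebra_simps power2_eq_square power3_eq_cube)
  also have "\<dots> \<le> (c3 * S + c3 * e + (3 * L\<^sup>2) * q) * ?w"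
  proof (intro mult_right_mono add_mono)
    have "0 \<le> 2 * L\<^sup>2 * (1 + M0) + 3 * L ^ 3 + 2 * L\<^sup>2 * (1 + L + M0) + 2 * L ^ 3"
      using L0 M0_nonneg by (intro add_nonneg_nonneg mult_nonneg_nonneg) auto
    then show "2 * L\<^sup>2 * (1 + L + M0) \<le> c3" by (simp add: c3_def)
  qed (use L0 S0 e_nonneg q in auto)
  finally show ?thesis by (simp add: o3_def algebra_simps)
qed

text \<open>Over a single cell the scheme has no defect, because its second level vanishes there.\<close>

lemma defect_err_step:
  assumes "k < N"
  shows "defect_err k (Suc k) = defect (\<tau> k) (\<tau> (Suc k))"
  using Z_Suc[OF assms] XN_step[OF assms] apply_matrix_linear(4)[of "\<Gamma> (stateN k)" 0 0]
  by (simp add: defect_err_def defect_def err_def drift_err_def germN_def stateN_def)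

lemma defect_err_step_bound:
  assumes "k < N"
  shows "norm (defect_err k (Suc k)) \<le> e * (c0 * (1 + M1)) * \<Omega> k (Suc k) powr (\<alpha> + \<beta>)"
  unfolding defect_err_step[OF assms]
  using assms \<tau>_range[of k] \<tau>_range[of "Suc k"] \<tau>_strict_mono[of k "Suc k"] e_nonneg cell[OF assms]
  by (intro defect_of_cell) auto

lemma grid_\<omega>_pos: "k < l \<Longrightarrow> l \<le> N \<Longrightarrow> 0 < \<Omega> k l"
  using grid_driver(4)[of k l] \<tau>_strict_mono[of k l] grid_\<omega>(1)[of k l] exponents
  by (cases "\<Omega> k l = 0") auto

lemma grid_\<omega>_mono:
  assumes "a \<le> k" "k \<le> l" "l \<le> c" "c \<le> N"
  shows "\<Omega> k l \<le> \<Omega> a c"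
  using assms by (intro control_mono[OF control_\<omega>] \<tau>_range \<tau>_mono) auto

text \<open>On a block of small control both unknowns, the size of the error and the size of its
  defect, reappear on the right-hand side with a factor one half.  They are maxima over finite sets,
  so they are finite and can be absorbed.\<close>

lemma block_estimate:
  assumes ac: "a \<le> c" "c \<le> N" and small: "\<Omega> a c \<le> \<delta>1"
  shows "\<And>l. a \<le> l \<Longrightarrow> l \<le> c \<Longrightarrow> norm (err l) \<le> 2 * norm (err a) + e"
    "\<And>k l. a \<le> k \<Longrightarrow> k < l \<Longrightarrow> l \<le> c \<Longrightarrow>
      norm (err l - err k) \<le> 2 * c5 * (norm (err a) + e) * \<Omega> k l powr \<alpha>"
proof -
  define S where "S = Max ((\<lambda>i. norm (err i)) ` {a..c})"
  have S: "norm (err i) \<le> S" if "a \<le> i" "i \<le> c" for i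
    unfolding S_def using that by (intro Max_ge) auto
  have "S \<in> (\<lambda>i. norm (err i)) ` {a..c}" unfolding S_def using ac by (intro Max_in) auto
  then obtain i\<^sub>0 where i0: "a \<le> i\<^sub>0" "i\<^sub>0 \<le> c" "S = norm (err i\<^sub>0)" by auto
  have S0: "0 \<le> S" using i0 by simp
  define P where "P = {(k, l). a \<le> k \<and> k < l \<and> l \<le> c}"
  define f where "f = (\<lambda>(k, l). norm (defect_err k l) / \<Omega> k l powr (\<alpha> + \<beta>))"
  define M where "M = Max (insert 0 (f ` P))"
  have finP: "finite P" by (rule finite_subset[of _ "{a..c} \<times> {a..c}"]) (auto simp: P_def)
  have M0: "0 \<le> M" unfolding M_def using finP by (intro Max_ge) auto
  have D: "norm (defect_err k l) \<le> M * \<Omega> k l powr (\<alpha> + \<beta>)" if "a \<le> k" "k < l" "l \<le> c" for k l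
  proof -
    have "f (k, l) \<le> M" unfolding M_def using finP that by (intro Max_ge) (auto simp: P_def)
    then show ?thesis using grid_\<omega>_pos[of k l] that ac by (simp add: f_def field_simps)
  qed
  define d where "d = \<delta>1 powr \<alpha>"
  have d: "0 \<le> d" by (simp add: d_def)
  have \<omega>d: "\<Omega> k l powr \<alpha> \<le> d" "\<Omega> k l \<le> 1" if "a \<le> k" "k \<le> l" "l \<le> c" for k l
    using grid_\<omega>_mono[OF that ac(2)] grid_\<omega>(1)[of k l] that ac small \<delta>1(2) exponents
    by (auto simp: d_def intro!: powr_mono2)
  define q where "q = c2 * (S + e) + M * d"
  have q: "0 \<le> q" using constants_nonneg(2) S0 e_nonneg M0 d by (simp add: q_def)
  have R: "norm (remainder_err k l) \<le> q * \<Omega> k l powr \<beta>" if "a \<le> k" "k < l" "l \<le> c" for k l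
  proof -
    have "norm (remainder_err k l) \<le> (c2 * (S + e) + M * \<Omega> k l powr \<alpha>) * \<Omega> k l powr \<beta>"
      using that ac S D by (intro remainder_err_bound) auto
    also have "\<dots> \<le> q * \<Omega> k l powr \<beta>"
      unfolding q_def using M0 \<omega>d(1)[of k l] that by (intro mult_right_mono add_left_mono mult_left_mono) auto
    finally show ?thesis .
  qed
  define K where "K = c3 * (S + e) + 3 * L\<^sup>2 * q + e * (c0 * (1 + M1))"
  have nn: "0 \<le> c3 * (S + e)" "0 \<le> 3 * L\<^sup>2 * q" "0 \<le> e * (c0 * (1 + M1))"
    using constants_nonneg(3) S0 e_nonneg q c0_ge_1 M1_nonneg by auto
  then have K0: "0 \<le> K" by (simp add: K_def)
  have sew: "norm (defect_err k l) \<le> sewing_const (\<alpha> + \<beta>) * K * \<Omega> k l powr (\<alpha> + \<beta>)"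
    if kl: "a \<le> k" "k < l" "l \<le> c" for k l
  proof (rule discrete_sewing[where a = a and c = c and W = "\<lambda>i j. \<Omega> i j", OF exponents(4) K0])
    show "0 \<le> \<Omega> i j" if "i \<le> j" "j \<le> c" for i j
      using that ac by (intro grid_\<omega>) auto
    show "\<Omega> i j + \<Omega> j k \<le> \<Omega> i k" if "i \<le> j" "j \<le> k" "k \<le> c" for i j k
      using that ac by (intro control_add[OF control_\<omega>] \<tau>_range \<tau>_mono) auto
    show "norm (defect_err i (Suc i)) \<le> K * \<Omega> i (Suc i) powr (\<alpha> + \<beta>)" if "i < c" for i
    proof -
      have "e * (c0 * (1 + M1)) * \<Omega> i (Suc i) powr (\<alpha> + \<beta>) \<le> K * \<Omega> i (Suc i) powr (\<alpha> + \<beta>)"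
        using nn by (intro mult_right_mono) (auto simp: K_def)
      then show ?thesis using defect_err_step_bound[of i] that ac by linarith
    qed
    show "norm (defect_err i k - defect_err i j - defect_err j k) \<le> K * \<Omega> i k powr (\<alpha> + \<beta>)"
      if ijk: "a \<le> i" "i < j" "j < k" "k \<le> c" for i j k
    proof -
      have "norm (defect_err i k - defect_err i j - defect_err j k)
          \<le> (c3 * (S + e) + 3 * L\<^sup>2 * q) * \<Omega> i k powr (\<alpha> + \<beta>)"
        using ijk ac S R q \<omega>d(2)[of i k] by (intro defect_err_coboundary) auto
      also have "\<dots> \<le> K * \<Omega> i k powr (\<alpha> + \<beta>)"
        using nn by (intro mult_right_mono) (auto simp: K_def)
      finally show ?thesis .
    qed
  qed (use kl in auto)
  let ?C = "sewing_const (\<alpha> + \<beta>)"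
  have C: "3 \<le> ?C" by (rule constants_nonneg(9))
  have CK: "0 \<le> ?C * K" using C K0 by simp
  have "M \<le> ?C * K"
    unfolding M_def
  proof (intro Max.boundedI)
    fix x assume "x \<in> insert 0 (f ` P)"
    then consider "x = 0" | k l where "a \<le> k" "k < l" "l \<le> c" "x = f (k, l)" by (auto simp: P_def)
    then show "x \<le> ?C * K"
    proof cases
      case 2
      then show ?thesis using sew[of k l] grid_\<omega>_pos[of k l] ac by (simp add: f_def pos_divide_le_eq)
    qed (use CK in simp)
  qed (use finP in auto)
  also have "?C * K = ?C * ((c3 + 3 * L\<^sup>2 * c2) * (S + e) + e * (c0 * (1 + M1))) + (?C * (3 * L\<^sup>2) * d) * M"
    by (simp add: K_def q_def algebra_simps)
  also have "\<dots> \<le> ?C * ((c3 + 3 * L\<^sup>2 * c2) * (S + e) + (S + e) * (c0 * (1 + M1))) + 1/2 * M"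
    using \<delta>1(3) M0 C S0 c0_ge_1 M1_nonneg
    by (intro add_mono mult_left_mono mult_right_mono add_left_mono) (auto simp: d_def)
  also have "\<dots> = 1/2 * (c4 * (S + e)) + 1/2 * M" by (simp add: c4_def algebra_simps)
  finally have M: "M \<le> c4 * (S + e)" by simp
  have d1: "d \<le> 1" using \<delta>1 exponents by (auto simp: d_def intro: powr_le1)
  have "M * d \<le> c4 * (S + e) * 1"
    using M d1 d M0 order.trans[OF M0 M] by (intro mult_mono) auto
  then have "L * S + q \<le> L * S + L * e + c2 * (S + e) + c4 * (S + e)"
    using mult_nonneg_nonneg[OF _ e_nonneg, of L] L_ge_1 by (simp add: q_def)
  then have Lq: "L * S + q \<le> c5 * (S + e)" by (simp add: c5_def algebra_simps)
  have inc: "norm (err l - err k) \<le> c5 * (S + e) * \<Omega> k l powr \<alpha>" if "a \<le> k" "k < l" "l \<le> c" for k l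
  proof -
    have "norm (err l - err k) \<le> (L * S + q) * \<Omega> k l powr \<alpha>"
      using that ac S R q \<omega>d(2)[of k l] by (intro err_increment) auto
    also have "\<dots> \<le> c5 * (S + e) * \<Omega> k l powr \<alpha>" using Lq by (intro mult_right_mono) auto
    finally show ?thesis .
  qed
  have "S \<le> norm (err a) + 1/2 * (S + e)"
  proof (cases "i\<^sub>0 = a")
    case True
    then show ?thesis using i0 S0 e_nonneg by simp
  next
    case False
    have "norm (err i\<^sub>0 - err a) \<le> c5 * (S + e) * \<omega> (\<tau> a) (\<tau> i\<^sub>0) powr \<alpha>" using i0 False by (intro inc) auto
    also have "\<dots> \<le> c5 * (S + e) * d"
      using \<omega>d(1)[of a i\<^sub>0] i0 constants_nonneg(5) S0 e_nonneg by (intro mult_left_mono) auto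
    also have "\<dots> = c5 * d * (S + e)" by simp
    also have "\<dots> \<le> 1/2 * (S + e)" using \<delta>1(4) S0 e_nonneg by (intro mult_right_mono) (auto simp: d_def)
    finally have "norm (err i\<^sub>0 - err a) \<le> 1/2 * (S + e)" .
    moreover have "norm (err i\<^sub>0) \<le> norm (err i\<^sub>0 - err a) + norm (err a)" by (rule norm_add_le2) simp
    ultimately show ?thesis using i0 by linarith
  qed
  then have Sb: "S \<le> 2 * norm (err a) + e" unfolding distrib_left by linarith
  show "norm (err l) \<le> 2 * norm (err a) + e" if "a \<le> l" "l \<le> c" for l
    using S[OF that] Sb by linarith
  show "norm (err l - err k) \<le> 2 * c5 * (norm (err a) + e) * \<Omega> k l powr \<alpha>"
    if "a \<le> k" "k < l" "l \<le> c" for k l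
  proof -
    have "c5 * (S + e) \<le> c5 * (2 * (norm (err a) + e))"
      using Sb constants_nonneg(5) by (intro mult_left_mono) auto
    then have "c5 * (S + e) \<le> 2 * c5 * (norm (err a) + e)" by (simp only: mult.assoc mult.left_commute)
    then have "c5 * (S + e) * \<Omega> k l powr \<alpha> \<le> 2 * c5 * (norm (err a) + e) * \<Omega> k l powr \<alpha>"
      by (intro mult_right_mono) auto
    then show ?thesis using inc[OF that] by linarith
  qed
qed

text \<open>A cell may carry a large control, for instance if X jumps at its right end.  It costs a fixed factor,
  for its second level coincides with that of the scheme, which is zero, up to the factor e.\<close>

lemma err_step:
  assumes k: "k < N"
  shows "norm (err (Suc k)) \<le> c7 * (norm (err k) + e)"
proof -
  let ?a = "\<tau> k" and ?c = "\<tau> (Suc k)" and ?E = "norm (err k)"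
  let ?x = "X ?c - X ?a"
  have ks: "k < Suc k" "Suc k \<le> N" using k by auto
  have ac: "0 \<le> ?a" "?a < ?c" "?c \<le> T"
    using \<tau>_range[of k] \<tau>_range[of "Suc k"] \<tau>_strict_mono[of k "Suc k"] k by auto
  have L0: "0 \<le> L" using L_ge_1 by simp
  have o: "\<omega> ?a ?c powr \<alpha> \<le> W" "\<omega> ?a ?c powr \<beta> \<le> W" "\<omega> ?a ?c powr (\<alpha> + \<beta>) \<le> W * W"
  proof -
    show "\<omega> ?a ?c powr \<alpha> \<le> W" and w: "\<omega> ?a ?c powr \<beta> \<le> W" using powr_\<omega>_le(1,2)[of ?a ?c] ac by auto
    have "W * \<omega> ?a ?c powr \<beta> \<le> W * W" using w W_ge_1 by (intro mult_left_mono) auto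
    then show "\<omega> ?a ?c powr (\<alpha> + \<beta>) \<le> W * W" using powr_\<omega>_le(4)[of ?a ?c] ac by linarith
  qed
  let ?A = "\<sigma> (state ?a) ?x - \<sigma> (stateN k) ?x" and ?B = "apply_matrix (\<Gamma> (state ?a)) (XX ?a ?c)"
  have eq: "err (Suc k) = (err k + drift_err k (Suc k)) + ((?A + ?B) + defect ?a ?c)"
    using Z_Suc[OF k] by (simp add: err_def drift_err_def defect_def germ_def stateN_def)
  have n: "norm (err (Suc k)) \<le> ?E + norm (drift_err k (Suc k)) + norm ?A + norm ?B + norm (defect ?a ?c)"
    using norm_add_le2[OF eq] norm_triangle_ineq[of "err k" "drift_err k (Suc k)"]
      norm_triangle_ineq[of "?A + ?B" "defect ?a ?c"] norm_triangle_ineq[of ?A ?B] by linarith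
  have "norm (drift_err k (Suc k)) \<le> L * (e * B1 + ?E) * \<omega> ?a ?c powr \<beta>"
    using drift_err_bound[OF ks, of ?E] by (simp add: less_Suc_eq_le)
  also have "\<dots> \<le> L * (e * B1 + ?E) * W"
    using o L0 e_nonneg constants_nonneg(1) by (intro mult_left_mono) auto
  finally have d: "norm (drift_err k (Suc k)) \<le> L * (e * B1 + ?E) * W" .
  have "norm ?A \<le> L * ?E * norm ?x"
    using first_order_bounds(2)[of "state ?a" ?x "stateN k"] by (simp add: state_diff)
  also have "\<dots> \<le> L * ?E * W"
    using grid_driver(1)[OF ks] o L0 by (intro mult_left_mono) auto
  finally have A: "norm ?A \<le> L * ?E * W" .
  have "contraction_const TYPE('d) * norm (XX ?a ?c) \<le> e * W"
    using XN_close[OF ks] XN_step[OF k] mult_left_mono[OF o(2) e_nonneg] by simp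
  from second_level_bound[OF this \<Gamma>_bound] have B: "norm ?B \<le> L\<^sup>2 * (e * W)" .
  have "norm (defect ?a ?c) \<le> e * (c0 * (1 + M1)) * \<omega> ?a ?c powr (\<alpha> + \<beta>)"
    using defect_err_step_bound[OF k] defect_err_step[OF k] by simp
  also have "\<dots> \<le> e * (c0 * (1 + M1)) * (W * W)"
    using o e_nonneg c0_ge_1 M1_nonneg by (intro mult_left_mono) auto
  finally have D: "norm (defect ?a ?c) \<le> e * (c0 * (1 + M1)) * (W * W)" .
  have "norm (err (Suc k)) \<le> (1 + 2 * L * W) * ?E + (L * B1 * W + L\<^sup>2 * W + c0 * (1 + M1) * W\<^sup>2) * e"
    using n d A B D by (simp add: algebra_simps power2_eq_square)
  also have "\<dots> \<le> c7 * ?E + c7 * e"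
  proof (intro add_mono mult_right_mono)
    have "0 \<le> L * B1 * W" "0 \<le> L\<^sup>2 * W" "0 \<le> c0 * (1 + M1) * W\<^sup>2" "0 \<le> 2 * L * W"
      using L0 W_ge_1 c0_ge_1 M1_nonneg constants_nonneg(1) by auto
    then show "1 + 2 * L * W \<le> c7" "L * B1 * W + L\<^sup>2 * W + c0 * (1 + M1) * W\<^sup>2 \<le> c7"
      by (auto simp: c7_def)
  qed (use e_nonneg in auto)
  finally show ?thesis by (simp add: algebra_simps)
qed

text \<open>Starting from k, a maximal block of control at most \<open>\<delta>1\<close> is followed by one further cell; together
  they use up more than \<open>\<delta>1\<close> of the control.\<close>

lemma err_growth:
  assumes "k \<le> l" "l \<le> N" "\<Omega> k l \<le> real n * \<delta>1"
  shows "norm (err l) + e \<le> 2 * (2 * (c7 + 1)) ^ n * (norm (err k) + e)"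
  using assms
proof (induction n arbitrary: k)
  case 0
  then show ?case using block_estimate(1)[of k l l] \<delta>1(1) by simp
next
  case (Suc n)
  let ?r = "2 * (c7 + 1)"
  have r: "1 \<le> ?r" using constants_nonneg(7) by simp
  show ?case
  proof (cases "\<Omega> k l \<le> \<delta>1")
    case True
    have "norm (err l) + e \<le> 2 * (norm (err k) + e)"
      using block_estimate(1)[OF Suc.prems(1,2) True, of l] Suc.prems by simp
    also have "\<dots> \<le> (2 * ?r ^ Suc n) * (norm (err k) + e)"
      using one_le_power[OF r, of "Suc n"] e_nonneg by (intro mult_right_mono) auto
    finally show ?thesis .
  next
    case False
    define A where "A = {j. k \<le> j \<and> j \<le> l \<and> \<Omega> k j \<le> \<delta>1}"
    have "\<Omega> k k + \<Omega> k k \<le> \<Omega> k k"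
      using Suc.prems by (intro control_add[OF control_\<omega>] \<tau>_range) auto
    then have kA: "k \<in> A" using Suc.prems \<delta>1(1) by (auto simp: A_def)
    have finA: "finite A" by (rule finite_subset[of _ "{k..l}"]) (auto simp: A_def)
    define j where "j = Max A"
    have "j \<in> A" unfolding j_def using finA kA by (intro Max_in) auto
    then have j: "k \<le> j" "j \<le> l" "\<Omega> k j \<le> \<delta>1" by (auto simp: A_def)
    have jl: "j < l" using j False by (cases "j = l") auto
    have "Suc j \<notin> A" using Max_ge[OF finA, of "Suc j"] unfolding j_def by auto
    then have "\<delta>1 < \<Omega> k (Suc j)" using j jl by (auto simp: A_def)
    moreover have "\<Omega> k (Suc j) + \<Omega> (Suc j) l \<le> \<Omega> k l"
      using j jl Suc.prems by (intro control_add[OF control_\<omega>] \<tau>_range \<tau>_mono) auto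
    ultimately have rest: "\<Omega> (Suc j) l \<le> real n * \<delta>1"
      using Suc.prems(3) by (simp add: algebra_simps)
    have "norm (err l) + e \<le> 2 * ?r ^ n * (norm (err (Suc j)) + e)"
      using rest jl Suc.prems by (intro Suc.IH) auto
    also have "\<dots> \<le> 2 * ?r ^ n * ((c7 + 1) * (norm (err j) + e))"
    proof (intro mult_left_mono)
      show "norm (err (Suc j)) + e \<le> (c7 + 1) * (norm (err j) + e)"
        using err_step[OF order.strict_trans2[OF jl Suc.prems(2)]] norm_ge_zero[of "err j"]
        unfolding distrib_right[of "c7" 1] mult_1 by linarith
    qed (use r in auto)
    also have "\<dots> \<le> 2 * ?r ^ n * ((c7 + 1) * (2 * (norm (err k) + e)))"
    proof (intro mult_left_mono)
      show "norm (err j) + e \<le> 2 * (norm (err k) + e)"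
        using block_estimate(1)[of k j j] j Suc.prems by simp
    qed (use r in auto)
    finally show ?thesis by (simp add: algebra_simps)
  qed
qed

lemma err_bound: "l \<le> N \<Longrightarrow> norm (err l) \<le> c8 * e"
proof -
  assume l: "l \<le> N"
  define n where "n = nat \<lceil>W / \<delta>1\<rceil>"
  have "W / \<delta>1 \<le> real n" unfolding n_def by linarith
  then have "\<Omega> 0 l \<le> real n * \<delta>1"
    using grid_\<omega>(2)[of 0 l] l \<delta>1(1) by (simp add: field_simps)
  from err_growth[OF _ l this] have "norm (err l) + e \<le> c8 * (norm (err 0) + e)"
    by (simp add: c8_def n_def)
  moreover have "\<tau> 0 = 0" using partition by (simp add: interval_partition_def)
  then have "err 0 = 0" using Z_0 by (simp add: err_def)
  ultimately show ?thesis using e_nonneg by simp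
qed

text \<open>On small blocks this is the block estimate started at k; otherwise \<open>\<omega> / \<delta>1\<close> is at least 1.\<close>

lemma err_increment_bound:
  assumes kl: "k < l" "l \<le> N"
  shows "norm (err l - err k) \<le> (2 * c5 * (c8 + 1) + 2 * c8 * (1 / \<delta>1) powr \<alpha>) * e * \<Omega> k l powr \<alpha>"
    (is "_ \<le> (?P + ?Q) * e * ?w")
proof -
  have PQ: "0 \<le> ?P" "0 \<le> ?Q" using constants_nonneg(5,8) by auto
  show ?thesis
  proof (cases "\<Omega> k l \<le> \<delta>1")
    case True
    have "norm (err l - err k) \<le> 2 * c5 * (norm (err k) + e) * ?w"
      using True kl by (intro block_estimate(2)[of k l]) auto
    also have "\<dots> \<le> 2 * c5 * (c8 * e + e) * ?w"
      using err_bound[of k] kl constants_nonneg(5) by (intro mult_left_mono mult_right_mono add_right_mono) auto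
    also have "\<dots> = ?P * e * ?w" by (simp add: algebra_simps)
    also have "\<dots> \<le> (?P + ?Q) * e * ?w" using PQ e_nonneg by (intro mult_right_mono) auto
    finally show ?thesis .
  next
    case False
    have "1 \<le> 1 / \<delta>1 * \<Omega> k l" using False \<delta>1(1) by (simp add: field_simps)
    then have one: "1 \<le> (1 / \<delta>1 * \<Omega> k l) powr \<alpha>" using exponents by (intro ge_one_powr_ge_zero) auto
    have "norm (err l - err k) \<le> norm (err l) + norm (err k)" by (rule norm_diff_le2) simp
    also have "\<dots> \<le> 2 * c8 * e * 1" using err_bound[of k] err_bound[of l] kl by simp
    also have "\<dots> \<le> 2 * c8 * e * (1 / \<delta>1 * \<Omega> k l) powr \<alpha>"
      using one constants_nonneg(8) e_nonneg by (intro mult_left_mono) auto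
    also have "(1 / \<delta>1 * \<Omega> k l) powr \<alpha> = (1 / \<delta>1) powr \<alpha> * ?w" by (rule powr_mult)
    also have "2 * c8 * e * ((1 / \<delta>1) powr \<alpha> * ?w) = ?Q * e * ?w" by simp
    also have "\<dots> \<le> (?P + ?Q) * e * ?w" using PQ e_nonneg by (intro mult_right_mono) auto
    finally show ?thesis .
  qed
qed

section \<open>From grid points to all times\<close>

definition cell_index :: "real \<Rightarrow> nat" where "cell_index t = Max {k. k \<le> N \<and> \<tau> k \<le> t}"

lemma cell_index:
  assumes "0 \<le> t"
  shows "cell_index t \<le> N" "\<tau> (cell_index t) \<le> t"
    "k \<le> N \<Longrightarrow> \<tau> k \<le> t \<Longrightarrow> k \<le> cell_index t"
    "cell_index t < N \<Longrightarrow> t < \<tau> (Suc (cell_index t))"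
proof -
  let ?A = "{k. k \<le> N \<and> \<tau> k \<le> t}"
  have fin: "finite ?A" by (rule finite_subset[of _ "{..N}"]) auto
  have "\<tau> 0 = 0" using partition by (simp add: interval_partition_def)
  then have "0 \<in> ?A" using assms by simp
  then have "cell_index t \<in> ?A" unfolding cell_index_def using fin by (intro Max_in) auto
  then show "cell_index t \<le> N" "\<tau> (cell_index t) \<le> t" by auto
  show ub: "k \<le> cell_index t" if "k \<le> N" "\<tau> k \<le> t" for k
    unfolding cell_index_def using that fin by (intro Max_ge) auto
  show "t < \<tau> (Suc (cell_index t))" if "cell_index t < N"
    using ub[of "Suc (cell_index t)"] that by (cases "t < \<tau> (Suc (cell_index t))") auto
qed

lemma cell_index_mono: "0 \<le> s \<Longrightarrow> s \<le> t \<Longrightarrow> cell_index s \<le> cell_index t"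
  using cell_index(1,2)[of s] by (intro cell_index(3)) auto

lemma cell_increment:
  assumes st: "0 \<le> s" "s \<le> t" "t \<le> T" and cell_eq: "\<tau> k \<le> s" "cell_index t = k"
  shows "norm (Y t - Y s) \<le> e * (L + M1 * W) * \<omega> s t powr \<alpha>"
proof (cases "s = t")
  case True
  then show ?thesis using e_nonneg L_ge_1 M1_nonneg W_ge_1 by simp
next
  case False
  have "k \<le> N" using cell_index(1)[of t] st cell_eq by auto
  moreover have "k \<noteq> N"
  proof
    assume "k = N"
    moreover have "\<tau> N = T" using partition by (simp add: interval_partition_def)
    ultimately show False using cell_eq st False by auto
  qed
  ultimately have kN: "k < N" by simp
  then have "t < \<tau> (Suc k)" using cell_index(4)[of t] st cell_eq by auto
  then show ?thesis
    using cell[OF kN] st cell_eq False e_nonneg by (intro increment_in_cell) auto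
qed

definition euler_path :: "real \<Rightarrow> real^'k" where "euler_path t = Z (cell_index t)"

text \<open>Between grid points the error consists of the increment of the solution inside a cell.  If an
  interval meets two cells, then the part inside the left cell is not controlled by the interval itself,
  but it is controlled by the span of the grid points attached to the interval.\<close>

lemma path_error_increment:
  assumes st: "0 \<le> s" "s \<le> t" "t \<le> T"
  shows "norm ((euler_path t - Y t) - (euler_path s - Y s))
    \<le> c9 * e * (\<omega> s t + \<omega> (\<tau> (cell_index s)) (\<tau> (cell_index t))) powr \<alpha>"
proof -
  define k l where "k = cell_index s" and "l = cell_index t"
  have kl: "k \<le> l" "l \<le> N" "\<tau> k \<le> s" "\<tau> l \<le> t"
    using cell_index_mono[of s t] cell_index(1,2)[of t] cell_index(1,2)[of s] st by (auto simp: k_def l_def)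
  define Bc where "Bc = L + M1 * W"
  define Pc where "Pc = 2 * c5 * (c8 + 1) + 2 * c8 * (1 / \<delta>1) powr \<alpha>"
  have nn: "0 \<le> Bc" "0 \<le> Pc" using L_ge_1 M1_nonneg W_ge_1 constants_nonneg(5,8) by (auto simp: Bc_def Pc_def)
  have c9: "c9 = Pc + 2 * Bc" by (simp add: c9_def Pc_def Bc_def)
  let ?w = "(\<omega> s t + \<Omega> k l) powr \<alpha>"
  have o: "0 \<le> \<omega> s t" "0 \<le> \<Omega> k l" using \<omega>_range(1)[OF st] grid_\<omega>(1)[OF kl(1,2)] by auto
  have up: "x powr \<alpha> \<le> ?w" if "0 \<le> x" "x \<le> \<omega> s t \<or> x \<le> \<Omega> k l" for x
    using that o exponents by (intro powr_mono2) auto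
  have split: "(euler_path t - Y t) - (euler_path s - Y s) = (err k - err l) + ((Y s - Y (\<tau> k)) - (Y t - Y (\<tau> l)))"
    by (simp add: euler_path_def k_def l_def err_def)
  have "norm ((euler_path t - Y t) - (euler_path s - Y s)) \<le> (Pc + 2 * Bc) * e * ?w"
  proof (cases "k = l")
    case True
    have "norm (Y t - Y s) \<le> e * Bc * \<omega> s t powr \<alpha>"
      unfolding Bc_def using st kl True by (intro cell_increment[of s t l]) (auto simp: l_def)
    also have "\<dots> \<le> e * Bc * ?w" using up o nn e_nonneg by (intro mult_left_mono) auto
    also have "\<dots> \<le> (Pc + 2 * Bc) * e * ?w" using nn e_nonneg by (auto simp: algebra_simps)
    finally show ?thesis using True by (simp add: split norm_minus_commute)
  next
    case False
    then have lt: "k < l" using kl by simp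
    have "s < \<tau> (Suc k)" using cell_index(4)[of s] st lt kl by (auto simp: k_def)
    then have sl: "s \<le> \<tau> l" using \<tau>_mono[of "Suc k" l] lt kl by simp
    have tk: "0 \<le> \<tau> k" "\<tau> l \<le> T" "0 \<le> \<tau> l" using \<tau>_range[of k] \<tau>_range[of l] kl by auto
    have "norm (err k - err l) \<le> Pc * e * \<Omega> k l powr \<alpha>"
      using err_increment_bound[OF lt kl(2)] by (simp add: Pc_def norm_minus_commute)
    also have "\<dots> \<le> Pc * e * ?w" using up o nn e_nonneg by (intro mult_left_mono) auto
    finally have a: "norm (err k - err l) \<le> Pc * e * ?w" .
    have "norm (Y s - Y (\<tau> k)) \<le> e * Bc * \<omega> (\<tau> k) s powr \<alpha>"
      unfolding Bc_def using st kl tk by (intro cell_increment[of "\<tau> k" s k]) (auto simp: k_def)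
    also have "\<dots> \<le> e * Bc * ?w"
      using nn e_nonneg control_mono[OF control_\<omega>, of "\<tau> k" "\<tau> k" s "\<tau> l"] \<omega>_range(1)[of "\<tau> k" s] st kl tk sl
      by (intro mult_left_mono up) auto
    finally have c: "norm (Y s - Y (\<tau> k)) \<le> e * Bc * ?w" .
    have "norm (Y t - Y (\<tau> l)) \<le> e * Bc * \<omega> (\<tau> l) t powr \<alpha>"
      unfolding Bc_def using st kl tk by (intro cell_increment[of "\<tau> l" t l]) (auto simp: l_def)
    also have "\<dots> \<le> e * Bc * ?w"
      using nn e_nonneg control_mono[OF control_\<omega>, of s "\<tau> l" t t] \<omega>_range(1)[of "\<tau> l" t] st kl tk sl
      by (intro mult_left_mono up) auto
    finally have d: "norm (Y t - Y (\<tau> l)) \<le> e * Bc * ?w" .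
    show ?thesis
      using norm_add_le2[OF split] norm_triangle_ineq4[of "Y s - Y (\<tau> k)" "Y t - Y (\<tau> l)"] a c d
      by (simp add: algebra_simps)
  qed
  then show ?thesis by (simp add: c9 k_def l_def)
qed

lemma path_error_control: "control T (\<lambda>s t. \<omega> s t + \<omega> (\<tau> (cell_index s)) (\<tau> (cell_index t)))"
  unfolding control_def simplex2_def
proof (intro conjI allI impI; clarify)
  fix s t :: real assume "0 \<le> s" "s \<le> t" "t \<le> T"
  then show "0 \<le> \<omega> s t + \<omega> (\<tau> (cell_index s)) (\<tau> (cell_index t))"
    using \<omega>_range(1)[of s t] grid_\<omega>(1)[of "cell_index s" "cell_index t"] cell_index_mono[of s t] cell_index(1)[of t]
    by auto
next
  fix s u t :: real assume h: "0 \<le> s" "s \<le> u" "u \<le> t" "t \<le> T"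
  have "\<omega> s u + \<omega> u t \<le> \<omega> s t" by (rule control_add[OF control_\<omega> h])
  moreover have "\<omega> (\<tau> (cell_index s)) (\<tau> (cell_index u)) + \<omega> (\<tau> (cell_index u)) (\<tau> (cell_index t))
      \<le> \<omega> (\<tau> (cell_index s)) (\<tau> (cell_index t))"
    using h cell_index_mono[of s u] cell_index_mono[of u t] cell_index(1)
    by (intro control_add[OF control_\<omega>] \<tau>_range \<tau>_mono) auto
  ultimately show "\<omega> s u + \<omega> (\<tau> (cell_index s)) (\<tau> (cell_index u)) + (\<omega> u t + \<omega> (\<tau> (cell_index u)) (\<tau> (cell_index t)))
      \<le> \<omega> s t + \<omega> (\<tau> (cell_index s)) (\<tau> (cell_index t))" by linarith
qed

end

text \<open>Superadditivity of the control bounds every sum over a partition.\<close>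

lemma variation_le_of_control:
  fixes V :: "real \<Rightarrow> 'a::real_normed_vector"
  assumes r: "0 < r" and ctrl: "control T \<Phi>" and T: "0 \<le> T" and K: "0 \<le> K"
    and V: "\<And>s t. 0 \<le> s \<Longrightarrow> s \<le> t \<Longrightarrow> t \<le> T \<Longrightarrow> norm (V t - V s) \<le> K * \<Phi> s t powr (1 / r)"
  shows "variation r T V \<le> ennreal (K * \<Phi> 0 T powr (1 / r))"
proof -
  let ?B = "K powr r * \<Phi> 0 T"
  have P0: "0 \<le> \<Phi> 0 T" using control_nonneg[OF ctrl] T by auto
  have le: "(\<Sum>i<N. norm (V (t (Suc i)) - V (t i)) powr r) \<le> ?B" if "interval_partition 0 T N t" for N t
  proof -
    have "(\<Sum>i<N. norm (V (t (Suc i)) - V (t i)) powr r) \<le> (\<Sum>i<N. K powr r * \<Phi> (t i) (t (Suc i)))"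
    proof (intro sum_mono)
      fix i assume i: "i \<in> {..<N}"
      have b: "0 \<le> t i" "t i \<le> t (Suc i)" "t (Suc i) \<le> T"
        using interval_partition_bounds[OF that, of i] interval_partition_bounds[OF that, of "Suc i"]
          interval_partition_mono[OF that, of i "Suc i"] i by auto
      have p: "0 \<le> \<Phi> (t i) (t (Suc i))" using control_nonneg[OF ctrl b] .
      have "norm (V (t (Suc i)) - V (t i)) powr r \<le> (K * \<Phi> (t i) (t (Suc i)) powr (1 / r)) powr r"
        using V[OF b] r by (intro powr_mono2) auto
      also have "\<dots> = K powr r * \<Phi> (t i) (t (Suc i))" using p r by (simp add: powr_mult powr_powr)
      finally show "norm (V (t (Suc i)) - V (t i)) powr r \<le> K powr r * \<Phi> (t i) (t (Suc i))" .
    qed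
    also have "\<dots> \<le> ?B"
      unfolding sum_distrib_left[symmetric]
      using control_sum_le[OF ctrl _ _ that] by (intro mult_left_mono) auto
    finally show ?thesis .
  qed
  have S: "(SUP (N, t) \<in> {(N, t). interval_partition 0 T N t}.
      ennreal (\<Sum>i<N. norm (V (t (Suc i)) - V (t i)) powr r)) \<le> ennreal ?B" (is "?S \<le> _")
    by (intro SUP_least) (auto intro!: ennreal_leI le)
  then have fin: "?S \<noteq> top" by (rule neq_top_trans[OF ennreal_neq_top])
  have "enn2real ?S \<le> ?B"
    by (rule enn2real_leI[OF _ S]) (simp add: P0)
  then have "enn2real ?S powr (1 / r) \<le> ?B powr (1 / r)" using r by (intro powr_mono2) auto
  also have "\<dots> = K * \<Phi> 0 T powr (1 / r)" using K r by (simp add: powr_mult powr_powr)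
  finally show ?thesis
    unfolding variation_def variation2_def ennreal_powr_def using fin by (auto intro: ennreal_leI)
qed

context euler_comparison begin

lemma variation_path_error:
  "variation (1 / \<alpha>) T (\<lambda>t. euler_path t - Y t) \<le> ennreal (c9 * (2 * W) * e)"
proof -
  have T: "0 \<le> T" "\<tau> 0 = 0" "\<tau> N = T" using \<tau>_range[of 0] partition by (auto simp: interval_partition_def)
  have i: "cell_index 0 = 0" "cell_index T = N"
  proof -
    show "cell_index T = N" using cell_index(1)[of T] cell_index(3)[of T N] T by auto
    show "cell_index 0 = 0"
    proof (rule ccontr)
      assume "cell_index 0 \<noteq> 0"
      then have "\<tau> 0 < \<tau> (cell_index 0)" using cell_index(1)[of 0] by (intro \<tau>_strict_mono) auto
      then show False using cell_index(2)[of 0] T by simp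
    qed
  qed
  have c9: "0 \<le> c9" using constants_nonneg(5,8) L_ge_1 M1_nonneg W_ge_1 by (auto simp: c9_def)
  have W0: "0 \<le> \<omega> 0 T" "\<omega> 0 T \<le> W" using \<omega>_range[of 0 T] T by auto
  have "variation (1 / \<alpha>) T (\<lambda>t. euler_path t - Y t)
      \<le> ennreal (c9 * e * (\<omega> 0 T + \<omega> (\<tau> (cell_index 0)) (\<tau> (cell_index T))) powr (1 / (1 / \<alpha>)))"
    using path_error_increment c9 e_nonneg exponents T
    by (intro variation_le_of_control[OF _ path_error_control]) auto
  also have "\<dots> \<le> ennreal (c9 * (2 * W) * e)"
  proof (intro ennreal_leI)
    have "(\<omega> 0 T + \<omega> 0 T) powr \<alpha> \<le> (2 * W) powr \<alpha>" using W0 exponents by (intro powr_mono2) auto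
    also have "\<dots> \<le> (2 * W) powr 1" using W_ge_1 exponents by (intro powr_mono) auto
    finally have "(\<omega> 0 T + \<omega> 0 T) powr \<alpha> \<le> 2 * W" using W_ge_1 by simp
    then have "c9 * e * (\<omega> 0 T + \<omega> 0 T) powr \<alpha> \<le> c9 * e * (2 * W)"
      using c9 e_nonneg by (intro mult_left_mono) auto
    then show "c9 * e * (\<omega> 0 T + \<omega> (\<tau> (cell_index 0)) (\<tau> (cell_index T))) powr (1 / (1 / \<alpha>)) \<le> c9 * (2 * W) * e"
      by (simp add: i T algebra_simps)
  qed
  finally show ?thesis .
qed

end

section \<open>Solutions and Euler schemes as instances\<close>

text \<open>Measurability of Y comes from step functions that sample Y slightly to the right.\<close>

lemma cadlag_composition_integrable:
  fixes Y :: "real \<Rightarrow> real^'k" and b :: "real \<times> (real^'k) \<Rightarrow> real^'k"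
  assumes cad: "\<And>t. 0 \<le> t \<Longrightarrow> t < T \<Longrightarrow> (Y \<longlongrightarrow> Y t) (at_right t)"
    and b: "continuous_on UNIV b" "\<And>z. norm (b z) \<le> B"
  shows "(\<lambda>r. b (r, Y r)) integrable_on {0..T}"
proof -
  define r where "r n t = (real_of_int \<lfloor>t * real (Suc n)\<rfloor> + 1) / real (Suc n)" for n t
  have r: "t < r n t" "r n t \<le> t + 1 / real (Suc n)" for n t
  proof -
    have "t * real (Suc n) < real_of_int \<lfloor>t * real (Suc n)\<rfloor> + 1" by linarith
    then show "t < r n t" unfolding r_def by (simp add: pos_less_divide_eq del: of_nat_Suc)
    have "real_of_int \<lfloor>t * real (Suc n)\<rfloor> + 1 \<le> (t + 1 / real (Suc n)) * real (Suc n)"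
      by (simp add: distrib_right del: of_nat_Suc)
    then show "r n t \<le> t + 1 / real (Suc n)" unfolding r_def by (simp add: pos_divide_le_eq del: of_nat_Suc)
  qed
  define Yn where "Yn n t = indicat_real {0..T} t *\<^sub>R Y (min T (r n t))" for n t
  define YT where "YT t = indicat_real {0..T} t *\<^sub>R Y t" for t
  have meas: "Yn n \<in> borel_measurable borel" for n
  proof -
    have "(\<lambda>t. Y (min T ((real_of_int \<lfloor>t * real (Suc n)\<rfloor> + 1) / real (Suc n)))) \<in> borel_measurable borel"
      by (rule measurable_compose[of "\<lambda>t. \<lfloor>t * real (Suc n)\<rfloor>" borel "count_space UNIV"]) measurable
    then show ?thesis unfolding Yn_def[abs_def] r_def by measurable
  qed
  have lim: "(\<lambda>n. Yn n t) \<longlonglongrightarrow> YT t" for t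
  proof (cases "0 \<le> t \<and> t < T")
    case True
    have "(\<lambda>n. r n t) \<longlonglongrightarrow> t"
    proof (rule tendsto_sandwich[of "\<lambda>n. t" _ _ "\<lambda>n. t + 1 / real (Suc n)"])
      show "(\<lambda>n. t + 1 / real (Suc n)) \<longlonglongrightarrow> t"
        using tendsto_add[OF tendsto_const LIMSEQ_inverse_real_of_nat, of t] by (simp add: inverse_eq_divide)
    qed (use r in \<open>auto intro!: always_eventually less_imp_le\<close>)
    then have "(\<lambda>n. min T (r n t)) \<longlonglongrightarrow> min T t" by (intro tendsto_min tendsto_const)
    moreover have "t < min T (r n t)" for n using r(1)[of t n] True by simp
    then have "eventually (\<lambda>n. min T (r n t) \<in> {t<..} \<and> min T (r n t) \<noteq> t) sequentially"
      by (intro always_eventually) (auto simp: less_imp_neq[symmetric] less_le)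
    ultimately have "filterlim (\<lambda>n. min T (r n t)) (at_right t) sequentially"
      unfolding filterlim_at using True by (auto simp: min_absorb2)
    then have "(\<lambda>n. Y (min T (r n t))) \<longlonglongrightarrow> Y t"
      by (rule filterlim_compose[rotated]) (use cad True in auto)
    then show ?thesis using True by (simp add: Yn_def YT_def)
  next
    case False
    have "Yn n t = YT t" for n
    proof (cases "t = T")
      case True
      then have "min T (r n t) = T" using r(1)[of t n] by simp
      then show ?thesis using True by (simp add: Yn_def YT_def)
    qed (use False in \<open>auto simp: Yn_def YT_def indicator_def\<close>)
    then show ?thesis by simp
  qed
  have YT: "YT \<in> borel_measurable borel"
    by (rule borel_measurable_LIMSEQ_metric[OF meas lim])
  have bm: "b \<in> borel_measurable borel" by (rule borel_measurable_continuous_onI[OF b(1)])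
  have "(\<lambda>t. (t, YT t)) \<in> borel_measurable borel" using YT by measurable
  from measurable_compose[OF this bm] have "(\<lambda>t. b (t, YT t)) \<in> borel_measurable lborel" by simp
  then have "set_integrable lborel {0..T} (\<lambda>t. b (t, YT t))"
    unfolding set_integrable_def using b(2)
    by (intro integrableI_bounded_set_indicator[of _ _ _ B]) (auto simp: emeasure_lborel_Icc_eq)
  then have "(\<lambda>t. b (t, YT t)) integrable_on {0..T}" by (rule set_borel_integral_eq_integral)
  then show ?thesis by (rule integrable_eq) (auto simp: YT_def)
qed

text \<open>The largest sum over partitions of \<open>[0, t]\<close>, as a function of t, dominates the two-parameter
  function by its increments.\<close>

lemma finite_variation2_dominated:
  fixes A :: "real \<Rightarrow> real \<Rightarrow> 'a::real_normed_vector"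
  assumes fin: "variation2 r T A < top" and r: "0 < r" and diag: "\<And>s. A s s = 0"
  shows "\<exists>v. \<forall>s t. 0 \<le> s \<and> s \<le> t \<and> t \<le> T \<longrightarrow> v s \<le> v t \<and> norm (A s t) powr r \<le> (v t - v s :: real)"
proof -
  let ?sum = "\<lambda>(N, u). \<Sum>i<N. norm (A (u i) (u (Suc i))) powr r"
  let ?S = "SUP (N, t) \<in> {(N, t). interval_partition 0 T N t}. ennreal (\<Sum>i<N. norm (A (t i) (t (Suc i))) powr r)"
  have "?S \<noteq> top" using fin unfolding variation2_def ennreal_powr_def by (auto split: if_splits)
  define B where "B = enn2real ?S"
  have B: "(\<Sum>i<N. norm (A (u i) (u (Suc i))) powr r) \<le> B" if "interval_partition 0 T N u" for N u
  proof -
    have "ennreal (\<Sum>i<N. norm (A (u i) (u (Suc i))) powr r) \<le> ?S"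
      using that by (intro SUP_upper2[of "(N, u)"]) auto
    also have "?S = ennreal B" using \<open>?S \<noteq> top\<close> by (simp add: B_def less_top[symmetric])
    finally show ?thesis
      by (subst (asm) ennreal_le_iff) (simp_all add: B_def)
  qed
  define P where "P t = {(N, u). interval_partition 0 t N u}" for t
  define v where "v t = Sup (?sum ` P t)" for t
  have extend: "\<exists>N' u'. interval_partition 0 t N' u' \<and>
      ?sum (N, u) + norm (A s t) powr r = ?sum (N', u')"
    if "interval_partition 0 s N u" "s \<le> t" for s t N u
  proof (cases "s = t")
    case True
    then show ?thesis using that diag r by (intro exI[of _ N] exI[of _ u]) auto
  next
    case False
    let ?v = "\<lambda>i::nat. if i = 0 then s else t"
    have v: "interval_partition s t 1 ?v" using that False by (auto simp: interval_partition_def)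
    let ?d = "max (mesh N u) (mesh 1 ?v) + 1"
    have m: "mesh N u < ?d" "mesh 1 ?v < ?d" by auto
    have "0 \<le> mesh N u" unfolding mesh_def by (intro Max_ge) auto
    then have d: "0 < ?d" by linarith
    note c = concat_partition(1)[OF that(1) m(1) v m(2) d]
      concat_partition(3)[OF that(1) m(1) v m(2) d, of "\<lambda>x y. norm (A x y) powr r"]
    show ?thesis
      by (rule exI, rule exI, rule conjI, rule c(1)) (simp only: prod.case c(2), simp)
  qed
  have bdd: "bdd_above (?sum ` P t)" if "0 \<le> t" and tT: "t \<le> T" for t
  proof (rule bdd_aboveI[of _ B])
    fix x assume "x \<in> ?sum ` P t"
    then obtain N u where u: "interval_partition 0 t N u" "x = ?sum (N, u)" by (auto simp: P_def)
    obtain N' u' where u': "interval_partition 0 T N' u'" "?sum (N, u) + norm (A t T) powr r = ?sum (N', u')"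
      using extend[OF u(1) tT] by blast
    have "x \<le> x + norm (A t T) powr r" by simp
    also have "\<dots> \<le> B" using B[OF u'(1)] u' u(2) by simp
    finally show "x \<le> B" .
  qed
  have ne: "?sum ` P t \<noteq> {}" if "0 \<le> t" for t
    using fine_partition_exists[OF that, of 1] by (auto simp: P_def)
  have main: "v s + norm (A s t) powr r \<le> v t" if st: "0 \<le> s" "s \<le> t" "t \<le> T" for s t
  proof -
    have "v s \<le> v t - norm (A s t) powr r"
      unfolding v_def[of s]
    proof (rule cSup_least[OF ne[OF st(1)]])
      fix x assume "x \<in> ?sum ` P s"
      then obtain N u where u: "interval_partition 0 s N u" "x = ?sum (N, u)" by (auto simp: P_def)
      obtain N' u' where u': "interval_partition 0 t N' u'" "?sum (N, u) + norm (A s t) powr r = ?sum (N', u')"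
        using extend[OF u(1) st(2)] by blast
      have "?sum (N', u') \<le> v t"
        unfolding v_def using u'(1) st by (intro cSup_upper bdd imageI) (auto simp: P_def)
      then show "x \<le> v t - norm (A s t) powr r" using u u' by simp
    qed
    then show ?thesis by simp
  qed
  have "v s \<le> v t \<and> norm (A s t) powr r \<le> v t - v s" if "0 \<le> s" "s \<le> t" "t \<le> T" for s t
    using main[OF that] powr_ge_zero[of "norm (A s t)" r] by linarith
  then show ?thesis by blast
qed

text \<open>On bounded sets a smaller exponent costs a constant factor, which is absorbed by rescaling v.\<close>

lemma finite_variation2_powr:
  fixes A :: "real \<Rightarrow> real \<Rightarrow> 'a::real_normed_vector"
  assumes fin: "variation2 r T A < top" and r: "0 < r" and diag: "\<And>s. A s s = 0"
    and \<beta>: "0 < \<beta>" "\<beta> \<le> 1 / r" "1 / r \<le> \<beta> + 1"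
  shows "\<exists>v. \<forall>s t. 0 \<le> s \<and> s \<le> t \<and> t \<le> T \<longrightarrow> v s \<le> v t \<and> norm (A s t) \<le> (v t - v s :: real) powr \<beta>"
proof -
  obtain v where v: "\<And>s t. 0 \<le> s \<Longrightarrow> s \<le> t \<Longrightarrow> t \<le> T \<Longrightarrow> v s \<le> v t \<and> norm (A s t) powr r \<le> (v t - v s :: real)"
    using finite_variation2_dominated[OF fin r diag] by blast
  define D where "D = 1 + \<bar>v T - v 0\<bar>"
  define v' where "v' t = D powr (1 / \<beta>) * v t" for t
  have "v' s \<le> v' t \<and> norm (A s t) \<le> (v' t - v' s) powr \<beta>" if "0 \<le> s" "s \<le> t" "t \<le> T" for s t
  proof
    show "v' s \<le> v' t" using v[OF that] by (auto simp: v'_def intro: mult_left_mono)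
    have d: "0 \<le> v t - v s" "v t - v s \<le> D"
      using v[of 0 s] v[of t T] v[OF that] that by (auto simp: D_def)
    have "norm (A s t) = (norm (A s t) powr r) powr (1 / r)" using r by (simp add: powr_powr)
    also have "\<dots> \<le> (v t - v s) powr (1 / r)" using v[OF that] r by (intro powr_mono2) auto
    also have "\<dots> \<le> D * (v t - v s) powr \<beta>"
      using d \<beta> by (intro powr_lower_exponent) (auto simp: D_def)
    also have "\<dots> = (D powr (1 / \<beta>)) powr \<beta> * (v t - v s) powr \<beta>"
      using \<beta> by (simp add: powr_powr D_def)
    also have "\<dots> = (D powr (1 / \<beta>) * (v t - v s)) powr \<beta>" by (rule powr_mult[symmetric])
    also have "\<dots> = (v' t - v' s) powr \<beta>" by (simp add: v'_def algebra_simps)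
    finally show "norm (A s t) \<le> (v' t - v' s) powr \<beta>" .
  qed
  then show ?thesis by blast
qed

lemma rough_integral_at_0:
  assumes "has_rough_integral X XX F F' 0 I"
  shows "I = 0"
proof (rule ccontr)
  assume "I \<noteq> 0"
  then have "0 < norm I" by simp
  then obtain \<delta> where d: "0 < \<delta>" "\<And>M u. interval_partition 0 0 M u \<Longrightarrow> mesh M u < \<delta> \<Longrightarrow>
      norm ((\<Sum>i<M. F (u i) (X (u (Suc i)) - X (u i)) + apply_matrix (F' (u i)) (XX (u i) (u (Suc i)))) - I) < norm I"
    using assms unfolding has_rough_integral_def by meson
  have "interval_partition 0 0 0 (\<lambda>_. 0)" "mesh 0 (\<lambda>_. 0) < \<delta>"
    using d(1) by (auto simp: interval_partition_def mesh_def)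
  from d(2)[OF this] show False by simp
qed

text \<open>Finite \<open>p / 2\<close>-variation of the remainder gives a bound with the exponent \<open>2 / p\<close>, which may be
  lowered to \<open>\<beta>\<close>.\<close>

lemma solution_is_rough_equation:
  fixes \<sigma> :: "real \<times> (real^'k) \<Rightarrow> (real^'d) \<Rightarrow>\<^sub>L (real^'k)"
  assumes sol: "solves_RDE p T X XX y0 b \<sigma> Y" and p: "0 < p"
    and L: "1 \<le> L" "C3b \<sigma>" "C3b_norm \<sigma> \<le> L" "C2b b" "C2b_norm b \<le> L"
    and exps: "0 < \<alpha>" "\<alpha> \<le> \<beta>" "\<beta> \<le> 1" "1 < \<alpha> + \<beta>" "\<beta> \<le> 2 / p" "2 / p \<le> \<beta> + 1"
    and W: "1 \<le> W" "control T \<omega>" "\<omega> 0 T \<le> W"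
    and chen: "\<And>s u t. XX s t = XX s u + XX u t + (X u - X s) \<otimes>\<^sub>v (X t - X u)"
    and driver: "\<And>s t. 0 \<le> s \<Longrightarrow> s < t \<Longrightarrow> t \<le> T \<Longrightarrow> driver_bound \<alpha> \<beta> X XX \<omega> 1 s t"
  shows "\<exists>I. rough_equation L \<sigma> T \<alpha> \<beta> W \<omega> X XX b Y y0 I"
proof -
  interpret smooth_field L \<sigma> using L by unfold_locales
  have ctl: "controlled_path p T X Y (\<lambda>s. \<sigma> (s, Y s))"
    and eq: "\<And>t. t \<in> {0..T} \<Longrightarrow> \<exists>I. has_rough_integral X XX (\<lambda>s. \<sigma> (s, Y s))
            (\<lambda>s. Dblin (\<lambda>y. \<sigma> (s, y)) (Y s) o\<^sub>L \<sigma> (s, Y s)) t I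
          \<and> Y t = y0 + integral {0..t} (\<lambda>s. b (s, Y s)) + I"
    using sol by (auto simp: solves_RDE_def)
  have der: "Dblin (\<lambda>y. \<sigma> (s, y)) (Y s) o\<^sub>L \<sigma> (s, Y s) = gubinelli_field \<sigma> (s, Y s)" for s
    by (simp add: gubinelli_field_def Dblin_state[OF sigma_smooth(1)])
  have "\<forall>t\<in>{0..T}. \<exists>J. has_rough_integral X XX (\<lambda>s. \<sigma> (s, Y s)) (\<lambda>s. gubinelli_field \<sigma> (s, Y s)) t J
      \<and> Y t = y0 + integral {0..t} (\<lambda>s. b (s, Y s)) + J"
    using eq unfolding der by (rule ballI)
  from bchoice[OF this] obtain I where "\<forall>t\<in>{0..T}.
      has_rough_integral X XX (\<lambda>s. \<sigma> (s, Y s)) (\<lambda>s. gubinelli_field \<sigma> (s, Y s)) t (I t)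
      \<and> Y t = y0 + integral {0..t} (\<lambda>s. b (s, Y s)) + I t" by (rule exE)
  note I = bspec[OF this]
  have cad: "(Y \<longlongrightarrow> Y t) (at_right t)" if "0 \<le> t" "t < T" for t
    using ctl that by (auto simp: controlled_path_def cadlag_finite_variation_def cadlag_on_def)
  have cont: "continuous_on UNIV b" using L(4) by (simp add: C2b_def C0b_def)
  have bint: "(\<lambda>r. b (r, Y r)) integrable_on {0..T}"
    by (rule cadlag_composition_integrable[OF _ cont C2b_bounds(1)[OF L(4,5)]]) (rule cad)
  have "variation2 (p / 2) T (\<lambda>s t. Y t - Y s - \<sigma> (s, Y s) (X t - X s)) < top"
    using ctl by (auto simp: controlled_path_def cadlag_finite_variation2_def)
  from finite_variation2_powr[OF this, of \<beta>]
  have "\<exists>v. \<forall>s t. 0 \<le> s \<and> s \<le> t \<and> t \<le> T \<longrightarrow>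
      v s \<le> v t \<and> norm (Y t - Y s - \<sigma> (s, Y s) (X t - X s)) \<le> (v t - v s :: real) powr \<beta>"
    using p exps by (auto simp: blinfun.zero_right)
  then have "rough_equation L \<sigma> T \<alpha> \<beta> W \<omega> X XX b Y y0 I"
    using exps W chen driver C2b_bounds[OF L(4,5)] cad bint I by unfold_locales auto
  then show ?thesis by blast
qed

lemma solution_at_0:
  assumes "solves_RDE p T X XX y0 b \<sigma> Y" "0 \<le> T"
  shows "Y 0 = y0"
proof -
  have "0 \<in> {0..T}" using assms(2) by simp
  then show ?thesis using assms(1) rough_integral_at_0 unfolding solves_RDE_def by fastforce
qed

lemma euler_grid_index:
  assumes P: "interval_partition 0 T N \<tau>" and k: "k \<le> N"
  shows "{i. i < N \<and> \<tau> (Suc i) \<le> \<tau> k} = {..<k}"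
proof safe
  fix i assume i: "i < N" "\<tau> (Suc i) \<le> \<tau> k"
  show "i < k"
  proof (rule ccontr)
    assume "\<not> i < k"
    then have "\<tau> k < \<tau> (Suc i)" using interval_partition_strict_mono[OF P, of k "Suc i"] i by auto
    then show False using i by simp
  qed
next
  fix i assume "i < k"
  then show "i < N" "\<tau> (Suc i) \<le> \<tau> k" using interval_partition_mono[OF P, of "Suc i" k] k by auto
qed

lemma euler_at_grid:
  assumes P: "interval_partition 0 T N \<tau>" and E: "euler_approximation T N \<tau> X y0 b \<sigma> Yn" and k: "k \<le> N"
  shows "Yn (\<tau> k) = y0 + (\<Sum>i<k. (\<tau> (Suc i) - \<tau> i) *\<^sub>R b (\<tau> i, Yn (\<tau> i)))
    + (\<Sum>i<k. \<sigma> (\<tau> i, Yn (\<tau> i)) (X (\<tau> (Suc i)) - X (\<tau> i)))"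
  using E interval_partition_bounds[OF P k] unfolding euler_approximation_def euler_grid_index[OF P k, symmetric]
  by auto

section \<open>The driver under Property (RIE)\<close>

text \<open>With J a primitive of the iterated integral.  Chen's relation holds for any J; taking the Riemann sums
  gives the second level of the discretised driver on the grid, taking their limit gives the canonical lift.\<close>

definition second_level ::
  "(real \<Rightarrow> real^'d) \<Rightarrow> (real \<Rightarrow> real^'d^'d) \<Rightarrow> real \<Rightarrow> real \<Rightarrow> real^'d^'d" where
  "second_level X J s t = J t - J s - X s \<otimes>\<^sub>v (X t - X s)"

lemma canonical_lift_eq: "canonical_lift N \<tau> X = second_level X (RIE_integral N \<tau> X)"
  by (intro ext) (simp add: canonical_lift_def second_level_def)

lemma second_level_chen:
  "second_level X J s t = second_level X J s u + second_level X J u t + (X u - X s) \<otimes>\<^sub>v (X t - X u)"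
  by (simp add: second_level_def tensor_linear)

lemma second_level_same: "second_level X J s s = 0"
  by (simp add: second_level_def tensor_linear)

lemma second_level_diff: "second_level X J s t - second_level X J' s t = (J t - J' t) - (J s - J' s)"
  by (simp add: second_level_def)

text \<open>The case \<open>y = 0\<close> is covered because a positive number divided by zero is infinite here.\<close>

lemma ennreal_quotient_le_1:
  assumes "ennreal x / ennreal y \<le> 1" "0 \<le> x" "0 \<le> y"
  shows "x \<le> y"
proof (cases "y = 0")
  case True
  then show ?thesis using assms by (cases "x = 0") (auto simp: ennreal_eq_0_iff top_unique split: if_splits)
next
  case False
  then have "ennreal (x / y) \<le> ennreal 1" using assms by (simp add: divide_ennreal)
  then have "x / y \<le> 1" by (subst (asm) ennreal_le_iff) auto
  then show ?thesis using False assms by (simp add: field_simps)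
qed

lemma le_powr_inverse:
  fixes x y p :: real
  assumes "x powr p \<le> y" "0 \<le> x" "0 < p"
  shows "x \<le> y powr (1 / p)"
proof -
  have "x = (x powr p) powr (1 / p)" using assms by (simp add: powr_powr)
  also have "\<dots> \<le> y powr (1 / p)" using assms by (intro powr_mono2) auto
  finally show ?thesis .
qed

lemma RIE_control_bounds:
  assumes R: "RIE_control p T N \<tau> X w" and p: "0 < p" and P: "\<And>n. interval_partition 0 T (N n) (\<tau> n)"
  shows "control T w"
    "\<And>s t. 0 \<le> s \<Longrightarrow> s \<le> t \<Longrightarrow> t \<le> T \<Longrightarrow> norm (X t - X s) \<le> w s t powr (1 / p)"
    "\<And>n k l. k \<le> l \<Longrightarrow> l \<le> N n \<Longrightarrow> norm (second_level X (riemann_sum (N n) (\<tau> n) X) (\<tau> n k) (\<tau> n l))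
       \<le> w (\<tau> n k) (\<tau> n l) powr (2 / p)"
proof -
  let ?A = "SUP (s, t) \<in> simplex2 T. ennreal (norm (X t - X s) powr p) / ennreal (w s t)"
  let ?g = "\<lambda>n (k, l). ennreal (norm (riemann_sum (N n) (\<tau> n) X (\<tau> n l) - riemann_sum (N n) (\<tau> n) X (\<tau> n k)
             - X (\<tau> n k) \<otimes>\<^sub>v (X (\<tau> n l) - X (\<tau> n k))) powr (p / 2)) / ennreal (w (\<tau> n k) (\<tau> n l))"
  let ?B = "SUP n. SUP (k, l) \<in> {(k, l). k < l \<and> l \<le> N n}. ?g n (k, l)"
  show ctrl: "control T w" using R by (simp add: RIE_control_def)
  have "?A + ?B \<le> 1" using R by (simp add: RIE_control_def)
  then have AB: "?A \<le> 1" "?B \<le> 1"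
    by (auto elim: order.trans[rotated])
  show "norm (X t - X s) \<le> w s t powr (1 / p)" if st: "0 \<le> s" "s \<le> t" "t \<le> T" for s t
  proof (rule le_powr_inverse[OF ennreal_quotient_le_1])
    have "ennreal (norm (X t - X s) powr p) / ennreal (w s t) \<le> ?A"
      using st by (intro SUP_upper2[of "(s, t)"]) (auto simp: simplex2_def)
    then show "ennreal (norm (X t - X s) powr p) / ennreal (w s t) \<le> 1" using AB by order
  qed (use p control_nonneg[OF ctrl st] in auto)
  show "norm (second_level X (riemann_sum (N n) (\<tau> n) X) (\<tau> n k) (\<tau> n l)) \<le> w (\<tau> n k) (\<tau> n l) powr (2 / p)"
    if kl: "k \<le> l" "l \<le> N n" for n k l
  proof (cases "k = l")
    case True
    then show ?thesis by (simp add: second_level_same)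
  next
    case False
    have r: "0 \<le> \<tau> n k" "\<tau> n k \<le> \<tau> n l" "\<tau> n l \<le> T"
      using interval_partition_bounds[OF P, of k n] interval_partition_bounds[OF P, of l n]
        interval_partition_mono[OF P, of k l n] kl by auto
    let ?x = "second_level X (riemann_sum (N n) (\<tau> n) X) (\<tau> n k) (\<tau> n l)"
    have "norm ?x \<le> w (\<tau> n k) (\<tau> n l) powr (1 / (p / 2))"
    proof (rule le_powr_inverse[OF ennreal_quotient_le_1])
      have "?g n (k, l) \<le> (SUP (k, l) \<in> {(k, l). k < l \<and> l \<le> N n}. ?g n (k, l))"
        using kl False by (intro SUP_upper2[of "(k, l)"]) auto
      also have "\<dots> \<le> ?B" by (rule SUP_upper) simp
      finally show "ennreal (norm ?x powr (p / 2)) / ennreal (w (\<tau> n k) (\<tau> n l)) \<le> 1"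
        using AB by (simp add: second_level_def)
    qed (use p control_nonneg[OF ctrl r] in auto)
    then show ?thesis by simp
  qed
qed

lemma partition_cell_exists:
  assumes P: "interval_partition 0 T N \<tau>" and t: "0 \<le> t" "t < T"
  shows "\<exists>k<N. \<tau> k \<le> t \<and> t < \<tau> (Suc k)"
proof -
  have N: "t < \<tau> N" and z: "\<tau> 0 = 0" using P t by (auto simp: interval_partition_def)
  define m where "m = (LEAST m. t < \<tau> m)"
  have m: "t < \<tau> m" unfolding m_def using N by (rule LeastI)
  have "m \<noteq> 0" using m z t by (cases m) auto
  then obtain k where k: "m = Suc k" using not0_implies_Suc by blast
  have "\<not> t < \<tau> k" using not_less_Least[of k "\<lambda>m. t < \<tau> m"] k by (simp add: m_def)
  moreover have "m \<le> N" unfolding m_def using N by (rule Least_le)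
  ultimately show ?thesis using m k by (intro exI[of _ k]) auto
qed

lemma riemann_sum_in_cell:
  assumes P: "interval_partition 0 T N \<tau>" and k: "k < N" and st: "\<tau> k \<le> s" "s \<le> t" "t \<le> \<tau> (Suc k)"
  shows "riemann_sum N \<tau> X t - riemann_sum N \<tau> X s = X (\<tau> k) \<otimes>\<^sub>v (X t - X s)"
proof -
  let ?f = "\<lambda>j u. X (\<tau> j) \<otimes>\<^sub>v (X (min (\<tau> (Suc j)) u) - X (min (\<tau> j) u))"
  have zero: "?f j t - ?f j s = 0" if j: "j < N" "j \<noteq> k" for j
  proof (cases "j < k")
    case True
    then have "\<tau> (Suc j) \<le> \<tau> k" "\<tau> j \<le> \<tau> k" using k by (auto intro!: interval_partition_mono[OF P])
    then show ?thesis using st by simp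
  next
    case False
    then have "\<tau> (Suc k) \<le> \<tau> j" "\<tau> j \<le> \<tau> (Suc j)" using j by (auto intro!: interval_partition_mono[OF P])
    then show ?thesis using st by (simp add: min_absorb2 tensor_linear)
  qed
  have "riemann_sum N \<tau> X t - riemann_sum N \<tau> X s = (\<Sum>j<N. ?f j t - ?f j s)"
    by (simp add: riemann_sum_def sum_subtractf)
  also have "\<dots> = (\<Sum>j<N. if j = k then ?f k t - ?f k s else 0)"
    by (rule sum.cong) (use zero in auto)
  also have "\<dots> = ?f k t - ?f k s" using k by simp
  also have "\<dots> = X (\<tau> k) \<otimes>\<^sub>v (X t - X s)"
    using st by (simp add: min_absorb2 min_absorb1 flip: tensor_linear(4))
  finally show ?thesis .
qed

text \<open>In particular it vanishes if s is the left end of the cell.\<close>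

lemma second_level_riemann_in_cell:
  assumes "interval_partition 0 T N \<tau>" "k < N" "\<tau> k \<le> s" "s \<le> t" "t \<le> \<tau> (Suc k)"
  shows "second_level X (riemann_sum N \<tau> X) s t = - ((X s - X (\<tau> k)) \<otimes>\<^sub>v (X t - X s))"
  using riemann_sum_in_cell[OF assms, of X] by (simp add: second_level_def tensor_linear)

lemma discretization_in_cell:
  assumes P: "interval_partition 0 T N \<tau>" and k: "k < N" and t: "\<tau> k \<le> t" "t < \<tau> (Suc k)"
  shows "discretization T N \<tau> X t = X (\<tau> k)"
proof -
  have "t \<noteq> T" using interval_partition_bounds(2)[OF P, of "Suc k"] k t by auto
  moreover have "indicat_real {\<tau> j..<\<tau> (Suc j)} t *\<^sub>R X (\<tau> j) = (if j = k then X (\<tau> k) else 0)" if "j < N" for j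
  proof (cases j k rule: linorder_cases)
    case less
    then show ?thesis using t interval_partition_mono[OF P, of "Suc j" k] k by (auto simp: indicator_def)
  next
    case greater
    then show ?thesis using t interval_partition_mono[OF P, of "Suc k" j] that by (auto simp: indicator_def)
  qed (use t in auto)
  ultimately show ?thesis using k by (simp add: discretization_def)
qed

lemma discretization_at_end:
  assumes P: "interval_partition 0 T N \<tau>"
  shows "discretization T N \<tau> X T = X T"
proof -
  have "indicat_real {\<tau> j..<\<tau> (Suc j)} T = 0" if "j < N" for j
    using interval_partition_bounds(2)[OF P, of "Suc j"] that by (auto simp: indicator_def)
  then show ?thesis by (simp add: discretization_def)
qed

text \<open>A quantity that is bounded by A and has finite \<open>p / r\<close>-variation has small \<open>p' / r\<close>-variation if A
  is small: split it into its powers \<open>1 - p / p'\<close> and \<open>p / p'\<close>.\<close>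

lemma interpolation_powr:
  fixes x A B u :: real
  assumes "0 \<le> x" "x \<le> A" "x \<le> B * u powr (r / p)" "1 \<le> B" "0 < p" "p < p'"
  shows "x \<le> A powr (1 - p / p') * (B * u powr (r / p'))"
proof -
  have e: "0 \<le> p / p'" "p / p' \<le> 1" using assms by auto
  have "x = x powr (1 - p / p') * x powr (p / p')" using assms(1) by (simp flip: powr_add)
  also have "\<dots> \<le> A powr (1 - p / p') * (B * u powr (r / p)) powr (p / p')"
    using assms e by (intro mult_mono powr_mono2) auto
  also have "(B * u powr (r / p)) powr (p / p') = B powr (p / p') * u powr (r / p')"
    using assms by (simp add: powr_mult powr_powr)
  also have "A powr (1 - p / p') * (B powr (p / p') * u powr (r / p')) \<le> A powr (1 - p / p') * (B * u powr (r / p'))"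
  proof (intro mult_left_mono mult_right_mono)
    show "B powr (p / p') \<le> B" using assms e powr_mono[of "p / p'" 1 B] by simp
  qed auto
  finally show ?thesis .
qed

lemma powr_mult_le:
  assumes "1 \<le> B" "0 \<le> \<eta>" "\<eta> \<le> 1"
  shows "(B * x) powr \<eta> \<le> B * x powr (\<eta>::real)"
proof -
  have "B powr \<eta> \<le> B" using assms powr_mono[of \<eta> 1 B] by simp
  then show ?thesis unfolding powr_mult by (intro mult_right_mono) auto
qed

text \<open>The dimensional constant is a parameter, so that the definitions below carry no type argument.\<close>

locale RIE_driver =
  fixes p p' q T :: real and N :: "nat \<Rightarrow> nat" and \<tau> :: "nat \<Rightarrow> nat \<Rightarrow> real" and X :: "real \<Rightarrow> real^'d"
    and w :: "real \<Rightarrow> real \<Rightarrow> real" and \<kappa> :: real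
  assumes \<kappa>_eq: "contraction_const TYPE('d) = \<kappa>" and T: "0 < T" and pp: "2 < p" "p < p'" "p' < 3" and q: "1 < q" "q < 2" "1 < 1 / p' + 1 / q"
    and RIE: "property_RIE p T N \<tau> X" and ctrl: "RIE_control p T N \<tau> X w"
begin

abbreviation "J n \<equiv> riemann_sum (N n) (\<tau> n) X"
abbreviation "I \<equiv> RIE_integral N \<tau> X"
abbreviation "XX \<equiv> second_level X I"
abbreviation "XN n \<equiv> second_level X (J n)"
abbreviation "\<epsilon>1 n \<equiv> sup_norm {0..T} (\<lambda>t. discretization T (N n) (\<tau> n) X t - X t)"
abbreviation "\<epsilon>2 n \<equiv> sup_norm {0..T} (\<lambda>t. J n t - I t)"

lemma part: "interval_partition 0 T (N n) (\<tau> n)"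
  using RIE by (simp add: property_RIE_def)

lemma p0: "0 < p" using pp by simp

lemmas w_bounds = RIE_control_bounds[OF ctrl p0 part]

lemma grid: "k \<le> N n \<Longrightarrow> 0 \<le> \<tau> n k" "k \<le> N n \<Longrightarrow> \<tau> n k \<le> T"
  using interval_partition_bounds[OF part] by auto

lemma J_limit: "uniform_limit {0..T} J I sequentially"
proof -
  obtain K where K: "uniform_limit {0..T} J K sequentially"
    using RIE by (auto simp: property_RIE_def)
  have "I t = K t" if "t \<in> {0..T}" for t
    unfolding RIE_integral_def using tendsto_uniform_limitI[OF K that] by (rule limI)
  then show ?thesis using K uniform_limit_cong'[of "{0..T}" J J I K] by auto
qed

lemma X_bound: "0 \<le> s \<Longrightarrow> s \<le> t \<Longrightarrow> t \<le> T \<Longrightarrow> norm (X t - X s) \<le> w 0 T powr (1 / p)"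
  using w_bounds(2)[of s t] control_mono[OF w_bounds(1), of 0 s t T] control_nonneg[OF w_bounds(1), of s t]
    powr_mono2[of "1 / p" "w s t" "w 0 T"] p0 by auto

lemma disc_bdd: "bdd_above ((\<lambda>t. norm (discretization T (N n) (\<tau> n) X t - X t)) ` {0..T})"
proof (rule bdd_aboveI2[of _ _ "w 0 T powr (1 / p)"])
  fix t assume t: "t \<in> {0..T}"
  show "norm (discretization T (N n) (\<tau> n) X t - X t) \<le> w 0 T powr (1 / p)"
  proof (cases "t = T")
    case True
    then show ?thesis by (simp add: discretization_at_end[OF part])
  next
    case False
    then obtain k where k: "k < N n" "\<tau> n k \<le> t" "t < \<tau> n (Suc k)"
      using partition_cell_exists[OF part, of t n] t by auto
    then show ?thesis using X_bound[of "\<tau> n k" t] grid[of k n] t discretization_in_cell[OF part k, of X]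
      by (simp add: norm_minus_commute)
  qed
qed

lemma cell_close:
  assumes "k < N n" "\<tau> n k \<le> t" "t < \<tau> n (Suc k)"
  shows "norm (X t - X (\<tau> n k)) \<le> \<epsilon>1 n"
proof -
  have "t \<in> {0..T}" using assms grid[of k n] grid[of "Suc k" n] by auto
  from sup_norm_upper[OF disc_bdd[of n] this] show ?thesis
    using discretization_in_cell[OF part assms, of X] norm_minus_commute[of "X t"] by simp
qed

lemma J_bounded: "\<exists>B. \<forall>t\<in>{0..T}. norm (J n t) \<le> B"
proof (intro exI ballI)
  fix t assume t: "t \<in> {0..T}"
  have "norm (J n t) \<le> (\<Sum>k<N n. norm (X (\<tau> n k)) * w 0 T powr (1 / p))"
    unfolding riemann_sum_def
  proof (intro sum_norm_le)
    fix k assume k: "k \<in> {..<N n}"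
    have "\<tau> n k \<le> \<tau> n (Suc k)" using interval_partition_mono[OF part, of k "Suc k" n] k by auto
    then have "norm (X (min (\<tau> n (Suc k)) t) - X (min (\<tau> n k) t)) \<le> w 0 T powr (1 / p)"
      using t k grid[of k n] by (intro X_bound) auto
    then show "norm (X (\<tau> n k) \<otimes>\<^sub>v (X (min (\<tau> n (Suc k)) t) - X (min (\<tau> n k) t)))
        \<le> norm (X (\<tau> n k)) * w 0 T powr (1 / p)"
      by (intro order.trans[OF norm_tensor] mult_left_mono) auto
  qed
  then show "norm (J n t) \<le> (\<Sum>k<N n. norm (X (\<tau> n k)) * w 0 T powr (1 / p))" .
qed

lemma J_close: "t \<in> {0..T} \<Longrightarrow> norm (J n t - I t) \<le> \<epsilon>2 n"
proof (rule sup_norm_upper)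
  have "eventually (\<lambda>m. \<forall>t\<in>{0..T}. dist (J m t) (I t) < 1) sequentially"
    using uniform_limitD[OF J_limit, of 1] by simp
  then obtain m where m: "\<forall>t\<in>{0..T}. dist (J m t) (I t) < 1"
    using eventually_happens'[OF sequentially_bot] by blast
  obtain A B where A: "\<forall>t\<in>{0..T}. norm (J n t) \<le> A" and B: "\<forall>t\<in>{0..T}. norm (J m t) \<le> B"
    using J_bounded by meson
  show "bdd_above ((\<lambda>t. norm (J n t - I t)) ` {0..T})"
  proof (rule bdd_aboveI2[of _ _ "A + B + 1"])
    fix t assume t: "t \<in> {0..T}"
    have "norm (J n t - I t) \<le> norm (J n t - J m t) + norm (J m t - I t)" by (rule norm_add_le2) simp
    moreover have "norm (J n t - J m t) \<le> norm (J n t) + norm (J m t)" by (rule norm_triangle_ineq4)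
    moreover have "norm (J m t - I t) < 1" using m t by (auto simp: dist_norm)
    moreover have "norm (J n t) \<le> A" "norm (J m t) \<le> B" using A B t by auto
    ultimately show "norm (J n t - I t) \<le> A + B + 1" by linarith
  qed
qed

lemma \<epsilon>_nonneg: "0 \<le> \<epsilon>1 n" "0 \<le> \<epsilon>2 n"
  using order.trans[OF norm_ge_zero sup_norm_upper[OF disc_bdd, of 0 n]] order.trans[OF norm_ge_zero J_close[of 0 n]] T
  by auto

lemma sup_norm_tendsto_0:
  assumes "uniform_limit {0..T} F G sequentially" "\<And>n. 0 \<le> sup_norm {0..T} (\<lambda>t. F n t - G t)"
  shows "(\<lambda>n. sup_norm {0..T} (\<lambda>t. F n t - G t)) \<longlonglongrightarrow> 0"
proof (rule order_tendstoI)
  fix a :: real assume "0 < a"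
  then have "eventually (\<lambda>n. \<forall>t\<in>{0..T}. dist (F n t) (G t) < a / 2) sequentially"
    using uniform_limitD[OF assms(1), of "a / 2"] by simp
  then show "eventually (\<lambda>n. sup_norm {0..T} (\<lambda>t. F n t - G t) < a) sequentially"
  proof eventually_elim
    case (elim n)
    have "sup_norm {0..T} (\<lambda>t. F n t - G t) \<le> a / 2"
      unfolding sup_norm_def using elim T by (intro cSUP_least) (auto simp: dist_norm less_imp_le)
    then show ?case using \<open>0 < a\<close> by simp
  qed
next
  fix a :: real assume "a < 0"
  then show "eventually (\<lambda>n. a < sup_norm {0..T} (\<lambda>t. F n t - G t)) sequentially"
    using assms(2) by (intro always_eventually allI) (meson less_le_trans)
qed

lemma \<epsilon>_tendsto: "\<epsilon>1 \<longlonglongrightarrow> 0" "\<epsilon>2 \<longlonglongrightarrow> 0"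
proof -
  have "uniform_limit {0..T} (\<lambda>n. discretization T (N n) (\<tau> n) X) X sequentially"
    using RIE by (simp add: property_RIE_def)
  from sup_norm_tendsto_0[OF this \<epsilon>_nonneg(1)] show "\<epsilon>1 \<longlonglongrightarrow> 0" .
  from sup_norm_tendsto_0[OF J_limit \<epsilon>_nonneg(2)] show "\<epsilon>2 \<longlonglongrightarrow> 0" .
qed

text \<open>The grid bound passes to arbitrary intervals: cutting at the first grid point after s and the last
  grid point before t leaves two pieces inside cells.  The right piece has no second level, and that of the
  left piece vanishes in the limit.\<close>

lemma XN_bound:
  assumes st: "0 \<le> s" "s < t" "t \<le> T" and mesh: "mesh (N n) (\<tau> n) < t - s"
  shows "norm (XN n s t) \<le> \<epsilon>1 n * w s t powr (1 / p) + 3 * w s t powr (2 / p)"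
proof -
  obtain j where j: "j < N n" "\<tau> n j \<le> s" "s < \<tau> n (Suc j)"
    using partition_cell_exists[OF part, of s n] st by auto
  have "\<bar>\<tau> n (Suc j) - \<tau> n j\<bar> < t - s" using mesh mesh_less_iff[of "t - s" "N n" "\<tau> n"] j(1) st by simp
  then have at: "\<tau> n (Suc j) < t" using j by linarith
  obtain l where l: "Suc j \<le> l" "l \<le> N n" "\<tau> n l \<le> t" "XN n (\<tau> n l) t = 0"
  proof (cases "t = T")
    case True
    have "\<tau> n (N n) = T" using part[of n] by (simp add: interval_partition_def)
    then show ?thesis using that[of "N n"] True j by (simp add: second_level_same Suc_le_eq)
  next
    case False
    then obtain k where k: "k < N n" "\<tau> n k \<le> t" "t < \<tau> n (Suc k)"
      using partition_cell_exists[OF part, of t n] st by auto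
    have "Suc j < Suc k"
    proof (rule ccontr)
      assume "\<not> Suc j < Suc k"
      then have "\<tau> n (Suc k) \<le> \<tau> n (Suc j)" using j by (intro interval_partition_mono[OF part]) auto
      then show False using at k by simp
    qed
    then show ?thesis
      using that[of k] k second_level_riemann_in_cell[OF part k(1), of "\<tau> n k" t X]
      by (simp add: tensor_linear)
  qed
  let ?a = "\<tau> n (Suc j)" and ?c = "\<tau> n l"
  have ac: "s \<le> ?a" "?a \<le> ?c" "?c \<le> t" using j l interval_partition_mono[OF part, of "Suc j" l n] by auto
  have w1: "norm (X v - X u) \<le> w s t powr (1 / p)" if "s \<le> u" "u \<le> v" "v \<le> t" for u v
    using w_bounds(2)[of u v] control_mono[OF w_bounds(1), of s u v t] control_nonneg[OF w_bounds(1), of u v]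
      powr_mono2[of "1 / p" "w u v" "w s t"] p0 st that by auto
  have "w s t powr (1 / p) * w s t powr (1 / p) = w s t powr (2 / p)" by (simp flip: powr_add)
  then have tens: "norm ((X v - X u) \<otimes>\<^sub>v (X v' - X u')) \<le> w s t powr (2 / p)"
    if "s \<le> u" "u \<le> v" "v \<le> t" "s \<le> u'" "u' \<le> v'" "v' \<le> t" for u v u' v'
    using norm_tensor[of "X v - X u" "X v' - X u'"]
      mult_mono[OF w1[OF that(1-3)] w1[OF that(4-6)]] by simp
  have mid: "norm (XN n ?a ?c) \<le> w s t powr (2 / p)"
    using w_bounds(3)[of "Suc j" l n] control_mono[OF w_bounds(1), of s ?a ?c t] control_nonneg[OF w_bounds(1), of ?a ?c]
      powr_mono2[of "2 / p" "w ?a ?c" "w s t"] p0 st l ac by auto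
  have left: "norm (XN n s ?a) \<le> \<epsilon>1 n * w s t powr (1 / p)"
  proof -
    have "norm (XN n s ?a) \<le> norm (X s - X (\<tau> n j)) * norm (X ?a - X s)"
      using second_level_riemann_in_cell[OF part j(1,2), of ?a X] j norm_tensor[of "X s - X (\<tau> n j)" "X ?a - X s"] by simp
    also have "\<dots> \<le> \<epsilon>1 n * w s t powr (1 / p)"
      using cell_close[OF j] w1[of s ?a] ac \<epsilon>_nonneg by (intro mult_mono) auto
    finally show ?thesis .
  qed
  have "XN n s t = (XN n s ?a + XN n ?a ?c) + ((X ?a - X s) \<otimes>\<^sub>v (X ?c - X ?a) + (X ?c - X s) \<otimes>\<^sub>v (X t - X ?c))"
    using second_level_chen[of X "J n" s t ?c] second_level_chen[of X "J n" s ?c ?a] l(4) by simp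
  from norm_add_le2[OF this] left mid norm_triangle_ineq[of "XN n s ?a" "XN n ?a ?c"]
    norm_triangle_ineq[of "(X ?a - X s) \<otimes>\<^sub>v (X ?c - X ?a)" "(X ?c - X s) \<otimes>\<^sub>v (X t - X ?c)"]
    tens[of s ?a ?a ?c] tens[of s ?c ?c t] ac st
  show ?thesis by linarith
qed

lemma XX_bound:
  assumes st: "0 \<le> s" "s < t" "t \<le> T"
  shows "norm (XX s t) \<le> 3 * w s t powr (2 / p)"
proof -
  have J: "(\<lambda>n. J n u) \<longlonglongrightarrow> I u" if "0 \<le> u" "u \<le> T" for u
    using tendsto_uniform_limitI[OF J_limit] that by auto
  have "(\<lambda>n. norm (XN n s t)) \<longlonglongrightarrow> norm (XX s t)"
    unfolding second_level_def using st by (intro tendsto_intros J) auto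
  moreover have "(\<lambda>n. \<epsilon>1 n * w s t powr (1 / p) + 3 * w s t powr (2 / p)) \<longlonglongrightarrow> 0 * w s t powr (1 / p) + 3 * w s t powr (2 / p)"
    by (intro tendsto_intros \<epsilon>_tendsto)
  moreover have "eventually (\<lambda>n. mesh (N n) (\<tau> n) < t - s) sequentially"
    using RIE st by (intro order_tendstoD(2)[of _ 0]) (auto simp: property_RIE_def)
  then have "eventually (\<lambda>n. norm (XN n s t) \<le> \<epsilon>1 n * w s t powr (1 / p) + 3 * w s t powr (2 / p)) sequentially"
    by eventually_elim (rule XN_bound[OF st])
  ultimately show ?thesis
    using tendsto_le[of sequentially] by fastforce
qed

end

text \<open>All numerical constants in the bounds on the driver are at most \<open>12 \<kappa> V\<^sup>2\<close>.  Multiplying the control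
  by the power p' of this number absorbs them, since the control enters with the exponents
  \<open>\<alpha> = 1 / p'\<close> and \<open>\<beta> \<ge> \<alpha>\<close>.\<close>

definition control_scale :: "real \<Rightarrow> real \<Rightarrow> real \<Rightarrow> real" where
  "control_scale \<kappa> p' V = (12 * \<kappa> * V\<^sup>2) powr p'"

context RIE_driver begin

lemma \<kappa>_ge_1: "1 \<le> \<kappa>"
  using contraction_const_ge_1[where 'd='d] by (simp add: \<kappa>_eq)

text \<open>The exponent \<open>\<beta>\<close> is the worse one of \<open>2 / p'\<close> for the second level and \<open>1 / q\<close> for time; then
  \<open>\<alpha> + \<beta> > 1\<close> is precisely \<open>p' < 3\<close> together with \<open>1 / p' + 1 / q > 1\<close>.  The control v is w with time added,
  and \<open>\<omega>\<close> is its rescaling.\<close>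

definition \<alpha> :: real where "\<alpha> = 1 / p'"
definition \<beta> :: real where "\<beta> = min (2 / p') (1 / q)"
definition \<eta> :: real where "\<eta> = 1 - p / p'"
definition V :: real where "V = w 0 T + T + 1"
definition Q :: real where "Q = 12 * \<kappa> * V\<^sup>2"
definition c :: real where "c = control_scale \<kappa> p' V"
definition v :: "real \<Rightarrow> real \<Rightarrow> real" where "v s t = w s t + (t - s)"
definition \<omega> :: "real \<Rightarrow> real \<Rightarrow> real" where "\<omega> s t = c * v s t"
definition W :: real where "W = c * V"
definition rate :: "nat \<Rightarrow> real" where
  "rate n = mesh (N n) (\<tau> n) powr (1 - 1 / q) + \<epsilon>1 n powr \<eta> + \<epsilon>2 n powr \<eta>"

lemma exponent_facts:
  "0 < \<alpha>" "\<alpha> \<le> \<beta>" "\<beta> \<le> 1" "1 < \<alpha> + \<beta>" "\<beta> \<le> 2 / p" "2 / p \<le> \<beta> + 1"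
  "\<beta> \<le> 2 * \<alpha>" "2 * \<alpha> \<le> \<beta> + 1" "\<beta> \<le> 1 / q" "1 / q \<le> \<beta> + 1" "\<alpha> \<le> 1 / p" "1 / p \<le> \<alpha> + 1" "0 < \<eta>" "\<eta> \<le> 1"
  "0 < \<beta>"
proof -
  define x y z where "x = 1 / p'" and "y = 1 / p" and "z = 1 / q"
  have a: "1/3 < x" "x < 1/2" "x \<le> y" "y < 1/2" "1/2 < z" "z < 1" "1 < x + z"
    using pp q by (auto simp: x_def y_def z_def field_simps)
  have b: "\<alpha> = x" "\<beta> = min (2 * x) z" "1 / p = y" "2 / p = 2 * y" "1 / q = z"
    by (simp_all add: \<alpha>_def \<beta>_def x_def y_def z_def)
  show "0 < \<alpha>" "\<alpha> \<le> \<beta>" "\<beta> \<le> 1" "1 < \<alpha> + \<beta>" "\<beta> \<le> 2 / p" "2 / p \<le> \<beta> + 1"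
    "\<beta> \<le> 2 * \<alpha>" "2 * \<alpha> \<le> \<beta> + 1" "\<beta> \<le> 1 / q" "1 / q \<le> \<beta> + 1" "\<alpha> \<le> 1 / p" "1 / p \<le> \<alpha> + 1" "0 < \<beta>"
    using a unfolding b min_def by auto
  show "0 < \<eta>" "\<eta> \<le> 1" using pp by (auto simp: \<eta>_def)
qed

lemma w_nonneg: "0 \<le> s \<Longrightarrow> s \<le> t \<Longrightarrow> t \<le> T \<Longrightarrow> 0 \<le> w s t"
  by (rule control_nonneg[OF w_bounds(1)])

lemma v_range:
  assumes "0 \<le> s" "s \<le> t" "t \<le> T"
  shows "0 \<le> v s t" "v s t \<le> V" "w s t \<le> v s t" "t - s \<le> v s t"
  using w_nonneg[OF assms] control_mono[OF w_bounds(1), of 0 s t T] assms by (auto simp: v_def V_def)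

lemma V_ge_1: "1 \<le> V"
  using w_nonneg[of 0 T] T by (simp add: V_def)

lemma Q_bounds:
  assumes "0 \<le> r" "r \<le> 12"
  shows "r * V \<le> Q" "r * \<kappa> * V \<le> Q" "r * V\<^sup>2 \<le> Q" "r * \<kappa> * V\<^sup>2 \<le> Q" "1 \<le> Q"
proof -
  have V: "V \<le> V\<^sup>2" "1 \<le> V\<^sup>2" using V_ge_1 self_le_power[of V 2] by auto
  have k: "1 \<le> \<kappa>" by (rule \<kappa>_ge_1)
  show 4: "r * \<kappa> * V\<^sup>2 \<le> Q"
    unfolding Q_def using assms k by (intro mult_right_mono) auto
  have "r * 1 * V\<^sup>2 \<le> r * \<kappa> * V\<^sup>2" using assms k by (intro mult_right_mono mult_left_mono) auto
  with 4 show 3: "r * V\<^sup>2 \<le> Q" by simp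
  have "r * V \<le> r * V\<^sup>2" "r * \<kappa> * V \<le> r * \<kappa> * V\<^sup>2" using assms k V by (auto intro!: mult_left_mono)
  with 3 4 show "r * V \<le> Q" "r * \<kappa> * V \<le> Q" by auto
  have "1 * 1 \<le> (12 * \<kappa>) * V\<^sup>2" using k V by (intro mult_mono) auto
  then show "1 \<le> Q" by (simp add: Q_def)
qed

lemma c_facts: "1 \<le> c" "c powr \<alpha> = Q" "Q \<le> c powr \<beta>"
proof -
  have Q: "1 \<le> Q" using Q_bounds(5)[of 0] by simp
  have c: "c = Q powr p'" by (simp add: c_def control_scale_def Q_def)
  show c1: "1 \<le> c" unfolding c using Q pp by (intro ge_one_powr_ge_zero) auto
  show e: "c powr \<alpha> = Q" unfolding c using Q pp by (simp add: powr_powr \<alpha>_def)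
  have "c powr \<alpha> \<le> c powr \<beta>" using c1 exponent_facts by (intro powr_mono) auto
  then show "Q \<le> c powr \<beta>" using e by simp
qed

lemma scale_up:
  assumes "0 \<le> s" "s \<le> t" "t \<le> T" "0 \<le> a" "r \<le> Q"
  shows "x \<le> r * (a * v s t powr \<alpha>) \<Longrightarrow> x \<le> a * \<omega> s t powr \<alpha>"
    "x \<le> r * (a * v s t powr \<beta>) \<Longrightarrow> x \<le> a * \<omega> s t powr \<beta>"
proof -
  have "r * (a * v s t powr \<alpha>) \<le> c powr \<alpha> * (a * v s t powr \<alpha>)"
    "r * (a * v s t powr \<beta>) \<le> c powr \<beta> * (a * v s t powr \<beta>)"
    using assms c_facts by (auto intro!: mult_right_mono)
  moreover have "\<omega> s t powr \<alpha> = c powr \<alpha> * v s t powr \<alpha>" "\<omega> s t powr \<beta> = c powr \<beta> * v s t powr \<beta>"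
    unfolding \<omega>_def by (rule powr_mult)+
  ultimately show "x \<le> r * (a * v s t powr \<alpha>) \<Longrightarrow> x \<le> a * \<omega> s t powr \<alpha>"
    "x \<le> r * (a * v s t powr \<beta>) \<Longrightarrow> x \<le> a * \<omega> s t powr \<beta>"
    by (simp_all add: mult.left_commute)
qed

lemma v_lower:
  assumes "0 \<le> s" "s \<le> t" "t \<le> T" "a \<le> d" "d \<le> a + 1"
  shows "v s t powr d \<le> V * v s t powr a"
  using v_range[OF assms(1-3)] V_ge_1 assms(4,5) by (intro powr_lower_exponent) auto

lemma increment_v:
  assumes "0 \<le> s" "s \<le> t" "t \<le> T"
  shows "norm (X t - X s) \<le> v s t powr (1 / p)" "norm (X t - X s) \<le> V * v s t powr \<alpha>"
    "norm (X t - X s) \<le> V"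
proof -
  have "w s t powr (1 / p) \<le> v s t powr (1 / p)"
    using v_range[OF assms] w_nonneg[OF assms] p0 by (intro powr_mono2) auto
  then show 1: "norm (X t - X s) \<le> v s t powr (1 / p)" using w_bounds(2)[OF assms] by linarith
  then show "norm (X t - X s) \<le> V * v s t powr \<alpha>"
    using v_lower[OF assms, of \<alpha> "1 / p"] exponent_facts by linarith
  have "v s t powr (1 / p) \<le> V powr (1 / p)" using v_range[OF assms] p0 by (intro powr_mono2) auto
  also have "\<dots> \<le> V powr 1" using pp V_ge_1 by (intro powr_mono) auto
  finally show "norm (X t - X s) \<le> V" using 1 V_ge_1 by simp
qed

lemma w_v: "0 \<le> s \<Longrightarrow> s \<le> t \<Longrightarrow> t \<le> T \<Longrightarrow> w s t powr (2 / p) \<le> v s t powr (2 / p)"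
  using v_range[of s t] w_nonneg[of s t] p0 by (intro powr_mono2) auto

lemma driver_everywhere:
  assumes st: "0 \<le> s" "s < t" "t \<le> T"
  shows "driver_bound \<alpha> \<beta> X XX \<omega> 1 s t"
  unfolding driver_bound_def \<kappa>_eq
proof (intro conjI)
  have st': "0 \<le> s" "s \<le> t" "t \<le> T" using st by auto
  note up = scale_up[OF st', of 1]
  have lo: "v s t powr (2 / p) \<le> V * v s t powr \<beta>" by (rule v_lower[OF st']) (use exponent_facts in auto)
  show "norm (X t - X s) \<le> 1 * \<omega> s t powr \<alpha>"
    by (rule up(1)[of "1 * V"]) (use Q_bounds(1)[of 1] increment_v(2)[OF st'] in auto)
  show "(norm (X t - X s))\<^sup>2 \<le> 1 * \<omega> s t powr \<beta>"
  proof (rule up(2)[of "1 * V"])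
    have "(norm (X t - X s))\<^sup>2 \<le> (v s t powr (1 / p))\<^sup>2" using increment_v(1)[OF st'] by (intro power_mono) auto
    also have "\<dots> = v s t powr (2 / p)" by (simp add: power2_eq_square flip: powr_add)
    finally show "(norm (X t - X s))\<^sup>2 \<le> 1 * V * (1 * v s t powr \<beta>)" using lo by simp
  qed (use Q_bounds(1)[of 1] in auto)
  show "\<kappa> * norm (XX s t) \<le> 1 * \<omega> s t powr \<beta>"
  proof (rule up(2)[of "3 * \<kappa> * V"])
    have "\<kappa> * norm (XX s t) \<le> \<kappa> * (3 * (V * v s t powr \<beta>))"
      using XX_bound[OF st] w_v[OF st'] lo \<kappa>_ge_1 by (intro mult_left_mono) auto
    then show "\<kappa> * norm (XX s t) \<le> 3 * \<kappa> * V * (1 * v s t powr \<beta>)" by (simp add: algebra_simps)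
  qed (use Q_bounds(2)[of 3] in auto)
  show "t - s \<le> 1 * \<omega> s t powr \<beta>"
  proof (rule up(2)[of "1 * V"])
    have "v s t powr 1 \<le> V * v s t powr \<beta>" by (rule v_lower[OF st']) (use exponent_facts in auto)
    then show "t - s \<le> 1 * V * (1 * v s t powr \<beta>)" using v_range[OF st'] by simp
  qed (use Q_bounds(1)[of 1] in auto)
qed

lemma rate_parts:
  "0 \<le> rate n" "mesh (N n) (\<tau> n) powr (1 - 1 / q) \<le> rate n" "\<epsilon>1 n powr \<eta> \<le> rate n" "\<epsilon>2 n powr \<eta> \<le> rate n"
  "\<epsilon>1 n powr \<eta> + \<epsilon>2 n powr \<eta> \<le> rate n"
  by (auto simp: rate_def)

lemma second_level_interpolation:
  assumes st: "0 \<le> s" "s \<le> t" "t \<le> T" and x: "0 \<le> x" "x \<le> r * E" "x \<le> B * v s t powr (2 / p)"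
    and B: "1 \<le> B" and r: "1 \<le> r" and E: "E powr \<eta> \<le> rate n"
  shows "x \<le> r * B * V * (rate n * v s t powr \<beta>)"
proof -
  have "x \<le> (r * E) powr (1 - p / p') * (B * v s t powr (2 / p'))"
    using pp by (intro interpolation_powr x B) auto
  also have "\<dots> \<le> (r * rate n) * (B * (V * v s t powr \<beta>))"
  proof (intro mult_mono mult_left_mono)
    have "(r * E) powr \<eta> \<le> r * E powr \<eta>" using r exponent_facts by (intro powr_mult_le) auto
    also have "\<dots> \<le> r * rate n" using E r by (intro mult_left_mono) auto
    finally show "(r * E) powr (1 - p / p') \<le> r * rate n" by (simp add: \<eta>_def)
    have "v s t powr (2 * \<alpha>) \<le> V * v s t powr \<beta>" using exponent_facts by (intro v_lower[OF st]) auto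
    then show "v s t powr (2 / p') \<le> V * v s t powr \<beta>" by (simp add: \<alpha>_def)
  qed (use B r rate_parts in auto)
  finally show ?thesis by (simp add: algebra_simps)
qed

text \<open>First level: both values are within \<open>\<epsilon>1\<close> of the value at the left end of the cell.  Second level:
  the difference to the Riemann sum is at most \<open>2 \<epsilon>2\<close>, and the second level of the Riemann sum in the
  cell is a product of two increments of X.  Time: a cell is no longer than the mesh.  Each bound is
  interpolated with the corresponding variation bound.\<close>

lemma driver_in_cell:
  assumes k: "k < N n" and sx: "\<tau> n k \<le> s" "s < t" "t < \<tau> n (Suc k)"
  shows "driver_bound \<alpha> \<beta> X XX \<omega> (rate n) s t"
  unfolding driver_bound_def \<kappa>_eq
proof (intro conjI)
  have st: "0 \<le> s" "s < t" "t \<le> T" using grid[of k n] grid[of "Suc k" n] k sx by auto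
  then have st': "0 \<le> s" "s \<le> t" "t \<le> T" by auto
  note up = scale_up[OF st' rate_parts(1)]
  let ?x = "norm (X t - X s)"
  have cs: "norm (X s - X (\<tau> n k)) \<le> \<epsilon>1 n" "norm (X t - X (\<tau> n k)) \<le> \<epsilon>1 n"
    using cell_close[OF k, of s] cell_close[OF k, of t] sx by auto
  have x2: "?x \<le> 2 * \<epsilon>1 n"
    using norm_diff_le2[of "X t - X s" "X t - X (\<tau> n k)" "X s - X (\<tau> n k)"] cs by simp
  have X1: "?x \<le> 2 * (rate n * v s t powr \<alpha>)"
  proof -
    have "?x \<le> (2 * \<epsilon>1 n) powr (1 - p / p') * (1 * v s t powr (1 / p'))"
      using pp x2 increment_v(1)[OF st'] by (intro interpolation_powr) auto
    also have "\<dots> \<le> (2 * rate n) * (1 * v s t powr (1 / p'))"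
    proof (intro mult_right_mono)
      have "(2 * \<epsilon>1 n) powr \<eta> \<le> 2 * \<epsilon>1 n powr \<eta>" using exponent_facts by (intro powr_mult_le) auto
      then show "(2 * \<epsilon>1 n) powr (1 - p / p') \<le> 2 * rate n" using rate_parts(3)[of n] by (simp add: \<eta>_def)
    qed auto
    finally show ?thesis by (simp add: \<alpha>_def algebra_simps)
  qed
  have "2 \<le> Q" using Q_bounds(1)[of 2] V_ge_1 by simp
  then show "norm (X t - X s) \<le> rate n * \<omega> s t powr \<alpha>" by (rule up(1)[OF _ X1])
  show "(norm (X t - X s))\<^sup>2 \<le> rate n * \<omega> s t powr \<beta>"
  proof (rule up(2)[of "2 * V\<^sup>2"])
    have "(norm (X t - X s))\<^sup>2 \<le> 2 * (rate n * v s t powr \<alpha>) * (V * v s t powr \<alpha>)"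
      unfolding power2_eq_square using X1 increment_v(2)[OF st'] rate_parts(1) by (intro mult_mono) auto
    also have "\<dots> = 2 * V * rate n * v s t powr (2 * \<alpha>)"
      by (simp add: powr_add[symmetric] algebra_simps flip: mult_2)
    also have "\<dots> \<le> 2 * V * rate n * (V * v s t powr \<beta>)"
      using V_ge_1 rate_parts(1) exponent_facts by (intro mult_left_mono v_lower[OF st']) auto
    finally show "(norm (X t - X s))\<^sup>2 \<le> 2 * V\<^sup>2 * (rate n * v s t powr \<beta>)"
      by (simp add: power2_eq_square algebra_simps)
  qed (use Q_bounds(3)[of 2] in auto)
  show "\<kappa> * norm (XX s t) \<le> rate n * \<omega> s t powr \<beta>"
  proof (rule up(2)[of "12 * \<kappa> * V\<^sup>2"])
    define E where "E = max (\<epsilon>1 n) (\<epsilon>2 n)"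
    have E: "E powr \<eta> \<le> rate n" using rate_parts(3,4)[of n] by (simp add: E_def max_def)
    have E0: "0 \<le> E" "\<epsilon>1 n \<le> E" "\<epsilon>2 n \<le> E" using \<epsilon>_nonneg[of n] by (auto simp: E_def)
    have a: "norm (XN n s t) \<le> E * V"
    proof -
      have "norm (XN n s t) \<le> norm (X s - X (\<tau> n k)) * norm (X t - X s)"
        using second_level_riemann_in_cell[OF part k sx(1), of t X] sx norm_tensor[of "X s - X (\<tau> n k)" "X t - X s"]
        by simp
      also have "\<dots> \<le> E * V" using cs E0 increment_v(3)[OF st'] by (intro mult_mono) auto
      finally show ?thesis .
    qed
    have d: "norm (XX s t - XN n s t) \<le> 2 * E"
    proof -
      have "XX s t - XN n s t = (J n s - I s) - (J n t - I t)" by (simp add: second_level_diff)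
      from norm_diff_le2[OF this] J_close[of s n] J_close[of t n] E0 st show ?thesis by simp
    qed
    have "norm (XX s t) \<le> norm (XN n s t) + norm (XX s t - XN n s t)" by (rule norm_add_le2) simp
    also have "\<dots> \<le> E * V + 2 * E * V"
      using a d mult_left_mono[OF V_ge_1, of "2 * E"] E0 by (intro add_mono) auto
    also have "\<dots> \<le> 4 * V * E" using V_ge_1 E0 by simp
    finally have "norm (XX s t) \<le> 4 * V * E" .
    then have "norm (XX s t) \<le> 4 * V * 3 * V * (rate n * v s t powr \<beta>)"
      using XX_bound[OF st] w_v[OF st'] V_ge_1 by (intro second_level_interpolation[OF st' _ _ _ _ _ E]) auto
    then have "\<kappa> * norm (XX s t) \<le> \<kappa> * (4 * V * 3 * V * (rate n * v s t powr \<beta>))"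
      using \<kappa>_ge_1 by (intro mult_left_mono) auto
    then show "\<kappa> * norm (XX s t) \<le> 12 * \<kappa> * V\<^sup>2 * (rate n * v s t powr \<beta>)"
      by (simp add: power2_eq_square algebra_simps)
  qed (use Q_bounds(4)[of 12] in auto)
  show "t - s \<le> rate n * \<omega> s t powr \<beta>"
  proof (rule up(2)[of "1 * V"])
    have m: "t - s \<le> mesh (N n) (\<tau> n)"
    proof -
      have "\<bar>\<tau> n (Suc k) - \<tau> n k\<bar> \<le> mesh (N n) (\<tau> n)"
        unfolding mesh_def using k by (intro Max_ge) auto
      then show ?thesis using sx by linarith
    qed
    have qe: "0 \<le> 1 - 1 / q" "0 \<le> 1 / q" using q by (auto simp: field_simps)
    have "t - s = (t - s) powr (1 - 1 / q) * (t - s) powr (1 / q)" using st by (simp flip: powr_add)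
    also have "\<dots> \<le> mesh (N n) (\<tau> n) powr (1 - 1 / q) * v s t powr (1 / q)"
      using m st v_range(4)[OF st'] qe by (intro mult_mono powr_mono2) auto
    also have "\<dots> \<le> rate n * (V * v s t powr \<beta>)"
      using rate_parts(1,2)[of n] v_lower[OF st', of \<beta> "1 / q"] exponent_facts by (intro mult_mono) auto
    finally show "t - s \<le> 1 * V * (rate n * v s t powr \<beta>)" by (simp add: algebra_simps)
  qed (use Q_bounds(1)[of 1] in auto)
qed

text \<open>Between grid points the first levels agree, so the second levels differ by increments of the difference
  of the two primitives.\<close>

lemma grid_second_level:
  assumes kl: "k < l" "l \<le> N n"
  shows "\<kappa> * norm (XN n (\<tau> n k) (\<tau> n l)) \<le> \<omega> (\<tau> n k) (\<tau> n l) powr \<beta>"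
    "\<kappa> * norm (XX (\<tau> n k) (\<tau> n l) - XN n (\<tau> n k) (\<tau> n l)) \<le> rate n * \<omega> (\<tau> n k) (\<tau> n l) powr \<beta>"
proof -
  let ?s = "\<tau> n k" and ?t = "\<tau> n l"
  have st: "0 \<le> ?s" "?s < ?t" "?t \<le> T"
    using grid[of k n] grid[of l n] interval_partition_strict_mono[OF part kl] kl by auto
  then have st': "0 \<le> ?s" "?s \<le> ?t" "?t \<le> T" by auto
  have k1: "1 \<le> \<kappa>" by (rule \<kappa>_ge_1)
  have lo: "v ?s ?t powr (2 / p) \<le> V * v ?s ?t powr \<beta>" by (rule v_lower[OF st']) (use exponent_facts in auto)
  have n: "norm (XN n ?s ?t) \<le> v ?s ?t powr (2 / p)"
    using w_bounds(3)[of k l n] kl w_v[OF st'] by auto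
  have "\<kappa> * norm (XN n ?s ?t) \<le> 1 * \<omega> ?s ?t powr \<beta>"
  proof (rule scale_up(2)[OF st', of 1 "1 * \<kappa> * V"])
    have "\<kappa> * norm (XN n ?s ?t) \<le> \<kappa> * (V * v ?s ?t powr \<beta>)"
      using n lo k1 by (intro mult_left_mono) auto
    then show "\<kappa> * norm (XN n ?s ?t) \<le> 1 * \<kappa> * V * (1 * v ?s ?t powr \<beta>)" by (simp add: algebra_simps)
  qed (use Q_bounds(2)[of 1] in auto)
  then show "\<kappa> * norm (XN n ?s ?t) \<le> \<omega> ?s ?t powr \<beta>" by simp
  show "\<kappa> * norm (XX ?s ?t - XN n ?s ?t) \<le> rate n * \<omega> ?s ?t powr \<beta>"
  proof (rule scale_up(2)[OF st' rate_parts(1), of "8 * \<kappa> * V"])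
    have "XX ?s ?t - XN n ?s ?t = (J n ?s - I ?s) - (J n ?t - I ?t)" by (simp add: second_level_diff)
    from norm_diff_le2[OF this] have d: "norm (XX ?s ?t - XN n ?s ?t) \<le> 2 * \<epsilon>2 n"
      using J_close[of ?s n] J_close[of ?t n] st by simp
    have "norm (XX ?s ?t - XN n ?s ?t) \<le> norm (XX ?s ?t) + norm (XN n ?s ?t)" by (rule norm_triangle_ineq4)
    also have "\<dots> \<le> 4 * v ?s ?t powr (2 / p)" using XX_bound[OF st] w_v[OF st'] n by simp
    finally have "norm (XX ?s ?t - XN n ?s ?t) \<le> 2 * 4 * V * (rate n * v ?s ?t powr \<beta>)"
      using d by (intro second_level_interpolation[OF st' _ _ _ _ _ rate_parts(4)]) auto
    then have "\<kappa> * norm (XX ?s ?t - XN n ?s ?t) \<le> \<kappa> * (2 * 4 * V * (rate n * v ?s ?t powr \<beta>))"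
      using k1 by (intro mult_left_mono) auto
    then show "\<kappa> * norm (XX ?s ?t - XN n ?s ?t) \<le> 8 * \<kappa> * V * (rate n * v ?s ?t powr \<beta>)"
      by (simp add: algebra_simps)
  qed (use Q_bounds(2)[of 8] in auto)
qed

lemma \<omega>_facts: "control T \<omega>" "\<omega> 0 T \<le> W" "1 \<le> W"
proof -
  show "control T \<omega>"
    unfolding control_def simplex2_def
  proof (intro conjI allI impI; clarify)
    show "0 \<le> \<omega> s t" if "0 \<le> s" "s \<le> t" "t \<le> T" for s t
      using v_range(1)[OF that] c_facts by (simp add: \<omega>_def)
    show "\<omega> s u + \<omega> u t \<le> \<omega> s t" if "0 \<le> s" "s \<le> u" "u \<le> t" "t \<le> T" for s u t
    proof -
      have "v s u + v u t \<le> v s t" using control_add[OF w_bounds(1) that] by (simp add: v_def)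
      then have "c * (v s u + v u t) \<le> c * v s t" using c_facts by (intro mult_left_mono) auto
      then show ?thesis by (simp add: \<omega>_def distrib_left)
    qed
  qed
  show "\<omega> 0 T \<le> W" using v_range(2)[of 0 T] c_facts T by (simp add: \<omega>_def W_def)
  have "1 * 1 \<le> c * V" using c_facts V_ge_1 by (intro mult_mono) auto
  then show "1 \<le> W" by (simp add: W_def)
qed

end

lemma variation_cong:
  assumes "\<And>t. 0 \<le> t \<Longrightarrow> t \<le> T \<Longrightarrow> X t = Y t"
  shows "variation p T X = variation p T Y"
proof -
  have "(\<Sum>i<N. norm (X (t (Suc i)) - X (t i)) powr p) = (\<Sum>i<N. norm (Y (t (Suc i)) - Y (t i)) powr p)"
    if "interval_partition 0 T N t" for N t
    using interval_partition_bounds[OF that] assms by (intro sum.cong) auto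
  then have "(SUP (N, t) \<in> {(N, t). interval_partition 0 T N t}. ennreal (\<Sum>i<N. norm (X (t (Suc i)) - X (t i)) powr p))
      = (SUP (N, t) \<in> {(N, t). interval_partition 0 T N t}. ennreal (\<Sum>i<N. norm (Y (t (Suc i)) - Y (t i)) powr p))"
    by (intro SUP_cong) auto
  then show ?thesis unfolding variation_def variation2_def by simp
qed

definition euler_const :: "real \<Rightarrow> real \<Rightarrow> real \<Rightarrow> real \<Rightarrow> real \<Rightarrow> real \<Rightarrow> real" where
  "euler_const \<kappa> p' q L T w\<^sub>T = (let V = w\<^sub>T + T + 1; W = control_scale \<kappa> p' V * V
     in rough_equation.c9 L (1 / p') (min (2 / p') (1 / q)) W * (2 * W))"

text \<open>The Euler scheme at the grid points is an instance of the abstract comparison: the Riemann sums provide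
  the second level of the scheme, and the rate plays the part of e.\<close>

lemma (in RIE_driver) euler_rate:
  fixes \<sigma> :: "real \<times> (real^'k) \<Rightarrow> (real^'d) \<Rightarrow>\<^sub>L (real^'k)"
  assumes L: "1 \<le> L" "C3b \<sigma>" "C3b_norm \<sigma> \<le> L" "C2b b" "C2b_norm b \<le> L"
    and sol: "solves_RDE p T X (canonical_lift N \<tau> X) y0 b \<sigma> Y"
    and euler: "euler_approximation T (N n) (\<tau> n) X y0 b \<sigma> Yn"
  shows "variation p' T (\<lambda>t. Yn t - Y t) \<le> ennreal (euler_const \<kappa> p' q L T (w 0 T) * rate n)"
proof -
  have "\<exists>K. rough_equation L \<sigma> T \<alpha> \<beta> W \<omega> X XX b Y y0 K"
    using sol unfolding canonical_lift_eq
    by (rule solution_is_rough_equation[OF _ p0 L])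
      (use exponent_facts \<omega>_facts driver_everywhere second_level_chen in auto)
  then obtain K where "rough_equation L \<sigma> T \<alpha> \<beta> W \<omega> X XX b Y y0 K" by blast
  then interpret rough_equation L \<sigma> T \<alpha> \<beta> W \<omega> X XX b Y y0 K .
  note at_grid = euler_at_grid[OF part euler]
  have t0: "\<tau> n 0 = 0" using part[of n] by (simp add: interval_partition_def)
  interpret euler_comparison L \<sigma> T \<alpha> \<beta> W \<omega> X XX b Y y0 K "N n" "\<tau> n" "XN n" "rate n" "\<lambda>k. Yn (\<tau> n k)"
  proof unfold_locales
    show "XN n (\<tau> n k) (\<tau> n (Suc k)) = 0" if "k < N n" for k
      using second_level_riemann_in_cell[OF part that, of "\<tau> n k" "\<tau> n (Suc k)" X]
        interval_partition_mono[OF part, of k "Suc k" n] that by (simp add: tensor_linear)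
    show "Yn (\<tau> n 0) = Y 0"
      using at_grid[of 0] solution_at_0[OF sol] T by simp
    show "Yn (\<tau> n (Suc k)) = Yn (\<tau> n k) + (\<tau> n (Suc k) - \<tau> n k) *\<^sub>R b (\<tau> n k, Yn (\<tau> n k))
        + \<sigma> (\<tau> n k, Yn (\<tau> n k)) (X (\<tau> n (Suc k)) - X (\<tau> n k))" if "k < N n" for k
      using at_grid[of k] at_grid[of "Suc k"] that by simp
  qed (use part rate_parts second_level_chen grid_second_level driver_in_cell in \<open>auto simp: \<kappa>_eq\<close>)
  have path: "euler_path t = Yn t" if t: "0 \<le> t" "t \<le> T" for t
  proof -
    let ?k = "cell_index t"
    have k: "?k \<le> N n" "\<tau> n ?k \<le> t" using cell_index(1,2)[of t] t by auto
    have "\<tau> n (Suc i) \<le> t \<longleftrightarrow> \<tau> n (Suc i) \<le> \<tau> n ?k" if "i < N n" for i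
      using cell_index(3)[of t "Suc i"] t that k interval_partition_mono[OF part, of "Suc i" ?k n] by force
    then have "{i. i < N n \<and> \<tau> n (Suc i) \<le> t} = {i. i < N n \<and> \<tau> n (Suc i) \<le> \<tau> n ?k}" by auto
    then show ?thesis
      using euler t grid[of ?k n] k unfolding euler_approximation_def euler_path_def by auto
  qed
  have "variation p' T (\<lambda>t. Yn t - Y t) = variation (1 / \<alpha>) T (\<lambda>t. euler_path t - Y t)"
  proof -
    have "1 / \<alpha> = p'" by (simp add: \<alpha>_def)
    then show ?thesis using path by (simp, intro variation_cong) simp
  qed
  also have "\<dots> \<le> ennreal (c9 * (2 * W) * rate n)" by (rule variation_path_error)
  also have "c9 * (2 * W) = euler_const \<kappa> p' q L T (w 0 T)"
    by (simp add: euler_const_def Let_def W_def V_def c_def \<alpha>_def \<beta>_def)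
  finally show ?thesis .
qed

lemma C2b_norm_nonneg: "C2b f \<Longrightarrow> 0 \<le> C2b_norm f"
  using C0b_sup_norm(2)[of f] C0b_sup_norm(2)[of "Dblin f"] C0b_sup_norm(2)[of "Dblin (Dblin f)"]
  by (simp add: C2b_def C1b_def C2b_norm_def)

lemma C3b_norm_nonneg: "C3b f \<Longrightarrow> 0 \<le> C3b_norm f"
  using C0b_sup_norm(2)[of f] C0b_sup_norm(2)[of "Dblin f"] C0b_sup_norm(2)[of "Dblin (Dblin f)"]
    C0b_sup_norm(2)[of "Dblin (Dblin (Dblin f))"]
  by (simp add: C3b_def C2b_def C1b_def C3b_norm_def)

lemma (in RIE_driver) rate_tendsto_0: "rate \<longlonglongrightarrow> 0"
proof -
  have m: "(\<lambda>n. mesh (N n) (\<tau> n)) \<longlonglongrightarrow> 0" using RIE by (simp add: property_RIE_def)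
  have m0: "0 \<le> mesh (N n) (\<tau> n)" for n unfolding mesh_def by (intro Max_ge) auto
  have "(\<lambda>n. mesh (N n) (\<tau> n) powr (1 - 1 / q)) \<longlonglongrightarrow> 0"
    using q m0 by (intro tendsto_zero_powrI[OF m tendsto_const]) (auto simp: field_simps)
  moreover have "(\<lambda>n. \<epsilon>1 n powr \<eta>) \<longlonglongrightarrow> 0"
    using exponent_facts \<epsilon>_nonneg by (intro tendsto_zero_powrI[OF \<epsilon>_tendsto(1) tendsto_const]) auto
  moreover have "(\<lambda>n. \<epsilon>2 n powr \<eta>) \<longlonglongrightarrow> 0"
    using exponent_facts \<epsilon>_nonneg by (intro tendsto_zero_powrI[OF \<epsilon>_tendsto(2) tendsto_const]) auto
  ultimately show ?thesis unfolding rate_def[abs_def] using tendsto_add[OF tendsto_add, of _ 0 _ _ 0 _ 0] by simp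
qed


section \<open>Convergence of the Euler scheme\<close>

theorem theorem2p3:
  shows "\<exists>C :: real \<Rightarrow> real \<Rightarrow> real \<Rightarrow> real \<Rightarrow> real \<Rightarrow> real \<Rightarrow> real \<Rightarrow> real \<Rightarrow> real.
    \<forall>(p :: real) (T :: real) (N :: nat \<Rightarrow> nat) (\<tau> :: nat \<Rightarrow> nat \<Rightarrow> real)
      (X :: real \<Rightarrow> real^'d) (w :: real \<Rightarrow> real \<Rightarrow> real) (y0 :: real^'k)
      (b :: real \<times> (real^'k) \<Rightarrow> real^'k)
      (\<sigma> :: real \<times> (real^'k) \<Rightarrow> (real^'d) \<Rightarrow>\<^sub>L (real^'k))
      (Y :: real \<Rightarrow> real^'k) (Yn :: nat \<Rightarrow> real \<Rightarrow> real^'k).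
    0 < T \<and> 2 < p \<and> p < 3
    \<and> (\<forall>n. interval_partition 0 T (N n) (\<tau> n))
    \<and> property_RIE p T N \<tau> X \<and> RIE_control p T N \<tau> X w
    \<and> C2b b \<and> C3b \<sigma>
    \<and> solves_RDE p T X (canonical_lift N \<tau> X) y0 b \<sigma> Y
    \<and> (\<forall>n. euler_approximation T (N n) (\<tau> n) X y0 b \<sigma> (Yn n))
    \<longrightarrow>
    (\<forall>p'. p < p' \<and> p' < 3 \<longrightarrow>
       (\<lambda>n. variation p' T (\<lambda>t. Yn n t - Y t)) \<longlonglongrightarrow> 0
       \<and> (\<forall>q. 1 < q \<and> q < 2 \<and> 1 / p' + 1 / q > 1 \<longrightarrow>
            (\<forall>n. variation p' T (\<lambda>t. Yn n t - Y t)
               \<le> ennreal (C p p' q (C2b_norm b) (C3b_norm \<sigma>) T (norm (X 0)) (w 0 T)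
                   * (mesh (N n) (\<tau> n) powr (1 - 1 / q)
                      + sup_norm {0..T} (\<lambda>t. discretization T (N n) (\<tau> n) X t - X t)
                          powr (1 - p / p')
                      + sup_norm {0..T} (\<lambda>t. riemann_sum (N n) (\<tau> n) X t - RIE_integral N \<tau> X t)
                          powr (1 - p / p'))))))"
proof -
  define C :: "real \<Rightarrow> real \<Rightarrow> real \<Rightarrow> real \<Rightarrow> real \<Rightarrow> real \<Rightarrow> real \<Rightarrow> real \<Rightarrow> real"
    where "C p p' q nb n\<sigma> T x\<^sub>0 w\<^sub>T = euler_const (contraction_const TYPE('d)) p' q (1 + nb + n\<sigma>) T w\<^sub>T"
    for p p' q nb n\<sigma> T x\<^sub>0 w\<^sub>T
  have main: "(\<lambda>n. variation p' T (\<lambda>t. Yn n t - Y t)) \<longlonglongrightarrow> 0 \<and> (\<forall>q. 1 < q \<and> q < 2 \<and> 1 / p' + 1 / q > 1 \<longrightarrow>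
            (\<forall>n. variation p' T (\<lambda>t. Yn n t - Y t)
               \<le> ennreal (C p p' q (C2b_norm b) (C3b_norm \<sigma>) T (norm (X 0)) (w 0 T)
                   * (mesh (N n) (\<tau> n) powr (1 - 1 / q)
                      + sup_norm {0..T} (\<lambda>t. discretization T (N n) (\<tau> n) X t - X t)
                          powr (1 - p / p')
                      + sup_norm {0..T} (\<lambda>t. riemann_sum (N n) (\<tau> n) X t - RIE_integral N \<tau> X t)
                          powr (1 - p / p')))))"
    if h: "0 < T" "2 < p" "p < 3" "\<forall>n. interval_partition 0 T (N n) (\<tau> n)"
      "property_RIE p T N \<tau> X" "RIE_control p T N \<tau> X w" "C2b b" "C3b \<sigma>"
      "solves_RDE p T X (canonical_lift N \<tau> X) y0 b \<sigma> Y"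
      "\<forall>n. euler_approximation T (N n) (\<tau> n) X y0 b \<sigma> (Yn n)" and p': "p < p'" "p' < 3"
    for p T :: real and N :: "nat \<Rightarrow> nat" and \<tau> :: "nat \<Rightarrow> nat \<Rightarrow> real"
      and X :: "real \<Rightarrow> real^'d" and w :: "real \<Rightarrow> real \<Rightarrow> real" and y0 :: "real^'k"
      and b :: "real \<times> (real^'k) \<Rightarrow> real^'k"
      and \<sigma> :: "real \<times> (real^'k) \<Rightarrow> (real^'d) \<Rightarrow>\<^sub>L (real^'k)"
      and Y :: "real \<Rightarrow> real^'k" and Yn :: "nat \<Rightarrow> real \<Rightarrow> real^'k" and p' :: real
  proof -
    define L where "L = 1 + C2b_norm b + C3b_norm \<sigma>"
    have L: "1 \<le> L" "C3b_norm \<sigma> \<le> L" "C2b_norm b \<le> L"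
      using C2b_norm_nonneg[OF h(7)] C3b_norm_nonneg[OF h(8)] by (auto simp: L_def)
    have driver: "RIE_driver p p' q T N \<tau> X w (contraction_const TYPE('d))"
      if "1 < q" "q < 2" "1 / p' + 1 / q > 1" for q
      using h p' that by unfold_locales auto
    have bound: "variation p' T (\<lambda>t. Yn n t - Y t)
        \<le> ennreal (euler_const (contraction_const TYPE('d)) p' q L T (w 0 T) * RIE_driver.rate p p' q T N \<tau> X n)"
      if "1 < q" "q < 2" "1 / p' + 1 / q > 1" for q n
      using RIE_driver.euler_rate[OF driver[OF that] L(1) h(8) L(2) h(7) L(3) h(9)] h(10) by blast
    \<comment> \<open>For the mere convergence any admissible q will do; one exists since \<open>1 - 1 / p'\<close> lies above \<open>1 / 2\<close>
      and below 1.\<close>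
    obtain q where q: "1 < q" "q < 2" "1 / p' + 1 / q > 1"
    proof -
      have "1 / p' < 1 / 2" "0 < 1 / p'" using h p' by (auto simp: field_simps)
      then obtain r where r: "1 - 1 / p' < r" "r < 1" using dense[of "1 - 1 / p'" 1] by auto
      then have r2: "1 / 2 < r" using \<open>1 / p' < 1 / 2\<close> by linarith
      show thesis
        by (rule that[of "1 / r"]) (use r r2 in \<open>auto simp: field_simps\<close>)
    qed
    have "(\<lambda>n. euler_const (contraction_const TYPE('d)) p' q L T (w 0 T) * RIE_driver.rate p p' q T N \<tau> X n)
        \<longlonglongrightarrow> euler_const (contraction_const TYPE('d)) p' q L T (w 0 T) * 0"
      by (intro tendsto_mult_left RIE_driver.rate_tendsto_0[OF driver[OF q]])
    then have lim: "(\<lambda>n. ennreal (euler_const (contraction_const TYPE('d)) p' q L T (w 0 T) * RIE_driver.rate p p' q T N \<tau> X n))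
        \<longlonglongrightarrow> 0"
      using tendsto_ennrealI by fastforce
    have "(\<lambda>n. variation p' T (\<lambda>t. Yn n t - Y t)) \<longlonglongrightarrow> 0"
      by (rule tendsto_sandwich[OF _ _ tendsto_const lim]) (auto intro!: always_eventually bound[OF q])
    then show ?thesis
      using bound by (auto simp: C_def L_def RIE_driver.rate_def[OF driver] RIE_driver.\<eta>_def[OF driver])
  qed
  show ?thesis
    by (intro exI[of _ C] allI impI, elim conjE) (rule main)
qed

end
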